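(* Let $\mathcal M$ be a non-standard $\aleph_1$-saturated model of true arithmetic in a language $L$ containing the language of Peano arithmetic and having a canonical interpretation in the standard model. Let $h$ be a polynomial-time permutation with hard bit $B$ as in the context, let $n\in\mathcal M$ be non-standard, $m=n+1$, $\ell=n^{1/3}$, let $\{J_i\}_{i\in[m]}\in\mathcal M$ be a set system with $|J_i|=\ell$ and $|J_i\cap J_j|\le\log(m)$ for $i\neq j$, let $g$ be the associated function and $b\in\{0,1\}^m\setminus Rng(g)$ (all in $\mathcal M$), and let $w\in\mathcal M$ be a string of size polynomial in $n$. Then there exists a set $H\subseteq\{0,1\}^n$ with $H\in\mathcal M$ that is infinite (i.e. of non-standard cardinality in $\mathcal M$) such that every $\alpha\in F^{unif}_w$ is defined on all samples from $H$.
   Context: Assumption on $h$: $h$ is a polynomial-time computable permutation of each $\{0,1\}^\ell$ with a polynomial-time bit $B(v)$ such that for every fixed $k\ge1$ no $\mathsf{P}/poly$ algorithm computes, for large $\ell$, $B(h^{(-1)}(u))$ from $u\in\{0,1\}^\ell$ with advantage better than $\ell^{-k}$ over $1/2$; put $f(u)=B(h^{(-1)}(u))$. For $x\in\{0,1\}^n$ and $J=\{j_1<\dots<j_\ell\}$, $x(J)=x_{j_1}\dots x_{j_\ell}$, and $g:\{0,1\}^n\to\{0,1\}^m$ is $g(x)_i=f(x(J_i))$. These objects are interpreted in $\mathcal M$. $F^{unif}_w$ is the family of partial functions $\alpha:\{0,1\}^n\to\mathcal M$ (random variables on the sample space $\{0,1\}^n$) each computed by a uniform Student: a fixed (standard)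 polynomial-time algorithm, whose only advice is the triple $(\{J_i\}_i,b,w)$, which on input $\omega\in\{0,1\}^n$ may, for some standard constant $c$ (depending on $\alpha$ but not on $\omega$), ask the Teacher successively for up to $c$ values $h^{(-1)}(\omega(J_i))$ for indices $i\in[m]$ computed from $\omega$ and the previous answers; if an answer $v$ to a query with index $i$ does not satisfy $B(v)=b_i$ the computation is aborted and $\alpha(\omega)$ is undefined; otherwise, at the end the Student outputs an element of $\mathcal M$, which is $\alpha(\omega)$. "$\alpha$ is defined on $\omega$" means the computation on $\omega$ is not aborted. *)

theory Defs
  imports
    Complex_Main
    "HOL-Library.Countable_Set"
    "HOL-Library.Nat_Bijection"
    "HOL-Computational_Algebra.Polynomial"
begin

section \<open>First-order languages extending that of Peano arithmetic\<close>

text \<open>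
  The symbols of Peano arithmetic are built in; \<open>'f\<close> and \<open>'r\<close> are the further function and
  relation symbols of the language. Symbols carry no arity: a symbol together with a number
  of arguments plays the role of a symbol of that arity.
\<close>

datatype 'f tm = Var nat | Zero | One | Plus "'f tm" "'f tm" | Times "'f tm" "'f tm"
  | Fn 'f "'f tm list"

datatype ('f, 'r) fm = Eq "'f tm" "'f tm" | Less "'f tm" "'f tm" | Rl 'r "'f tm list"
  | Neg "('f, 'r) fm" | Conj "('f, 'r) fm" "('f, 'r) fm" | Ex nat "('f, 'r) fm"

record ('f, 'r, 'a) struct =
  zero :: 'a
  one :: 'a
  plus :: "'a \<Rightarrow> 'a \<Rightarrow> 'a"
  times :: "'a \<Rightarrow> 'a \<Rightarrow> 'a"
  less :: "'a \<Rightarrow> 'a \<Rightarrow> bool"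
  fn :: "'f \<Rightarrow> 'a list \<Rightarrow> 'a"
  rl :: "'r \<Rightarrow> 'a list \<Rightarrow> bool"

primrec val :: "('f, 'r, 'a) struct \<Rightarrow> (nat \<Rightarrow> 'a) \<Rightarrow> 'f tm \<Rightarrow> 'a" where
  "val M e (Var x) = e x"
| "val M e Zero = zero M"
| "val M e One = one M"
| "val M e (Plus t u) = plus M (val M e t) (val M e u)"
| "val M e (Times t u) = times M (val M e t) (val M e u)"
| "val M e (Fn f ts) = fn M f (map (val M e) ts)"

primrec sat :: "('f, 'r, 'a) struct \<Rightarrow> (nat \<Rightarrow> 'a) \<Rightarrow> ('f, 'r) fm \<Rightarrow> bool" where
  "sat M e (Eq t u) \<longleftrightarrow> val M e t = val M e u"
| "sat M e (Less t u) \<longleftrightarrow> less M (val M e t) (val M e u)"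
| "sat M e (Rl r ts) \<longleftrightarrow> rl M r (map (val M e) ts)"
| "sat M e (Neg \<phi>) \<longleftrightarrow> \<not> sat M e \<phi>"
| "sat M e (Conj \<phi> \<psi>) \<longleftrightarrow> sat M e \<phi> \<and> sat M e \<psi>"
| "sat M e (Ex x \<phi>) \<longleftrightarrow> (\<exists>a. sat M (e(x := a)) \<phi>)"

primrec fvt :: "'f tm \<Rightarrow> nat set" where
  "fvt (Var x) = {x}"
| "fvt Zero = {}"
| "fvt One = {}"
| "fvt (Plus t u) = fvt t \<union> fvt u"
| "fvt (Times t u) = fvt t \<union> fvt u"
| "fvt (Fn f ts) = \<Union> (set (map fvt ts))"

primrec fv :: "('f, 'r) fm \<Rightarrow> nat set" where
  "fv (Eq t u) = fvt t \<union> fvt u"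
| "fv (Less t u) = fvt t \<union> fvt u"
| "fv (Rl r ts) = \<Union> (fvt ` set ts)"
| "fv (Neg \<phi>) = fv \<phi>"
| "fv (Conj \<phi> \<psi>) = fv \<phi> \<union> fv \<psi>"
| "fv (Ex x \<phi>) = fv \<phi> - {x}"


section \<open>Models of true arithmetic\<close>

text \<open>\<open>N\<close> is the standard model; the interpretation of the additional symbols is arbitrary.\<close>

definition standard_model :: "('f, 'r, nat) struct \<Rightarrow> bool" where
  "standard_model N \<longleftrightarrow>
     zero N = 0 \<and> one N = 1 \<and> plus N = (+) \<and> times N = (*) \<and> less N = (<)"

definition true_arithmetic :: "('f, 'r, nat) struct \<Rightarrow> ('f, 'r, 'a) struct \<Rightarrow> bool" where
  "true_arithmetic N M \<longleftrightarrow>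
     (\<forall>\<phi>. fv \<phi> = {} \<longrightarrow> (\<forall>e. sat N e \<phi>) \<longrightarrow> (\<forall>e. sat M e \<phi>))"

primrec numeral_of :: "('f, 'r, 'a) struct \<Rightarrow> nat \<Rightarrow> 'a" where
  "numeral_of M 0 = zero M"
| "numeral_of M (Suc k) = plus M (numeral_of M k) (one M)"

definition nonstandard :: "('f, 'r, 'a) struct \<Rightarrow> 'a \<Rightarrow> bool" where
  "nonstandard M a \<longleftrightarrow> a \<notin> range (numeral_of M)"

definition nonstandard_model :: "('f, 'r, 'a) struct \<Rightarrow> bool" where
  "nonstandard_model M \<longleftrightarrow> (\<exists>a. nonstandard M a)"

text \<open>
  A pair \<open>(\<phi>, e)\<close> is a formula with parameters: variable \<open>0\<close> is the variable of the type, the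
  other free variables of \<open>\<phi>\<close> denote the parameters given by \<open>e\<close>. For a countable language a
  type over a countable set of parameters is a countable set of formulas; for an uncountable
  language the countable sets of formulas considered here are the weaker requirement (the
  one satisfied, e.g., by ultrapowers of \<open>N\<close> over a non-principal ultrafilter on the naturals).
\<close>

definition aleph1_saturated :: "('f, 'r, 'a) struct \<Rightarrow> bool" where
  "aleph1_saturated M \<longleftrightarrow>
     (\<forall>\<Gamma> :: (('f, 'r) fm \<times> (nat \<Rightarrow> 'a)) set. countable \<Gamma> \<longrightarrow>
        (\<forall>\<Delta> \<subseteq> \<Gamma>. finite \<Delta> \<longrightarrow> (\<exists>a. \<forall>(\<phi>, e) \<in> \<Delta>. sat M (e(0 := a)) \<phi>)) \<longrightarrow>
        (\<exists>a. \<forall>(\<phi>, e) \<in> \<Gamma>. sat M (e(0 := a)) \<phi>))"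


subsection \<open>Interpreting standard relations in a model\<close>

definition env :: "('f, 'r, 'a) struct \<Rightarrow> 'a list \<Rightarrow> nat \<Rightarrow> 'a" where
  "env M as i = (if i < length as then as ! i else zero M)"

definition definable_by ::
  "('f, 'r, nat) struct \<Rightarrow> nat \<Rightarrow> ('f, 'r) fm \<Rightarrow> (nat list \<Rightarrow> bool) \<Rightarrow> bool" where
  "definable_by N k \<phi> R \<longleftrightarrow>
     fv \<phi> \<subseteq> {..<k} \<and> (\<forall>ns. length ns = k \<longrightarrow> (sat N (env N ns) \<phi> \<longleftrightarrow> R ns))"

text \<open>
  The interpretation in \<open>M\<close> of a definable relation \<open>R\<close> on the natural numbers. By
  \<open>interp_iff\<close> below it does not depend on the defining formula. It is applied
  to arithmetical relations only.
\<close>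

definition interp ::
  "('f, 'r, nat) struct \<Rightarrow> ('f, 'r, 'a) struct \<Rightarrow> (nat list \<Rightarrow> bool) \<Rightarrow> 'a list \<Rightarrow> bool" where
  "interp N M R as \<longleftrightarrow> (\<exists>\<phi>. definable_by N (length as) \<phi> R \<and> sat M (env M as) \<phi>)"

lemma val_cong: "(\<And>x. x \<in> fvt t \<Longrightarrow> e x = e' x) \<Longrightarrow> val M e t = val M e' t"
proof (induction t)
  case (Fn f ts)
  then have "map (val M e) ts = map (val M e') ts" by auto
  then show ?case by (simp only: val.simps)
qed auto

lemma sat_cong: "(\<And>x. x \<in> fv \<phi> \<Longrightarrow> e x = e' x) \<Longrightarrow> sat M e \<phi> \<longleftrightarrow> sat M e' \<phi>"
proof (induction \<phi> arbitrary: e e')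
  case (Eq t u)
  have "val M e t = val M e' t" "val M e u = val M e' u"
    by (rule val_cong; simp add: Eq)+
  then show ?case by (simp only: sat.simps)
next
  case (Less t u)
  have "val M e t = val M e' t" "val M e u = val M e' u"
    by (rule val_cong; simp add: Less)+
  then show ?case by (simp only: sat.simps)
next
  case (Rl r ts)
  then have "map (val M e) ts = map (val M e') ts" by (auto intro!: val_cong)
  then show ?case by (simp only: sat.simps)
next
  case (Neg \<phi>)
  have "sat M e \<phi> \<longleftrightarrow> sat M e' \<phi>" by (rule Neg.IH) (simp add: Neg.prems)
  then show ?case by (simp only: sat.simps)
next
  case (Conj \<phi> \<psi>)
  have "sat M e \<phi> \<longleftrightarrow> sat M e' \<phi>" "sat M e \<psi> \<longleftrightarrow> sat M e' \<psi>"
    by (rule Conj.IH; simp add: Conj.prems)+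
  then show ?case by (simp only: sat.simps)
next
  case (Ex x \<phi>)
  have "sat M (e(x := a)) \<phi> \<longleftrightarrow> sat M (e'(x := a)) \<phi>" for a
    by (rule Ex.IH) (use Ex.prems in auto)
  then show ?case by (simp only: sat.simps)
qed

primrec exs :: "nat \<Rightarrow> ('f, 'r) fm \<Rightarrow> ('f, 'r) fm" where
  "exs 0 \<phi> = \<phi>"
| "exs (Suc k) \<phi> = exs k (Ex k \<phi>)"

lemma fv_exs: "fv (exs k \<phi>) = fv \<phi> - {..<k}"
  by (induction k arbitrary: \<phi>) (auto simp: less_Suc_eq)

lemma sat_exs: "sat M e (exs k \<phi>) \<longleftrightarrow> (\<exists>e'. (\<forall>i\<ge>k. e' i = e i) \<and> sat M e' \<phi>)"
proof (induction k arbitrary: \<phi>)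
  case 0
  have "e' = e" if "\<forall>i. e' i = e i" for e' using that by auto
  then show ?case by auto
next
  case (Suc k)
  have "(\<exists>e'. (\<forall>i\<ge>k. e' i = e i) \<and> (\<exists>a. sat M (e'(k := a)) \<phi>)) \<longleftrightarrow>
        (\<exists>e'. (\<forall>i\<ge>Suc k. e' i = e i) \<and> sat M e' \<phi>)" (is "?L \<longleftrightarrow> ?R")
  proof
    assume ?L
    then obtain e' a where "\<forall>i\<ge>k. e' i = e i" "sat M (e'(k := a)) \<phi>" by blast
    then show ?R by (intro exI[of _ "e'(k := a)"]) auto
  next
    assume ?R
    then obtain e' where e': "\<forall>i\<ge>Suc k. e' i = e i" "sat M e' \<phi>" by blast
    then show ?L
      by (intro exI[of _ "e'(k := e k)"] conjI exI[of _ "e' k"]) (auto simp: Suc_le_eq)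
  qed
  then show ?case by (simp add: Suc.IH)
qed

lemma interp_iff:
  assumes ta: "true_arithmetic N M" and \<phi>: "definable_by N (length as) \<phi> R"
  shows "interp N M R as \<longleftrightarrow> sat M (env M as) \<phi>"
proof
  assume "interp N M R as"
  then obtain \<psi> where \<psi>: "definable_by N (length as) \<psi> R" "sat M (env M as) \<psi>"
    by (auto simp: interp_def)
  let ?k = "length as"
  let ?\<chi> = "Neg (exs ?k (Conj \<psi> (Neg \<phi>)))"
  have fvs: "fv \<phi> \<subseteq> {..<?k}" "fv \<psi> \<subseteq> {..<?k}"
    using \<phi> \<psi> by (auto simp: definable_by_def)
  have "sat N e \<psi> \<longleftrightarrow> sat N e \<phi>" for e
  proof -
    let ?ns = "map e [0..<?k]"
    have "sat N e \<psi> \<longleftrightarrow> sat N (env N ?ns) \<psi>" "sat N e \<phi> \<longleftrightarrow> sat N (env N ?ns) \<phi>"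
      by (rule sat_cong; use fvs in \<open>auto simp: env_def\<close>)+
    moreover have "length ?ns = ?k" by simp
    ultimately show ?thesis using \<phi> \<psi>(1) unfolding definable_by_def by blast
  qed
  then have "\<forall>e. sat N e ?\<chi>" by (simp add: sat_exs)
  moreover have "fv ?\<chi> = {}" using fvs by (auto simp: fv_exs)
  ultimately have "sat M (env M as) ?\<chi>" using ta unfolding true_arithmetic_def by blast
  then show "sat M (env M as) \<phi>" using \<psi>(2) by (auto simp: sat_exs)
qed (use \<phi> in \<open>auto simp: interp_def\<close>)


section \<open>Polynomial time\<close>

text \<open>
  Structured programs for a machine with finitely many stacks of bits, i.e. a multitape
  Turing machine up to a constant factor in time. \<open>Branch r p q q'\<close> runs \<open>p\<close>, \<open>q\<close> or \<open>q'\<close> if stack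
  \<open>r\<close> is empty, has top \<open>False\<close> or has top \<open>True\<close>; \<open>Loop r p\<close> runs \<open>p\<close> while stack \<open>r\<close> is non-empty.
\<close>

datatype prog = Skip | Push nat bool | Pop nat | Seq prog prog
  | Branch nat prog prog prog | Loop nat prog

type_synonym store = "nat \<Rightarrow> bool list"

text \<open>\<open>exec p s t s'\<close>: from \<open>s\<close>, program \<open>p\<close> halts in \<open>s'\<close> after \<open>t\<close> steps.\<close>

inductive exec :: "prog \<Rightarrow> store \<Rightarrow> nat \<Rightarrow> store \<Rightarrow> bool" where
  "exec Skip s 1 s"
| "exec (Push r x) s 1 (s(r := x # s r))"
| "exec (Pop r) s 1 (s(r := tl (s r)))"
| "exec p s t s' \<Longrightarrow> exec q s' t' s'' \<Longrightarrow> exec (Seq p q) s (t + t') s''"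
| "s r = [] \<Longrightarrow> exec p s t s' \<Longrightarrow> exec (Branch r p q q') s (Suc t) s'"
| "s r = False # x \<Longrightarrow> exec q s t s' \<Longrightarrow> exec (Branch r p q q') s (Suc t) s'"
| "s r = True # x \<Longrightarrow> exec q' s t s' \<Longrightarrow> exec (Branch r p q q') s (Suc t) s'"
| "s r = [] \<Longrightarrow> exec (Loop r p) s 1 s"
| "s r \<noteq> [] \<Longrightarrow> exec p s t s' \<Longrightarrow> exec (Loop r p) s' t' s'' \<Longrightarrow>
     exec (Loop r p) s (Suc (t + t')) s''"

definition polytime :: "(bool list \<Rightarrow> bool list) \<Rightarrow> bool" where
  "polytime F \<longleftrightarrow> (\<exists>p (q :: nat poly). \<forall>x. \<exists>t s.
     exec p ((\<lambda>_. [])(0 := x)) t s \<and> s 0 = F x \<and> t \<le> poly q (length x))"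

text \<open>Self-delimiting encoding of several strings as one.\<close>

definition tuple :: "bool list list \<Rightarrow> bool list" where
  "tuple xs = concat (map (\<lambda>x. concat (map (\<lambda>c. [True, c]) x) @ [False]) xs)"

definition P_poly :: "(bool list \<Rightarrow> bool) \<Rightarrow> bool" where
  "P_poly A \<longleftrightarrow> (\<exists>F (adv :: nat \<Rightarrow> bool list) (q :: nat poly). polytime F \<and>
     (\<forall>l. length (adv l) \<le> poly q l) \<and> (\<forall>u. F (tuple [adv (length u), u]) = [A u]))"


section \<open>Permutations with a hard bit and the Nisan-Wigderson generator\<close>

definition cube :: "nat \<Rightarrow> bool list set" where
  "cube l = {u. length u = l}"

definition preimage :: "(bool list \<Rightarrow> bool list) \<Rightarrow> bool list \<Rightarrow> bool list" where
  "preimage h u = inv_into (cube (length u)) h u"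

definition hard_bit_permutation ::
  "(bool list \<Rightarrow> bool list) \<Rightarrow> (bool list \<Rightarrow> bool) \<Rightarrow> bool" where
  "hard_bit_permutation h B \<longleftrightarrow>
     polytime h \<and> (\<forall>l. bij_betw h (cube l) (cube l)) \<and> polytime (\<lambda>v. [B v]) \<and>
     (\<forall>k\<ge>1. \<forall>A. P_poly A \<longrightarrow> (\<forall>\<^sub>F l in sequentially.
        real (card {u \<in> cube l. A u = B (preimage h u)}) / 2 ^ l \<le> 1 / 2 + 1 / real l ^ k))"

text \<open>
  A family of \<open>m\<close> subsets of \<open>{..<n}\<close> is given by its \<open>m \<times> n\<close> incidence matrix, written row by
  row as a string \<open>J\<close> of length \<open>m * n\<close>. Indices and positions are counted from \<open>0\<close>. The
  string \<open>x(J\<^sub>i)\<close> is \<^term>\<open>nths x (row n J i)\<close>. The guard \<^term>\<open>i * n + j < length J\<close> keeps \<open>row\<close>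
  arithmetical on arguments of the wrong shape, where \<open>!\<close> is unspecified.
\<close>

definition row :: "nat \<Rightarrow> bool list \<Rightarrow> nat \<Rightarrow> nat set" where
  "row n J i = {j. j < n \<and> i * n + j < length J \<and> J ! (i * n + j)}"

definition set_system :: "nat \<Rightarrow> nat \<Rightarrow> nat \<Rightarrow> bool list \<Rightarrow> bool" where
  "set_system n m l J \<longleftrightarrow> length J = m * n \<and> (\<forall>i<m. card (row n J i) = l) \<and>
     (\<forall>i<m. \<forall>j<m. i \<noteq> j \<longrightarrow> real (card (row n J i \<inter> row n J j)) \<le> log 2 (real m))"

definition NW ::
  "(bool list \<Rightarrow> bool) \<Rightarrow> nat \<Rightarrow> nat \<Rightarrow> bool list \<Rightarrow> bool list \<Rightarrow> bool list" where
  "NW f n m J x = map (\<lambda>i. f (nths x (row n J i))) [0..<m]"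


section \<open>Strings and sets as numbers\<close>

text \<open>Bijective base-two notation.\<close>

primrec code :: "bool list \<Rightarrow> nat" where
  "code [] = 0"
| "code (c # x) = Suc (of_bool c + 2 * code x)"

fun str :: "nat \<Rightarrow> bool list" where
  "str 0 = []"
| "str (Suc k) = odd k # str (k div 2)"

lemma str_code [simp]: "str (code x) = x"
  by (induction x) auto

lemma code_str [simp]: "code (str k) = k"
proof (induction k rule: str.induct)
  case (2 k)
  have "of_bool (odd k) + 2 * (k div 2) = k"
    by (metis add.commute mult_div_mod_eq mod2_eq_if of_bool_def even_iff_mod_2_eq_zero)
  then show ?case by (simp only: str.simps code.simps 2)
qed (simp only: str.simps code.simps)

text \<open>\<open>cubeM N M n\<close> is \<open>{0,1}\<^sup>n\<close> in the sense of \<open>M\<close>; \<open>elemsM N M H\<close> are the members of the set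
  coded by \<open>H\<close> in \<open>M\<close>.\<close>

definition cubeM :: "('f, 'r, nat) struct \<Rightarrow> ('f, 'r, 'a) struct \<Rightarrow> 'a \<Rightarrow> 'a set" where
  "cubeM N M n = {x. interp N M (\<lambda>v. str (v ! 1) \<in> cube (v ! 0)) [n, x]}"

definition elemsM :: "('f, 'r, nat) struct \<Rightarrow> ('f, 'r, 'a) struct \<Rightarrow> 'a \<Rightarrow> 'a set" where
  "elemsM N M H = {x. interp N M (\<lambda>v. v ! 1 \<in> set_decode (v ! 0)) [H, x]}"

definition cardM :: "('f, 'r, nat) struct \<Rightarrow> ('f, 'r, 'a) struct \<Rightarrow> 'a \<Rightarrow> 'a \<Rightarrow> bool" where
  "cardM N M H c \<longleftrightarrow> interp N M (\<lambda>v. card (set_decode (v ! 0)) = v ! 1) [H, c]"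


section \<open>Uniform Students\<close>

datatype outcome = Aborted | Illegal | Output "bool list"

text \<open>
  \<open>student_run h B S J b w \<omega> c vs\<close>: the run of Student \<open>S\<close> on \<open>\<omega>\<close>, with at most \<open>c\<close> further queries
  allowed, after the answers \<open>vs\<close> were received. The next move of \<open>S\<close> is computed from the
  advice, \<open>\<omega>\<close> and \<open>vs\<close>. A move \<open>True # x\<close> is a query with index \<open>code x\<close>; a move \<open>False # y\<close> is
  the output \<open>y\<close> (and so is the move \<open>[]\<close>, with \<open>y = []\<close>). A run is \<open>Illegal\<close> if it queries an index
  outside \<open>{..<m}\<close> (\<open>m\<close> being the length of \<open>b\<close>) or asks too many queries.
\<close>

primrec student_run ::
  "(bool list \<Rightarrow> bool list) \<Rightarrow> (bool list \<Rightarrow> bool) \<Rightarrow> (bool list \<Rightarrow> bool list) \<Rightarrow>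
   bool list \<Rightarrow> bool list \<Rightarrow> bool list \<Rightarrow> bool list \<Rightarrow> nat \<Rightarrow> bool list list \<Rightarrow> outcome" where
  "student_run h B S J b w \<omega> 0 vs =
     (case S (tuple (J # b # w # \<omega> # vs)) of
        True # x \<Rightarrow> Illegal
      | False # y \<Rightarrow> Output y
      | [] \<Rightarrow> Output [])"
| "student_run h B S J b w \<omega> (Suc c) vs =
     (case S (tuple (J # b # w # \<omega> # vs)) of
        True # x \<Rightarrow>
          (let i = code x; v = preimage h (nths \<omega> (row (length \<omega>) J i)) in
           if i \<ge> length b then Illegal
           else if B v = b ! i then student_run h B S J b w \<omega> c (vs @ [v])
           else Aborted)
      | False # y \<Rightarrow> Output y
      | [] \<Rightarrow> Output [])"

text \<open>
  The family \<open>F\<^sup>u\<^sup>n\<^sup>i\<^sup>f\<close> for the advice \<open>w\<close>, as partial functions on \<open>M\<close>. Student \<open>S\<close> and query bound \<open>c\<close>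
  are standard, the run is the one in \<open>M\<close>. Since runs are never illegal, \<open>\<alpha>\<close> is undefined on a
  sample exactly if the run is aborted. Every element of \<open>M\<close> is the code of exactly one string.
\<close>

definition F_unif ::
  "('f, 'r, nat) struct \<Rightarrow> ('f, 'r, 'a) struct \<Rightarrow> (bool list \<Rightarrow> bool list) \<Rightarrow>
   (bool list \<Rightarrow> bool) \<Rightarrow> 'a \<Rightarrow> 'a \<Rightarrow> 'a \<Rightarrow> 'a \<Rightarrow> ('a \<rightharpoonup> 'a) set" where
  "F_unif N M h B n J b w =
     {\<alpha>. dom \<alpha> \<subseteq> cubeM N M n \<and>
       (\<exists>S c. polytime S \<and> (\<forall>\<omega> \<in> cubeM N M n.
          interp N M
            (\<lambda>v. student_run h B S (str (v ! 0)) (str (v ! 1)) (str (v ! 2)) (str (v ! 3)) c []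
                   \<noteq> Illegal)
            [J, b, w, \<omega>] \<and>
          (\<forall>y. \<alpha> \<omega> = Some y \<longleftrightarrow>
             interp N M
               (\<lambda>v. student_run h B S (str (v ! 0)) (str (v ! 1)) (str (v ! 2)) (str (v ! 3)) c []
                      = Output (str (v ! 4)))
               [J, b, w, \<omega>, y])))}"

end

theory Submission
  imports Defs "HOL-Number_Theory.Cong"
begin

text \<open>
  Run finitely many Students one after the other on a random sample. Suppose that a certain history
  of moves has occurred and that row \<open>i\<close>, not queried so far, is queried next. Write an input \<open>u\<close>
  of \<open>f\<close> into the positions \<open>J\<^sub>i\<close> of a sample and fix the other positions. The answers to the earlier
  queries then depend on \<open>log m\<close> bits of \<open>u\<close> each, so they can be tabulated, and a polynomial-size
  algorithm can recognise the history from \<open>u\<close>. Were \<open>f(u)\<close> biased towards the complement of \<open>b\<^sub>i\<close>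
  under this history, the algorithm would predict \<open>f\<close>. So each query aborts at most about half of
  the runs that got to it, and since the number of queries is standard, a fraction of at least
  \<open>2\<^sup>-\<^sup>K\<close> with standard \<open>K\<close> of all samples survives all Students. As runs of Students are arithmetical,
  by means of Goedel's beta function, this transfers to \<open>M\<close>. There are only countably many uniform
  Students, so saturation yields one set \<open>H\<close> for all of them.
\<close>

section \<open>Arithmetical relations\<close>

text \<open>The counting is limited by error terms. Hardness is applied to each history separately
  with additive error \<open>2 ^ n / l ^ k\<close>, and these errors add up over the tree of
  histories to about \<open>K * (m + 1) ^ K\<close> of them. Since \<open>m\<close> is of the order
  of \<open>l ^ 3\<close>, the exponent \<open>k = 3 * K + 1\<close> suffices; it is available
  because the bit is hard for every fixed \<open>k\<close>. For this, histories must be few: they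
  record queries and the consistency of answers, never the answers themselves or the outputs. The
  threshold on \<open>n\<close> must not depend on \<open>J\<close>, \<open>b\<close>,
  \<open>w\<close>, which are arbitrary parameters in the model. So hardness is shown for all
  instances of one length at once: hypothetical counterexamples, one per length, become the advice
  of a single predictor. As \<open>P_poly\<close> asks for a function that is polynomial-time on
  every string, decoders and interpreters must also halt quickly on malformed advice. In the model,
  \<open>interp\<close> is false for a relation without defining formula; hence definability has to
  be settled for each relation before its truth can be transferred.\<close>

primrec rename_tm :: "(nat \<Rightarrow> nat) \<Rightarrow> 'f tm \<Rightarrow> 'f tm" where
  "rename_tm \<sigma> (Var x) = Var (\<sigma> x)"
| "rename_tm \<sigma> Zero = Zero"
| "rename_tm \<sigma> One = One"
| "rename_tm \<sigma> (Plus t u) = Plus (rename_tm \<sigma> t) (rename_tm \<sigma> u)"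
| "rename_tm \<sigma> (Times t u) = Times (rename_tm \<sigma> t) (rename_tm \<sigma> u)"
| "rename_tm \<sigma> (Fn f ts) = Fn f (map (rename_tm \<sigma>) ts)"

lemma val_rename_tm: "val M e (rename_tm \<sigma> t) = val M (\<lambda>x. e (\<sigma> x)) t"
proof (induction t)
  case (Fn f ts)
  then have "map (val M e) (map (rename_tm \<sigma>) ts) = map (val M (\<lambda>x. e (\<sigma> x))) ts"
    by auto
  then show ?case by (simp only: rename_tm.simps val.simps)
qed auto

lemma finite_fvt: "finite (fvt t)"
  by (induction t) auto

lemma finite_fv: "finite (fv \<phi>)"
  by (induction \<phi>) (auto simp: finite_fvt)

text \<open>The new bound variable exceeds the sum of the images of all free variables, hence each
  single image, so nothing is captured.\<close>

primrec rename_fm :: "(nat \<Rightarrow> nat) \<Rightarrow> ('f, 'r) fm \<Rightarrow> ('f, 'r) fm" where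
  "rename_fm \<sigma> (Eq t u) = Eq (rename_tm \<sigma> t) (rename_tm \<sigma> u)"
| "rename_fm \<sigma> (Less t u) = Less (rename_tm \<sigma> t) (rename_tm \<sigma> u)"
| "rename_fm \<sigma> (Rl r ts) = Rl r (map (rename_tm \<sigma>) ts)"
| "rename_fm \<sigma> (Neg \<phi>) = Neg (rename_fm \<sigma> \<phi>)"
| "rename_fm \<sigma> (Conj \<phi> \<psi>) = Conj (rename_fm \<sigma> \<phi>) (rename_fm \<sigma> \<psi>)"
| "rename_fm \<sigma> (Ex x \<phi>) =
     Ex (Suc (\<Sum>y\<in>fv \<phi>. \<sigma> y)) (rename_fm (\<sigma>(x := Suc (\<Sum>y\<in>fv \<phi>. \<sigma> y))) \<phi>)"

lemma sat_rename_fm: "sat M e (rename_fm \<sigma> \<phi>) \<longleftrightarrow> sat M (\<lambda>x. e (\<sigma> x)) \<phi>"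
proof (induction \<phi> arbitrary: \<sigma> e)
  case (Rl r ts)
  have "map (val M e) (map (rename_tm \<sigma>) ts) = map (val M (\<lambda>x. e (\<sigma> x))) ts"
    by (auto simp: val_rename_tm)
  then show ?case by (simp only: rename_fm.simps sat.simps)
next
  case (Ex x \<phi>)
  let ?z = "Suc (\<Sum>y\<in>fv \<phi>. \<sigma> y)"
  have fresh: "\<sigma> y \<noteq> ?z" if "y \<in> fv \<phi>" for y
    using member_le_sum[of y "fv \<phi>" \<sigma>] that by (auto simp: finite_fv)
  have "sat M (\<lambda>y. (e(?z := a)) ((\<sigma>(x := ?z)) y)) \<phi> \<longleftrightarrow> sat M ((\<lambda>y. e (\<sigma> y))(x := a)) \<phi>" for a
    by (rule sat_cong) (use fresh in auto)
  then show ?case by (simp only: rename_fm.simps sat.simps Ex.IH)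
qed (auto simp: val_rename_tm)

named_theorems arith_intros

locale std =
  fixes N :: "('f, 'r, nat) struct"
  assumes std: "standard_model N"
begin

lemma std_simps [simp]:
  "zero N = 0" "one N = Suc 0" "plus N = (+)" "times N = (*)" "less N = (<)"
  using std by (auto simp: standard_model_def)

definition arith_rel :: "((nat \<Rightarrow> nat) \<Rightarrow> bool) \<Rightarrow> bool" where
  "arith_rel R \<longleftrightarrow> (\<exists>\<phi>. \<forall>e. sat N e \<phi> \<longleftrightarrow> R e)"

text \<open>The graph has its value in variable 0 and its arguments shifted by one, as for de Bruijn
  indices. Definability goals under nested quantifiers then decompose syntactically by
  \<open>arith_intros\<close>.\<close>

definition arith_fun :: "((nat \<Rightarrow> nat) \<Rightarrow> nat) \<Rightarrow> bool" where
  "arith_fun f \<longleftrightarrow> arith_rel (\<lambda>e. f (\<lambda>i. e (Suc i)) = e 0)"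

lemma arith_rel_rename: "arith_rel R \<Longrightarrow> arith_rel (\<lambda>e. R (\<lambda>i. e (\<sigma> i)))"
proof -
  assume "arith_rel R"
  then obtain \<phi> where "\<And>e. sat N e \<phi> \<longleftrightarrow> R e"
    by (auto simp: arith_rel_def)
  then have "\<forall>e. sat N e (rename_fm \<sigma> \<phi>) \<longleftrightarrow> R (\<lambda>i. e (\<sigma> i))" by (simp add: sat_rename_fm)
  then show ?thesis unfolding arith_rel_def by blast
qed

lemma arith_rel_Not [arith_intros]: "arith_rel R \<Longrightarrow> arith_rel (\<lambda>e. \<not> R e)"
proof -
  assume "arith_rel R"
  then obtain \<phi> where "\<And>e. sat N e \<phi> \<longleftrightarrow> R e"
    by (auto simp: arith_rel_def)
  then have "\<forall>e. sat N e (Neg \<phi>) \<longleftrightarrow> \<not> R e" by simp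
  then show ?thesis unfolding arith_rel_def by blast
qed

lemma arith_rel_conj [arith_intros]:
  "arith_rel R \<Longrightarrow> arith_rel S \<Longrightarrow> arith_rel (\<lambda>e. R e \<and> S e)"
proof -
  assume "arith_rel R" "arith_rel S"
  then obtain \<phi> \<psi> where "\<And>e. sat N e \<phi> \<longleftrightarrow> R e" "\<And>e. sat N e \<psi> \<longleftrightarrow> S e"
    by (auto simp: arith_rel_def)
  then have "\<forall>e. sat N e (Conj \<phi> \<psi>) \<longleftrightarrow> R e \<and> S e" by simp
  then show ?thesis unfolding arith_rel_def by blast
qed

lemma arith_relI:
  assumes "arith_rel R" "\<And>e. S e \<longleftrightarrow> R e" shows "arith_rel S"
proof -
  have "S = R" using assms(2) by blast
  then show ?thesis using assms(1) by simp
qed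

lemma arith_rel_disj [arith_intros]:
  assumes "arith_rel R" "arith_rel S" shows "arith_rel (\<lambda>e. R e \<or> S e)"
  by (rule arith_relI[OF arith_rel_Not[OF arith_rel_conj[OF arith_rel_Not[OF assms(1)] arith_rel_Not[OF assms(2)]]]])
    blast

lemma arith_rel_imp [arith_intros]:
  assumes "arith_rel R" "arith_rel S" shows "arith_rel (\<lambda>e. R e \<longrightarrow> S e)"
  by (rule arith_relI[OF arith_rel_disj[OF arith_rel_Not[OF assms(1)] assms(2)]]) blast

lemma arith_rel_iff [arith_intros]:
  assumes "arith_rel R" "arith_rel S" shows "arith_rel (\<lambda>e. R e \<longleftrightarrow> S e)"
  by (rule arith_relI[OF arith_rel_conj[OF arith_rel_imp[OF assms] arith_rel_imp[OF assms(2,1)]]]) blast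

lemma arith_rel_Ex [arith_intros]:
  assumes "arith_rel (\<lambda>e. R (e 0) (\<lambda>i. e (Suc i)))"
  shows "arith_rel (\<lambda>e. \<exists>a. R a e)"
proof -
  obtain \<phi> where \<phi>: "\<And>e. sat N e \<phi> \<longleftrightarrow> R (e 0) (\<lambda>i. e (Suc i))"
    using assms by (auto simp: arith_rel_def)
  \<comment> \<open>Under the quantifier, variable \<open>Suc i\<close> has to read the outer
    variable \<open>i\<close>. The value of the renaming at 0 is overwritten by the
    quantifier.\<close>
  have "sat N e (rename_fm (case_nat 0 id) (Ex 0 \<phi>)) \<longleftrightarrow> (\<exists>a. R a e)" for e
    by (simp only: sat_rename_fm sat.simps \<phi>) simp
  then show ?thesis unfolding arith_rel_def by blast
qed

lemma arith_rel_All [arith_intros]: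
  assumes "arith_rel (\<lambda>e. R (e 0) (\<lambda>i. e (Suc i)))"
  shows "arith_rel (\<lambda>e. \<forall>a. R a e)"
  by (rule arith_relI[OF arith_rel_Not[OF arith_rel_Ex[where R = "\<lambda>a e. \<not> R a e", OF arith_rel_Not[OF assms]]]])
    blast

lemma arith_fun_shift:
  assumes "arith_fun f" shows "arith_fun (\<lambda>e. f (\<lambda>i. e (Suc i)))"
  using arith_rel_rename[OF assms[unfolded arith_fun_def],
    of "\<lambda>i. case i of 0 \<Rightarrow> 0 | Suc i \<Rightarrow> Suc (Suc i)"]
  by (simp only: nat.case arith_fun_def)

lemma arith_rel_let:
  assumes "arith_fun f" "arith_rel (\<lambda>e. R (e 0) (\<lambda>i. e (Suc i)))"
  shows "arith_rel (\<lambda>e. R (f e) e)"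
proof -
  have "arith_rel (\<lambda>e. f (\<lambda>i. e (Suc i)) = e 0 \<and> R (e 0) (\<lambda>i. e (Suc i)))"
    using assms unfolding arith_fun_def by (rule arith_rel_conj)
  from arith_rel_Ex[where R = "\<lambda>a e. f e = a \<and> R a e", OF this]
  show ?thesis by (rule arith_relI) blast
qed

lemma arith_fun_let:
  assumes "arith_fun f" "arith_fun (\<lambda>e. g (e 0) (\<lambda>i. e (Suc i)))"
  shows "arith_fun (\<lambda>e. g (f e) e)"
proof -
  have "arith_rel (\<lambda>e. g (e 0) (\<lambda>i. e (Suc (Suc i))) = e (Suc 0))"
    using arith_rel_rename[OF assms(2)[unfolded arith_fun_def],
      of "\<lambda>i. case i of 0 \<Rightarrow> Suc 0 | Suc j \<Rightarrow> (case j of 0 \<Rightarrow> 0 | Suc k \<Rightarrow> Suc (Suc k))"]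
    by (simp only: nat.case)
  from arith_rel_let[OF arith_fun_shift[OF assms(1)], of "\<lambda>x e. g x (\<lambda>i. e (Suc i)) = e 0", OF this]
  show ?thesis by (simp only: arith_fun_def)
qed

lemma arith_fun_var [arith_intros]: "arith_fun (\<lambda>e. e i)"
  unfolding arith_fun_def arith_rel_def
  by (rule exI[of _ "Eq (Var (Suc i)) (Var 0)"]) simp

lemma arith_fun_comp1:
  "arith_fun (\<lambda>e. F (e 0)) \<Longrightarrow> arith_fun f \<Longrightarrow> arith_fun (\<lambda>e. F (f e))"
  by (rule arith_fun_let[where g = "\<lambda>a e. F a"])

lemma arith_fun_comp2:
  assumes F: "arith_fun (\<lambda>e. F (e 0) (e (Suc 0)))" and "arith_fun f" "arith_fun g"
  shows "arith_fun (\<lambda>e. F (f e) (g e))"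
proof -
  have "arith_fun (\<lambda>e. F (e (Suc 0)) (e 0))"
    using arith_rel_rename[OF F[unfolded arith_fun_def],
      of "\<lambda>i. case i of 0 \<Rightarrow> 0 | Suc j \<Rightarrow> (case j of 0 \<Rightarrow> Suc (Suc 0) | Suc k \<Rightarrow> Suc 0)"]
    by (simp only: nat.case arith_fun_def)
  from arith_fun_let[where g = "\<lambda>a e. F (e 0) a", OF arith_fun_shift[OF assms(3)] this]
  show ?thesis by (rule arith_fun_let[where g = "\<lambda>a e. F a (g e)", OF assms(2)])
qed

lemma arith_rel_comp2:
  assumes R: "arith_rel (\<lambda>e. R (e 0) (e (Suc 0)))" and "arith_fun f" "arith_fun g"
  shows "arith_rel (\<lambda>e. R (f e) (g e))"
proof -
  have "arith_rel (\<lambda>e. R (e (Suc 0)) (e 0))"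
    using arith_rel_rename[OF R, of "\<lambda>i. case i of 0 \<Rightarrow> Suc 0 | Suc j \<Rightarrow> 0"]
    by (simp only: nat.case)
  from arith_rel_let[where R = "\<lambda>a e. R (e 0) a", OF arith_fun_shift[OF assms(3)] this]
  show ?thesis by (rule arith_rel_let[where R = "\<lambda>a e. R a (g e)", OF assms(2)])
qed

lemma arith_fun_add [arith_intros]: "arith_fun f \<Longrightarrow> arith_fun g \<Longrightarrow> arith_fun (\<lambda>e. f e + g e)"
  by (rule arith_fun_comp2)
    (auto simp: arith_fun_def arith_rel_def
       intro: exI[of _ "Eq (Plus (Var (Suc 0)) (Var (Suc (Suc 0)))) (Var 0)"])

lemma arith_fun_mult [arith_intros]: "arith_fun f \<Longrightarrow> arith_fun g \<Longrightarrow> arith_fun (\<lambda>e. f e * g e)"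
  by (rule arith_fun_comp2)
    (auto simp: arith_fun_def arith_rel_def
       intro: exI[of _ "Eq (Times (Var (Suc 0)) (Var (Suc (Suc 0)))) (Var 0)"])

lemma arith_fun_const [arith_intros]: "arith_fun (\<lambda>e. k)"
proof (induction k)
  case 0
  have "\<forall>e. sat N e (Eq Zero (Var 0)) \<longleftrightarrow> 0 = e 0" by simp
  then show ?case unfolding arith_fun_def arith_rel_def by blast
next
  case (Suc k)
  have "\<forall>e. sat N e (Eq One (Var 0)) \<longleftrightarrow> Suc 0 = e 0" by simp
  then have "arith_fun (\<lambda>e. Suc 0)" unfolding arith_fun_def arith_rel_def by blast
  from arith_fun_add[OF Suc this] show ?case by simp
qed

lemma arith_fun_Suc [arith_intros]: "arith_fun f \<Longrightarrow> arith_fun (\<lambda>e. Suc (f e))"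
  by (rule arith_fun_comp1[where F = Suc])
    (use arith_fun_add[OF arith_fun_var[of 0] arith_fun_const[of "Suc 0"]] in simp_all)

lemma arith_rel_eq [arith_intros]: "arith_fun f \<Longrightarrow> arith_fun g \<Longrightarrow> arith_rel (\<lambda>e. f e = g e)"
  by (rule arith_rel_comp2) (auto simp: arith_rel_def intro: exI[of _ "Eq (Var 0) (Var (Suc 0))"])

lemma arith_rel_less [arith_intros]: "arith_fun f \<Longrightarrow> arith_fun g \<Longrightarrow> arith_rel (\<lambda>e. f e < g e)"
  by (rule arith_rel_comp2) (auto simp: arith_rel_def intro: exI[of _ "Less (Var 0) (Var (Suc 0))"])

lemma arith_rel_le [arith_intros]:
  assumes "arith_fun f" "arith_fun g" shows "arith_rel (\<lambda>e. f e \<le> g e)"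
  by (rule arith_relI[OF arith_rel_Not[OF arith_rel_less[OF assms(2,1)]]]) auto

lemma arith_rel_const [arith_intros]: "arith_rel (\<lambda>e. P)"
  by (rule arith_relI[OF arith_rel_eq[OF arith_fun_const[of 0] arith_fun_const[of "if P then 0 else 1"]]]) simp

lemma arith_funI:
  assumes "\<And>e y. f e = y \<longleftrightarrow> P y e" "arith_rel (\<lambda>e. P (e 0) (\<lambda>i. e (Suc i)))"
  shows "arith_fun f"
  using assms by (simp only: arith_fun_def)

lemma arith_fun_if [arith_intros]:
  assumes "arith_rel P" "arith_fun f" "arith_fun g"
  shows "arith_fun (\<lambda>e. if P e then f e else g e)"
  by (rule arith_funI[where P = "\<lambda>y e. (P e \<longrightarrow> f e = y) \<and> (\<not> P e \<longrightarrow> g e = y)"])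
    (auto intro!: arith_intros arith_rel_rename[OF assms(1)] arith_fun_shift assms)

lemma arith_fun_diff [arith_intros]:
  "arith_fun f \<Longrightarrow> arith_fun g \<Longrightarrow> arith_fun (\<lambda>e. f e - g e)"
  by (rule arith_funI[where P = "\<lambda>y e. f e = g e + y \<or> f e < g e \<and> y = 0"])
    (auto intro!: arith_intros arith_fun_shift)

lemma arith_fun_div [arith_intros]:
  assumes "arith_fun f" "arith_fun g" shows "arith_fun (\<lambda>e. f e div g e)"
proof (rule arith_funI)
  show "f e div g e = y \<longleftrightarrow> g e = 0 \<and> y = 0 \<or> g e * y \<le> f e \<and> f e < g e * Suc y" for e y
    by (cases "g e = 0")
      (auto simp: div_nat_eqI mult.commute div_less_iff_less_mult less_eq_div_iff_mult_less_eq
        dividend_less_times_div dividend_less_div_times)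
qed (auto intro!: arith_intros arith_fun_shift assms)

lemma arith_fun_mod [arith_intros]:
  "arith_fun f \<Longrightarrow> arith_fun g \<Longrightarrow> arith_fun (\<lambda>e. f e mod g e)"
  unfolding minus_mult_div_eq_mod[symmetric] by (intro arith_intros)

lemma arith_rel_odd [arith_intros]: "arith_fun f \<Longrightarrow> arith_rel (\<lambda>e. odd (f e))"
  unfolding odd_iff_mod_2_eq_one by (intro arith_intros)

lemma arith_fun_rename:
  assumes "arith_fun f" shows "arith_fun (\<lambda>e. f (\<lambda>i. e (\<sigma> i)))"
  using arith_rel_rename[OF assms[unfolded arith_fun_def],
    of "\<lambda>i. case i of 0 \<Rightarrow> 0 | Suc i \<Rightarrow> Suc (\<sigma> i)"]
  by (simp only: nat.case arith_fun_def)

end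

section \<open>Goedel's beta function: recursion and iteration in first-order arithmetic\<close>

definition beta :: "nat \<Rightarrow> nat \<Rightarrow> nat \<Rightarrow> nat" where
  "beta c d i = c mod Suc (Suc i * d)"

text \<open>The step \<open>d\<close> is a factorial that is divisible by every positive number up
  to \<open>k\<close> and bounds all \<open>a i\<close>. A prime dividing two moduli divides
  \<open>(j - i) * d\<close>, hence \<open>d\<close>, yet each modulus is 1 modulo \<open>d\<close>;
  so the moduli are coprime and the Chinese remainder theorem applies. As \<open>a i\<close> lies
  below its modulus, the remainder is \<open>a i\<close> itself.\<close>

lemma beta_exists: "\<exists>c d. \<forall>i\<le>k. beta c d i = a i"
proof -
  define d :: nat where "d = fact (k + (\<Sum>i\<le>k. a i) + 1)"
  have div: "x dvd d" if "0 < x" "x \<le> k" for x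
    unfolding d_def using that by (intro dvd_fact) auto
  have le: "a i \<le> d" if "i \<le> k" for i
  proof -
    have "a i \<le> (\<Sum>i\<le>k. a i)" using that by (intro member_le_sum) auto
    also have "\<dots> \<le> d" unfolding d_def by (rule order.trans[OF _ fact_ge_self]) simp
    finally show ?thesis .
  qed
  have "coprime (Suc (Suc i * d)) (Suc (Suc j * d))" if "i < j" "j \<le> k" for i j
  proof (rule ccontr)
    assume "\<not> coprime (Suc (Suc i * d)) (Suc (Suc j * d))"
    then have "gcd (Suc (Suc i * d)) (Suc (Suc j * d)) \<noteq> 1" by (simp only: coprime_iff_gcd_eq_1 not_False_eq_True)
    then obtain p where "prime p" "p dvd gcd (Suc (Suc i * d)) (Suc (Suc j * d))"
      using prime_factor_nat by blast
    then have p: "prime p" "p dvd Suc (Suc i * d)" "p dvd Suc (Suc j * d)"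
      by (auto simp only: gcd_greatest_iff)
    have "p dvd Suc (Suc j * d) - Suc (Suc i * d)" using p(2,3) by (rule dvd_diff_nat[rotated])
    also have "Suc (Suc j * d) - Suc (Suc i * d) = (j - i) * d"
      by (simp add: diff_mult_distrib)
    finally have "p dvd d" using p(1) prime_dvd_mult_iff[OF p(1)] div[of "j - i"] that
      by (auto intro: dvd_trans)
    then have "p dvd Suc i * d" by simp
    then have "p dvd Suc (Suc i * d) - Suc i * d" using p(2) by (rule dvd_diff_nat[rotated])
    then show False using p(1) by (simp add: Suc_diff_le)
  qed
  then have "\<forall>i\<in>{..k}. \<forall>j\<in>{..k}. i \<noteq> j \<longrightarrow> coprime (Suc (Suc i * d)) (Suc (Suc j * d))"
    by (metis atMost_iff coprime_commute linorder_neqE_nat)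
  from chinese_remainder_nat[OF _ this, of a] obtain c where
    c: "\<And>i. i \<le> k \<Longrightarrow> [c = a i] (mod Suc (Suc i * d))" by auto
  have "beta c d i = a i" if "i \<le> k" for i
  proof -
    have "a i < Suc (Suc i * d)" using le[OF that] by simp
    then show ?thesis using c[OF that] unfolding beta_def cong_def by simp
  qed
  then show ?thesis by blast
qed

text \<open>The sequence of intermediate values is guessed as a pair \<open>c\<close>,
  \<open>d\<close>; checking it needs only number quantifiers.\<close>

lemma rec_nat_beta:
  "rec_nat a s k = y \<longleftrightarrow>
     (\<exists>c d. beta c d 0 = a \<and> (\<forall>i. i < k \<longrightarrow> beta c d (Suc i) = s i (beta c d i)) \<and> beta c d k = y)"
    (is "_ \<longleftrightarrow> ?R")
proof
  assume y: "rec_nat a s k = y"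
  obtain c d where "\<And>i. i \<le> k \<Longrightarrow> beta c d i = rec_nat a s i"
    using beta_exists[of k "rec_nat a s"] by blast
  then show ?R using y by (intro exI[of _ c] exI[of _ d]) auto
next
  assume ?R
  then obtain c d where cd: "beta c d 0 = a" "\<forall>i<k. beta c d (Suc i) = s i (beta c d i)"
    "beta c d k = y" by blast
  have "i \<le> k \<Longrightarrow> rec_nat a s i = beta c d i" for i by (induction i) (auto simp: cd)
  then show "rec_nat a s k = y" using cd(3) by simp
qed

text \<open>The same device for paths of unknown length; it makes loops of programs
  definable.\<close>

lemma rtranclp_beta:
  "Q\<^sup>*\<^sup>* a b \<longleftrightarrow>
     (\<exists>c d k. beta c d 0 = a \<and> beta c d k = b \<and> (\<forall>i. i < k \<longrightarrow> Q (beta c d i) (beta c d (Suc i))))"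
    (is "_ \<longleftrightarrow> ?R")
proof
  assume "Q\<^sup>*\<^sup>* a b"
  then obtain k f where f: "f 0 = a" "f k = b" "\<forall>i<k. Q (f i) (f (Suc i))"
    using relpowp_fun_conv[of _ Q a b] by (auto simp: rtranclp_power)
  obtain c d where "\<And>i. i \<le> k \<Longrightarrow> beta c d i = f i"
    using beta_exists[of k f] by blast
  then show ?R using f by (intro exI[of _ c] exI[of _ d] exI[of _ k]) auto
next
  assume ?R
  then obtain c d k where "beta c d 0 = a" "beta c d k = b"
    "\<forall>i<k. Q (beta c d i) (beta c d (Suc i))" by blast
  then have "(Q ^^ k) a b" by (subst relpowp_fun_conv) (intro exI[of _ "beta c d"], simp)
  then show "Q\<^sup>*\<^sup>* a b" by (auto simp: rtranclp_power)
qed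

context std
begin

lemma arith_fun_beta [arith_intros]:
  "arith_fun f \<Longrightarrow> arith_fun g \<Longrightarrow> arith_fun k \<Longrightarrow> arith_fun (\<lambda>e. beta (f e) (g e) (k e))"
  unfolding beta_def by (intro arith_intros)

lemma arith_fun_rec_nat:
  assumes "arith_fun g" "arith_fun (\<lambda>e. s (e 0) (e (Suc 0)) (\<lambda>i. e (Suc (Suc i))))" "arith_fun f"
  shows "arith_fun (\<lambda>e. rec_nat (g e) (\<lambda>k v. s k v e) (f e))"
proof (rule arith_funI[OF rec_nat_beta])
  note arith_fun_rename[OF assms(2), of "case_nat (Suc 0) (case_nat 0 (\<lambda>i. Suc (Suc (Suc (Suc (Suc i))))))"]
  then have "arith_fun (\<lambda>e. s (e (Suc 0)) (e 0) (\<lambda>i. e (Suc (Suc (Suc (Suc (Suc i)))))))"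
    by (simp only: nat.case)
  note * = arith_fun_let[where g = "\<lambda>v e. s (e 0) v (\<lambda>i. e (Suc (Suc (Suc (Suc i)))))", OF _ this]
  show "arith_rel (\<lambda>e. \<exists>c d. beta c d 0 = g (\<lambda>i. e (Suc i)) \<and>
      (\<forall>i. i < f (\<lambda>i. e (Suc i)) \<longrightarrow> beta c d (Suc i) = s i (beta c d i) (\<lambda>i. e (Suc i))) \<and>
      beta c d (f (\<lambda>i. e (Suc i))) = e 0)"
    by (intro arith_intros * arith_fun_rename[OF assms(1)] arith_fun_rename[OF assms(3)])
qed

lemma arith_rel_rtranclp:
  assumes "arith_rel (\<lambda>e. Q (e 0) (e (Suc 0)))" "arith_fun f" "arith_fun g"
  shows "arith_rel (\<lambda>e. Q\<^sup>*\<^sup>* (f e) (g e))"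
proof (rule arith_rel_comp2[OF _ assms(2,3)])
  show "arith_rel (\<lambda>e. Q\<^sup>*\<^sup>* (e 0) (e (Suc 0)))"
    unfolding rtranclp_beta by (intro arith_intros arith_rel_comp2[OF assms(1)])
qed

lemma arith_fun_power2 [arith_intros]:
  assumes "arith_fun f" shows "arith_fun (\<lambda>e. 2 ^ f e)"
proof -
  have *: "2 ^ k = rec_nat 1 (\<lambda>_ v. 2 * v) k" for k :: nat by (induction k) auto
  show ?thesis
    unfolding *
    by (rule arith_fun_rec_nat[where s = "\<lambda>_ v _. 2 * v" and g = "\<lambda>_. 1"]) (intro arith_intros assms)+
qed

end

section \<open>Definability of computations\<close>

lemma length_str_bounds: "2 ^ length (str x) \<le> Suc x" "Suc x < 2 ^ Suc (length (str x))"
proof -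
  have "2 ^ length xs \<le> Suc (code xs) \<and> Suc (code xs) < 2 ^ Suc (length xs)" for xs
    by (induction xs) auto
  from this[of "str x"] show "2 ^ length (str x) \<le> Suc x" "Suc x < 2 ^ Suc (length (str x))" by auto
qed

lemma length_str_iff: "length (str x) = k \<longleftrightarrow> 2 ^ k \<le> Suc x \<and> Suc x < 2 ^ Suc k"
proof
  assume *: "2 ^ k \<le> Suc x \<and> Suc x < 2 ^ Suc k"
  have "(2::nat) ^ k < 2 ^ Suc (length (str x))" "(2::nat) ^ length (str x) < 2 ^ Suc k"
    using * length_str_bounds[of x] by linarith+
  from this[THEN power_less_imp_less_exp[rotated]] show "length (str x) = k" by simp
qed (use length_str_bounds[of x] in auto)

text \<open>In ordinary binary, \<open>Suc (code xs)\<close> consists of the bits of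
  \<open>xs\<close>, the first one least significant, below a leading 1.\<close>

definition bit_at :: "bool list \<Rightarrow> nat \<Rightarrow> bool" where
  "bit_at xs i \<longleftrightarrow> odd (Suc (code xs) div 2 ^ i)"

lemma bit_at: "i < length xs \<Longrightarrow> bit_at xs i = xs ! i"
proof (induction xs arbitrary: i)
  case (Cons c xs)
  then show ?case
  proof (cases i)
    case (Suc j)
    have "Suc (code (c # xs)) div 2 ^ i = (Suc (code (c # xs)) div 2) div 2 ^ j"
      by (simp add: Suc div_mult2_eq)
    also have "Suc (code (c # xs)) div 2 = Suc (code xs)" by auto
    finally show ?thesis using Cons Suc by (simp add: bit_at_def)
  qed (simp add: bit_at_def)
qed simp

lemma code_append: "code (xs @ ys) = code xs + 2 ^ length xs * code ys"
  by (induction xs) (auto simp: algebra_simps)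

lemma code_inj: "code x = code y \<longleftrightarrow> x = y"
  by (metis str_code)

definition enc :: "bool list \<Rightarrow> bool list" where
  "enc x = concat (map (\<lambda>c. [True, c]) x) @ [False]"

lemma tuple_simps [simp]: "tuple [] = []" "tuple (x # xs) = enc x @ tuple xs"
  "tuple (xs @ ys) = tuple xs @ tuple ys"
  by (simp_all add: tuple_def enc_def)

text \<open>Recursion on strings becomes recursion on their codes, to which
  \<open>arith_fun_rec_nat\<close> applies.\<close>

lemma code_rec_nat: "code (rec_nat xs s k) = rec_nat (code xs) (\<lambda>i v. code (s i (str v))) k"
proof (induction k)
  case (Suc k)
  show ?case by (simp add: Suc[symmetric])
qed simp

context std
begin

lemma arith_fun_code:
  assumes "arith_fun (\<lambda>e. code (F (str (e 0))))" "arith_fun (\<lambda>e. code (f e))"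
  shows "arith_fun (\<lambda>e. code (F (f e)))"
  using arith_fun_comp1[where F = "\<lambda>x. code (F (str x))", OF assms] by simp

lemma arith_fun_code_str [arith_intros]: "arith_fun f \<Longrightarrow> arith_fun (\<lambda>e. code (str (f e)))"
  by simp

lemma arith_fun_length [arith_intros]:
  assumes "arith_fun (\<lambda>e. code (f e))" shows "arith_fun (\<lambda>e. length (f e))"
proof -
  have "arith_fun (\<lambda>e. length (str (e 0)))"
    by (rule arith_funI[OF length_str_iff]) (intro arith_intros)
  from arith_fun_comp1[OF this assms] show ?thesis by simp
qed

lemma arith_rel_eq_str [arith_intros]:
  "arith_fun (\<lambda>e. code (f e)) \<Longrightarrow> arith_fun (\<lambda>e. code (g e)) \<Longrightarrow> arith_rel (\<lambda>e. f e = g e)"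
  by (drule (1) arith_rel_eq) (simp add: code_inj)

lemma arith_rel_bit_at [arith_intros]:
  "arith_fun (\<lambda>e. code (f e)) \<Longrightarrow> arith_fun i \<Longrightarrow> arith_rel (\<lambda>e. bit_at (f e) (i e))"
  unfolding bit_at_def by (intro arith_intros)

lemma arith_fun_append [arith_intros]:
  "arith_fun (\<lambda>e. code (f e)) \<Longrightarrow> arith_fun (\<lambda>e. code (g e)) \<Longrightarrow> arith_fun (\<lambda>e. code (f e @ g e))"
  unfolding code_append by (intro arith_intros)

lemma arith_fun_Nil [arith_intros]: "arith_fun (\<lambda>e. code [])"
  by (simp add: arith_fun_const)

lemma arith_fun_Cons [arith_intros]:
  "arith_rel P \<Longrightarrow> arith_fun (\<lambda>e. code (f e)) \<Longrightarrow> arith_fun (\<lambda>e. code (P e # f e))"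
  unfolding code.simps of_bool_def by (intro arith_intros)

lemma arith_fun_enc [arith_intros]:
  assumes "arith_fun (\<lambda>e. code (f e))" shows "arith_fun (\<lambda>e. code (enc (f e)))"
proof (rule arith_fun_code[OF _ assms])
  have *: "code (concat (map (\<lambda>c. [True, c]) x)) =
      rec_nat 0 (\<lambda>i v. code (str v @ [True, bit_at x i])) (length x)" for x
  proof -
    have "concat (map (\<lambda>c. [True, c]) (take k x)) =
        rec_nat [] (\<lambda>i v. v @ [True, bit_at x i]) k" if "k \<le> length x" for k
      using that by (induction k) (auto simp: take_Suc_conv_app_nth bit_at)
    from arg_cong[OF this[of "length x"], of code] show ?thesis by (simp add: code_rec_nat)
  qed
  have "arith_fun (\<lambda>e. code (concat (map (\<lambda>c. [True, c]) (str (e 0)))))"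
    unfolding *
    by (intro arith_fun_rec_nat[where s = "\<lambda>i v e. code (str v @ [True, bit_at (str (e 0)) i])"]
        arith_intros)
  then show "arith_fun (\<lambda>e. code (enc (str (e 0))))"
    unfolding enc_def by (intro arith_intros)
qed

lemma arith_fun_nths [arith_intros]:
  assumes "arith_fun (\<lambda>e. code (f e))" "arith_rel (\<lambda>e. e 0 \<in> A (\<lambda>i. e (Suc i)))"
  shows "arith_fun (\<lambda>e. code (nths (f e) (A e)))"
proof -
  have *: "code (nths x C) =
      rec_nat 0 (\<lambda>i v. if i \<in> C then code (str v @ [bit_at x i]) else v) (length x)" for x C
  proof -
    have "nths (take k x) C = rec_nat [] (\<lambda>i v. if i \<in> C then v @ [bit_at x i] else v) k"
      if "k \<le> length x" for k
      using that by (induction k) (auto simp: take_Suc_conv_app_nth nths_append bit_at)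
    from arg_cong[OF this[of "length x"], of code] show ?thesis
      by (simp add: code_rec_nat if_distrib cong: if_cong)
  qed
  have "arith_rel (\<lambda>e. e 0 \<in> A (\<lambda>i. e (Suc (Suc i))))"
    using arith_rel_rename[OF assms(2), of "case_nat 0 (\<lambda>i. Suc (Suc i))"] by (simp only: nat.case)
  moreover have "arith_fun (\<lambda>e. code (f (\<lambda>i. e (Suc (Suc i)))))"
    using arith_fun_rename[OF assms(1)] .
  ultimately show ?thesis
    unfolding *
    by (intro arith_fun_rec_nat[where s = "\<lambda>i v e. if i \<in> A e then code (str v @ [bit_at (f e) i]) else v"]
        arith_intros assms)
qed

lemma arith_rel_row [arith_intros]:
  assumes "arith_fun j" "arith_fun n" "arith_fun (\<lambda>e. code (J e))" "arith_fun i"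
  shows "arith_rel (\<lambda>e. j e \<in> row (n e) (J e) (i e))"
proof (rule arith_relI)
  show "arith_rel (\<lambda>e. j e < n e \<and> i e * n e + j e < length (J e) \<and> bit_at (J e) (i e * n e + j e))"
    by (intro arith_intros assms)
qed (auto simp: row_def bit_at)

end

section \<open>Runs of programs as arithmetical relations between coded stores\<close>

lemma prod_decode_0: "prod_decode 0 = (0, 0)"
  by (simp add: prod_decode_def prod_decode_aux.simps)

text \<open>A number codes the store whose stacks are the components of the iterated pair it codes.\<close>

primrec get :: "nat \<Rightarrow> nat \<Rightarrow> nat" where
  "get 0 z = fst (prod_decode z)"
| "get (Suc r) z = get r (snd (prod_decode z))"

primrec put :: "nat \<Rightarrow> nat \<Rightarrow> nat \<Rightarrow> nat" where
  "put 0 x z = prod_encode (x, snd (prod_decode z))"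
| "put (Suc r) x z = prod_encode (fst (prod_decode z), put r x (snd (prod_decode z)))"

lemma get_put: "get r (put r' x z) = (if r = r' then x else get r z)"
proof (induction r' arbitrary: r z)
  case 0 then show ?case by (cases r) auto
next
  case (Suc r') then show ?case by (cases r) auto
qed

lemma get_0 [simp]: "get r 0 = 0"
  by (induction r) (auto simp: prod_decode_0)

definition dec :: "nat \<Rightarrow> store" where
  "dec z = (\<lambda>r. str (get r z))"

lemma str_get: "str (get r z) = dec z r"
  by (simp add: dec_def)

lemma dec_0: "dec 0 = (\<lambda>_. [])"
  by (simp add: dec_def)

lemma dec_put: "dec (put r x z) = (dec z)(r := str x)"
  by (auto simp: dec_def get_put)

text \<open>The input-output relation of a program without its running time, so that a loop is just
  a reflexive transitive closure. In bijective base two 0 codes the empty stack, an odd number a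
  stack with top \<open>False\<close>, a positive even number one with top
  \<open>True\<close>.\<close>

primrec reach :: "prog \<Rightarrow> nat \<Rightarrow> nat \<Rightarrow> bool" where
  "reach Skip z z' \<longleftrightarrow> z' = z"
| "reach (Push r x) z z' \<longleftrightarrow> z' = put r (code (x # str (get r z))) z"
| "reach (Pop r) z z' \<longleftrightarrow> z' = put r ((get r z - 1) div 2) z"
| "reach (Seq p q) z z' \<longleftrightarrow> (\<exists>y. reach p z y \<and> reach q y z')"
| "reach (Branch r p q q') z z' \<longleftrightarrow>
     get r z = 0 \<and> reach p z z' \<or> odd (get r z) \<and> reach q z z' \<or>
     get r z \<noteq> 0 \<and> \<not> odd (get r z) \<and> reach q' z z'"
| "reach (Loop r p) z z' \<longleftrightarrow>
     (\<lambda>a b. get r a \<noteq> 0 \<and> reach p a b)\<^sup>*\<^sup>* z z' \<and> get r z' = 0"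

lemma str_tl: "str ((x - 1) div 2) = tl (str x)"
  by (cases x) auto

lemma str_eq_Nil: "str x = [] \<longleftrightarrow> x = 0"
  by (cases x) auto

lemma str_pos: "x \<noteq> 0 \<Longrightarrow> str x = even x # str ((x - 1) div 2)"
  by (cases x) auto

lemma str_Cons: "str k = c # x \<Longrightarrow> k \<noteq> 0 \<and> (even k \<longleftrightarrow> c)"
  by (cases k) auto

lemma reach_exec: "reach p z z' \<Longrightarrow> \<exists>t. exec p (dec z) t (dec z')"
proof (induction p arbitrary: z z')
  case Skip
  then show ?case using exec.intros(1) by auto
next
  case (Push r x)
  then have "dec z' = (dec z)(r := x # dec z r)" by (simp only: reach.simps dec_put str_code str_get)
  then show ?case using exec.intros(2)[of r x "dec z"] by metis
next
  case (Pop r)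
  then have "dec z' = (dec z)(r := tl (dec z r))" by (simp only: reach.simps dec_put str_tl str_get)
  then show ?case using exec.intros(3)[of r "dec z"] by metis
next
  case (Seq p q)
  then show ?case by (auto intro: exec.intros) (meson exec.intros(4))
next
  case (Branch r p q q')
  then consider "get r z = 0" "reach p z z'" | "odd (get r z)" "reach q z z'"
    | "get r z \<noteq> 0" "even (get r z)" "reach q' z z'" by auto
  then show ?case
  proof cases
    case 1
    then have "dec z r = []" by (simp add: dec_def)
    then show ?thesis using Branch.IH(1)[OF 1(2)] exec.intros(5) by blast
  next
    case 2
    then have "dec z r = False # str ((get r z - 1) div 2)" unfolding dec_def by (subst str_pos) (auto intro: ccontr)
    then show ?thesis using Branch.IH(2)[OF 2(2)] exec.intros(6) by blast
  next
    case 3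
    then have "dec z r = True # str ((get r z - 1) div 2)" unfolding dec_def by (subst str_pos) auto
    then show ?thesis using Branch.IH(3)[OF 3(3)] exec.intros(7) by blast
  qed
next
  case (Loop r p)
  then have "(\<lambda>a b. get r a \<noteq> 0 \<and> reach p a b)\<^sup>*\<^sup>* z z'" "get r z' = 0" by auto
  then show ?case
  proof (induction rule: converse_rtranclp_induct)
    case base
    then show ?case using exec.intros(8)[of "dec z'" r p] by (auto simp: dec_def)
  next
    case (step a b)
    then have "dec a r \<noteq> []" by (simp add: dec_def str_eq_Nil)
    moreover obtain t where "exec p (dec a) t (dec b)" using Loop.IH step by blast
    ultimately show ?case using step.IH[OF step.prems] exec.intros(9) by blast
  qed
qed

text \<open>Each step changes one stack, and \<open>put\<close> changes one component of a code, so
  a run started in a coded store never leaves the coded stores.\<close>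

lemma exec_reach: "exec p s t s' \<Longrightarrow> s = dec z \<Longrightarrow> \<exists>z'. reach p z z' \<and> s' = dec z'"
proof (induction arbitrary: z rule: exec.induct)
  case (1 s)
  then show ?case by (intro exI[of _ z]) simp
next
  case (2 r x s)
  show ?case by (intro exI[of _ "put r (code (x # str (get r z))) z"] conjI)
    (simp_all only: reach.simps dec_put str_code str_get 2(1))
next
  case (3 r s)
  show ?case by (intro exI[of _ "put r ((get r z - 1) div 2) z"] conjI)
    (simp_all only: reach.simps dec_put str_tl str_get 3(1))
next
  case (4 p s t s' q t' s'')
  then show ?case by (metis reach.simps(4))
next
  case (5 s r p t s' q q')
  then have "get r z = 0" by (simp add: dec_def str_eq_Nil)
  then show ?case using 5 by auto
next
  case (6 s r x q t s' p q')
  then have "get r z \<noteq> 0" "odd (get r z)" using str_Cons[of "get r z"] by (auto simp: dec_def)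
  then show ?case using 6 by auto
next
  case (7 s r x q' t s' p q)
  then have "get r z \<noteq> 0" "even (get r z)" using str_Cons[of "get r z"] by (auto simp: dec_def)
  then show ?case using 7 by auto
next
  case (8 s r p)
  then have "get r z = 0" by (simp add: dec_def str_eq_Nil)
  then show ?case using 8 by auto
next
  case (9 s r p t s' t' s'')
  then obtain y where y: "reach p z y" "s' = dec y" by blast
  obtain z' where z': "reach (Loop r p) y z'" "s'' = dec z'" using 9 y by blast
  have "get r z \<noteq> 0" using 9(1,6) by (auto simp: dec_def str_eq_Nil)
  then have "reach (Loop r p) z z'"
    using y z' by (auto intro: converse_rtranclp_into_rtranclp)
  then show ?case using z' by blast
qed

inductive_cases exec_elims:
  "exec Skip s t s'" "exec (Push r x) s t s'" "exec (Pop r) s t s'" "exec (Seq p q) s t s'"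
  "exec (Branch r p q q') s t s'" "exec (Loop r p) s t s'"

lemma exec_determ: "exec p s t s' \<Longrightarrow> exec p s u s'' \<Longrightarrow> s' = s''"
proof (induction arbitrary: u s'' rule: exec.induct)
  case (1 s)
  then show ?case by (rule exec_elims(1)) simp
next
  case (2 r x s)
  then show ?case by (rule exec_elims(2)) simp
next
  case (3 r s)
  then show ?case by (rule exec_elims(3)) simp
next
  case (4 p s t s' q t' sf)
  from 4(5) show ?case by (rule exec_elims(4)) (use 4(3,4) in blast)
next
  case (5 s r p t s' q q')
  from 5(4) show ?case by (rule exec_elims(5)) (use 5(1,3) in auto)
next
  case (6 s r x q t s' p q')
  from 6(4) show ?case by (rule exec_elims(5)) (use 6(1,3) in auto)
next
  case (7 s r x q' t s' p q)
  from 7(4) show ?case by (rule exec_elims(5)) (use 7(1,3) in auto)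
next
  case (8 s r p)
  from 8(2) show ?case by (rule exec_elims(6)) (use 8(1) in auto)
next
  case (9 s r p t s' t' sf)
  from 9(6) show ?case
  proof (rule exec_elims(6))
    fix t1 s1 t2
    assume "exec p s t1 s1" "exec (Loop r p) s1 t2 s''"
    then show ?thesis using 9(4,5) by blast
  qed (use 9(1) in simp)
qed

text \<open>Halting provides a reachable final store and determinism makes its stack 0 unique, so
  this existential formula defines the graph of \<open>F\<close>.\<close>

lemma polytime_reach:
  assumes "polytime F"
  shows "\<exists>p. \<forall>x y. code (F (str x)) = y \<longleftrightarrow> (\<exists>z. reach p (put 0 x 0) z \<and> get 0 z = y)"
proof -
  obtain p where p: "\<And>x. \<exists>t s. exec p ((\<lambda>_. [])(0 := x)) t s \<and> s 0 = F x"
    using assms unfolding polytime_def by metis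
  have init: "dec (put 0 x 0) = (\<lambda>_. [])(0 := str x)" for x by (simp only: dec_put dec_0)
  have "code (F (str x)) = y \<longleftrightarrow> (\<exists>z. reach p (put 0 x 0) z \<and> get 0 z = y)" for x y
  proof -
    obtain t s where s: "exec p (dec (put 0 x 0)) t s" "s 0 = F (str x)" using p[of "str x"] init by auto
    then obtain z where z: "reach p (put 0 x 0) z" "s = dec z" using exec_reach by blast
    have "get 0 z' = get 0 z" if "reach p (put 0 x 0) z'" for z'
    proof -
      have "dec z' = dec z" using reach_exec[OF that] s(1) exec_determ z(2) by blast
      then have "str (get 0 z') = str (get 0 z)" unfolding dec_def by metis
      then show ?thesis by (metis code_str)
    qed
    moreover have "get 0 z = code (F (str x))" using z s(2) unfolding dec_def by (metis code_str)
    ultimately show ?thesis using z(1) by auto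
  qed
  then show ?thesis by blast
qed

context std
begin

lemma arith_fun_prod_encode [arith_intros]:
  "arith_fun f \<Longrightarrow> arith_fun g \<Longrightarrow> arith_fun (\<lambda>e. prod_encode (f e, g e))"
  unfolding prod_encode_def triangle_def by (simp add: arith_intros)

lemma arith_fun_fst_prod_decode [arith_intros]:
  assumes "arith_fun f" shows "arith_fun (\<lambda>e. fst (prod_decode (f e)))"
proof (rule arith_funI)
  show "fst (prod_decode (f e)) = y \<longleftrightarrow> (\<exists>b. prod_encode (y, b) = f e)" for e y
    by (metis fst_conv prod.collapse prod_decode_inverse prod_encode_inverse)
qed (intro arith_intros arith_fun_rename[OF assms])

lemma arith_fun_snd_prod_decode [arith_intros]:
  assumes "arith_fun f" shows "arith_fun (\<lambda>e. snd (prod_decode (f e)))"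
proof (rule arith_funI)
  show "snd (prod_decode (f e)) = y \<longleftrightarrow> (\<exists>a. prod_encode (a, y) = f e)" for e y
    by (metis snd_conv prod.collapse prod_decode_inverse prod_encode_inverse)
qed (intro arith_intros arith_fun_rename[OF assms])

lemma arith_fun_get [arith_intros]: "arith_fun f \<Longrightarrow> arith_fun (\<lambda>e. get r (f e))"
  by (induction r arbitrary: f) (simp_all add: arith_intros)

lemma arith_fun_put [arith_intros]:
  "arith_fun f \<Longrightarrow> arith_fun g \<Longrightarrow> arith_fun (\<lambda>e. put r (f e) (g e))"
  by (induction r arbitrary: f g) (simp_all add: arith_intros)

lemma arith_rel_reach: "arith_rel (\<lambda>e. reach p (e 0) (e (Suc 0)))"
proof (induction p)
  case Skip
  show ?case unfolding reach.simps by (intro arith_intros)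
next
  case (Push r x)
  show ?case unfolding reach.simps by (intro arith_intros)
next
  case (Pop r)
  show ?case unfolding reach.simps by (intro arith_intros)
next
  case (Seq p q)
  show ?case unfolding reach.simps by (intro arith_intros Seq[THEN arith_rel_comp2])
next
  case (Branch r p q q')
  show ?case unfolding reach.simps by (intro arith_intros Branch)
next
  case (Loop r p)
  show ?case unfolding reach.simps by (intro arith_intros arith_rel_rtranclp Loop)
qed

lemma arith_fun_polytime:
  assumes "polytime F" "arith_fun (\<lambda>e. code (f e))"
  shows "arith_fun (\<lambda>e. code (F (f e)))"
proof (rule arith_fun_code[OF _ assms(2)])
  obtain p where p: "\<And>x y. code (F (str x)) = y \<longleftrightarrow> (\<exists>z. reach p (put 0 x 0) z \<and> get 0 z = y)"
    using polytime_reach[OF assms(1)] by blast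
  show "arith_fun (\<lambda>e. code (F (str (e 0))))"
    by (rule arith_funI[OF p]) (intro arith_intros arith_rel_comp2[OF arith_rel_reach])
qed

lemma arith_rel_polytime_pred:
  assumes "polytime (\<lambda>v. [B v])" "arith_fun (\<lambda>e. code (f e))"
  shows "arith_rel (\<lambda>e. B (f e))"
proof (rule arith_relI)
  show "arith_rel (\<lambda>e. [B (f e)] = [True])"
    by (intro arith_rel_eq_str arith_fun_polytime[OF assms(1)] assms(2) arith_fun_const)
qed simp

end

section \<open>Runs of Students as arithmetical relations\<close>

lemma preimage_iff:
  assumes "\<And>l. bij_betw h (cube l) (cube l)"
  shows "preimage h u = v \<longleftrightarrow> length v = length u \<and> h v = u"
proof -
  have "bij_betw h (cube (length u)) (cube (length u))" "u \<in> cube (length u)"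
    using assms by (auto simp: cube_def)
  then have "preimage h u \<in> cube (length u)" "h (preimage h u) = u"
    unfolding preimage_def by (metis bij_betw_imp_surj_on inv_into_into f_inv_into_f)+
  moreover have "v = preimage h u" if "length v = length u" "h v = u"
    using that calculation assms[of "length u"] by (metis (mono_tags, lifting) bij_betw_inv_into_left cube_def mem_Collect_eq preimage_def)
  ultimately show ?thesis by (auto simp: cube_def)
qed

text \<open>In \<open>game h B S J b \<omega> c T\<close> the string \<open>T\<close> is the encoded information the Student has so far.\<close>

primrec game ::
  "(bool list \<Rightarrow> bool list) \<Rightarrow> (bool list \<Rightarrow> bool) \<Rightarrow> (bool list \<Rightarrow> bool list) \<Rightarrow>
   bool list \<Rightarrow> bool list \<Rightarrow> bool list \<Rightarrow> nat \<Rightarrow> bool list \<Rightarrow> bool list \<Rightarrow> bool" where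
  "game h B S J b \<omega> 0 T y \<longleftrightarrow> S T = False # y \<or> S T = [] \<and> y = []"
| "game h B S J b \<omega> (Suc c) T y \<longleftrightarrow> (S T = False # y \<or> S T = [] \<and> y = []) \<or>
     (\<exists>i. S T = True # str i \<and> i < length b \<and>
       (B (preimage h (nths \<omega> (row (length \<omega>) J i))) \<longleftrightarrow> bit_at b i) \<and>
       game h B S J b \<omega> c (T @ enc (preimage h (nths \<omega> (row (length \<omega>) J i)))) y)"

text \<open>A new answer at the end of the list just appends its encoding to the tuple. A run
  therefore depends only on one accumulated string, that is, on one number instead of a list of
  strings.\<close>

lemma student_run_game:
  "student_run h B S J b w \<omega> c vs = Output y \<longleftrightarrow> game h B S J b \<omega> c (tuple (J # b # w # \<omega> # vs)) y"
proof (induction c arbitrary: vs)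
  case 0
  show ?case by (auto split: list.splits bool.splits)
next
  case (Suc c)
  let ?T = "tuple (J # b # w # \<omega> # vs)"
  show ?case
  proof (cases "S ?T")
    case (Cons q x)
    have "True # x = True # str i \<longleftrightarrow> i = code x" for i by (metis code_str list.inject str_code)
    then show ?thesis using Cons by (cases q) (auto simp: Suc Let_def bit_at)
  qed auto
qed

context std
begin

lemma arith_fun_preimage:
  assumes "polytime h" "\<And>l. bij_betw h (cube l) (cube l)" "arith_fun (\<lambda>e. code (f e))"
  shows "arith_fun (\<lambda>e. code (preimage h (f e)))"
proof (rule arith_funI)
  show "code (preimage h (f e)) = y \<longleftrightarrow> length (str y) = length (f e) \<and> h (str y) = f e" for e y
    using preimage_iff[OF assms(2)] by (metis code_str str_code)
qed (intro arith_intros arith_fun_polytime[OF assms(1)] arith_fun_rename[OF assms(3)])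

text \<open>The query bound \<open>c\<close> is standard, so the rounds unfold into one formula for
  each \<open>c\<close>; no coding of the sequence of rounds is needed.\<close>

lemma arith_rel_game:
  assumes "polytime h" "\<And>l. bij_betw h (cube l) (cube l)" "polytime (\<lambda>v. [B v])" "polytime S"
    and "arith_fun (\<lambda>e. code (J e))" "arith_fun (\<lambda>e. code (b e))" "arith_fun (\<lambda>e. code (\<omega> e))"
    and "arith_fun (\<lambda>e. code (T e))" "arith_fun (\<lambda>e. code (y e))"
  shows "arith_rel (\<lambda>e. game h B S (J e) (b e) (\<omega> e) c (T e) (y e))"
  using assms(5-9)
proof (induction c arbitrary: J b \<omega> T y)
  case 0
  then show ?case unfolding game.simps
    by (intro arith_intros arith_fun_polytime[OF assms(4)])
next
  case (Suc c)
  note shift = Suc.prems[THEN arith_fun_rename[where \<sigma> = Suc]] Suc.prems[THEN arith_fun_rename[where \<sigma> = "\<lambda>i. Suc (Suc i)"]]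
  show ?case unfolding game.simps
    by (intro arith_intros Suc.IH arith_fun_polytime[OF assms(4)] arith_rel_polytime_pred[OF assms(3)]
        arith_fun_preimage[OF assms(1,2)] Suc.prems shift)
qed

lemma arith_rel_student_run:
  assumes "polytime h" "\<And>l. bij_betw h (cube l) (cube l)" "polytime (\<lambda>v. [B v])" "polytime S"
    and "arith_fun (\<lambda>e. code (J e))" "arith_fun (\<lambda>e. code (b e))" "arith_fun (\<lambda>e. code (w e))"
    and "arith_fun (\<lambda>e. code (\<omega> e))" "arith_fun (\<lambda>e. code (y e))"
  shows "arith_rel (\<lambda>e. student_run h B S (J e) (b e) (w e) (\<omega> e) c [] = Output (y e))"
  unfolding student_run_game tuple_simps
  by (intro arith_rel_game assms arith_intros)

lemma arith_rel_set_decode [arith_intros]: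
  "arith_fun f \<Longrightarrow> arith_fun g \<Longrightarrow> arith_rel (\<lambda>e. f e \<in> set_decode (g e))"
  unfolding set_decode_def mem_Collect_eq by (intro arith_intros)

lemma arith_fun_card_set_decode [arith_intros]:
  assumes "arith_fun f" shows "arith_fun (\<lambda>e. card (set_decode (f e)))"
proof -
  \<comment> \<open>All members of the set coded by \<open>x\<close> are below \<open>x\<close>, so
    counting up to \<open>x\<close> finds them all.\<close>
  have *: "card (set_decode x) = rec_nat 0 (\<lambda>i v. if i \<in> set_decode x then Suc v else v) x" for x
  proof -
    have "card (set_decode x \<inter> {..<k}) = rec_nat 0 (\<lambda>i v. if i \<in> set_decode x then Suc v else v) k" for k
      by (induction k) (auto simp: lessThan_Suc Int_insert_right)
    moreover have "i < x" if "i \<in> set_decode x" for i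
    proof (rule ccontr)
      assume "\<not> i < x"
      then have "x < 2 ^ i" using less_exp[of i] by linarith
      then show False using that by (simp add: set_decode_def)
    qed
    then have "set_decode x \<inter> {..<x} = set_decode x" by auto
    ultimately show ?thesis by metis
  qed
  show ?thesis unfolding *
    by (intro arith_fun_rec_nat[where s = "\<lambda>i v e. if i \<in> set_decode (f e) then Suc v else v"]
        arith_intros arith_fun_rename[OF assms] assms)
qed

end

section \<open>Running time of programs\<close>

definition runs :: "prog \<Rightarrow> store \<Rightarrow> nat \<Rightarrow> store \<Rightarrow> bool" where
  "runs p s T s' \<longleftrightarrow> (\<exists>t\<le>T. exec p s t s')"

lemma runs_mono: "runs p s T s' \<Longrightarrow> T \<le> T' \<Longrightarrow> runs p s T' s'"
  unfolding runs_def using le_trans by blast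

lemma runs_Seq: "runs p s T s' \<Longrightarrow> runs q s' T' s'' \<Longrightarrow> runs (Seq p q) s (T + T') s''"
  unfolding runs_def by (meson add_mono exec.intros(4))

lemma runs_Loop_Nil: "s r = [] \<Longrightarrow> runs (Loop r p) s (Suc 0) s"
  unfolding runs_def using exec.intros(8)[of s r p] by auto

lemma runs_Loop_step:
  assumes "s r \<noteq> []" "runs p s T s'" "runs (Loop r p) s' T' s''"
  shows "runs (Loop r p) s (Suc (T + T')) s''"
proof -
  obtain t t' where "t \<le> T" "exec p s t s'" "t' \<le> T'" "exec (Loop r p) s' t' s''"
    using assms(2,3) by (auto simp: runs_def)
  moreover from this have "exec (Loop r p) s (Suc (t + t')) s''"
    using assms(1) exec.intros(9) by blast
  ultimately show ?thesis unfolding runs_def by (intro exI[of _ "Suc (t + t')"]) auto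
qed

text \<open>Loop bodies are loop-free: their time is constant and the simplifier can evaluate their
  effect. \<open>cost\<close> adds up all branches and is an upper bound only; the
  \<open>Loop\<close> equations of \<open>cost\<close> and \<open>effect\<close> are
  dummies.\<close>

primrec loopfree :: "prog \<Rightarrow> bool" where
  "loopfree Skip \<longleftrightarrow> True"
| "loopfree (Push r x) \<longleftrightarrow> True"
| "loopfree (Pop r) \<longleftrightarrow> True"
| "loopfree (Seq p q) \<longleftrightarrow> loopfree p \<and> loopfree q"
| "loopfree (Branch r p q q') \<longleftrightarrow> loopfree p \<and> loopfree q \<and> loopfree q'"
| "loopfree (Loop r p) \<longleftrightarrow> False"

primrec cost :: "prog \<Rightarrow> nat" where
  "cost Skip = 1"
| "cost (Push r x) = 1"
| "cost (Pop r) = 1"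
| "cost (Seq p q) = cost p + cost q"
| "cost (Branch r p q q') = Suc (cost p + cost q + cost q')"
| "cost (Loop r p) = 0"

primrec effect :: "prog \<Rightarrow> store \<Rightarrow> store" where
  "effect Skip s = s"
| "effect (Push r x) s = s(r := x # s r)"
| "effect (Pop r) s = s(r := tl (s r))"
| "effect (Seq p q) s = effect q (effect p s)"
| "effect (Branch r p q q') s =
     (case s r of [] \<Rightarrow> effect p s | c # x \<Rightarrow> if c then effect q' s else effect q s)"
| "effect (Loop r p) s = s"

lemma runs_loopfree: "loopfree p \<Longrightarrow> runs p s (cost p) (effect p s)"
proof (induction p arbitrary: s)
  case (Seq p q)
  then show ?case by (auto intro: runs_Seq)
next
  case (Branch r p q q')
  then obtain t t1 t2 where *: "t \<le> cost p" "exec p s t (effect p s)"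
    "t1 \<le> cost q" "exec q s t1 (effect q s)" "t2 \<le> cost q'" "exec q' s t2 (effect q' s)"
    by (fastforce simp: runs_def)
  show ?case
  proof (cases "s r")
    case Nil
    then have "exec (Branch r p q q') s (Suc t) (effect p s)" using * by (intro exec.intros)
    then show ?thesis using Nil *(1) unfolding runs_def by (intro exI[of _ "Suc t"]) auto
  next
    case (Cons c x)
    show ?thesis
    proof (cases c)
      case True
      then have "exec (Branch r p q q') s (Suc t2) (effect q' s)" using * Cons by (auto intro: exec.intros)
      then show ?thesis using Cons True *(5) unfolding runs_def by (intro exI[of _ "Suc t2"]) auto
    next
      case False
      then have "exec (Branch r p q q') s (Suc t1) (effect q s)" using * Cons by (auto intro: exec.intros)
      then show ?thesis using Cons False *(3) unfolding runs_def by (intro exI[of _ "Suc t1"]) auto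
    qed
  qed
next
  case Skip
  show ?case unfolding runs_def cost.simps effect.simps using exec.intros(1) by blast
next
  case (Push r x)
  show ?case unfolding runs_def cost.simps effect.simps using exec.intros(2) by blast
next
  case (Pop r)
  show ?case unfolding runs_def cost.simps effect.simps using exec.intros(3) by blast
qed auto

lemma runs_Loop_effect:
  "s r \<noteq> [] \<Longrightarrow> loopfree p \<Longrightarrow> runs (Loop r p) (effect p s) T s' \<Longrightarrow> runs (Loop r p) s (Suc (cost p + T)) s'"
  using runs_Loop_step runs_loopfree by blast

lemma runs_Loop_last:
  assumes "s r \<noteq> []" "loopfree p" "effect p s = s'" "s' r = []"
  shows "runs (Loop r p) s (cost p + 2) s'"
  using runs_Loop_effect[of s r p "Suc 0" s'] runs_Loop_Nil[of s' r p] assms by simp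

lemma exec_length: "exec p s t s' \<Longrightarrow> length (s' r) \<le> length (s r) + t"
  by (induction rule: exec.induct) auto

subsection \<open>Renaming of stacks\<close>

primrec rename :: "(nat \<Rightarrow> nat) \<Rightarrow> prog \<Rightarrow> prog" where
  "rename f Skip = Skip"
| "rename f (Push r x) = Push (f r) x"
| "rename f (Pop r) = Pop (f r)"
| "rename f (Seq p q) = Seq (rename f p) (rename f q)"
| "rename f (Branch r p q q') = Branch (f r) (rename f p) (rename f q) (rename f q')"
| "rename f (Loop r p) = Loop (f r) (rename f p)"

text \<open>The store \<open>S\<close> with the stacks in the range of \<open>f\<close> replaced by
  those of \<open>s\<close>. Renaming to the even or to the odd stacks lets subprograms run side by
  side without interference.\<close>

definition embed :: "(nat \<Rightarrow> nat) \<Rightarrow> store \<Rightarrow> store \<Rightarrow> store" where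
  "embed f s S = (\<lambda>q. if q \<in> range f then s (inv f q) else S q)"

lemma embed_apply: "inj f \<Longrightarrow> embed f s S (f r) = s r"
  by (simp add: embed_def)

lemma embed_other: "q \<notin> range f \<Longrightarrow> embed f s S q = S q"
  by (simp add: embed_def)

lemma embed_upd: "inj f \<Longrightarrow> embed f (s(r := x)) S = (embed f s S)(f r := x)"
  by (auto simp: embed_def fun_eq_iff)

lemma exec_rename: "exec p s t s' \<Longrightarrow> inj f \<Longrightarrow> exec (rename f p) (embed f s S) t (embed f s' S)"
proof (induction rule: exec.induct)
  case (2 r x s)
  then show ?case using exec.intros(2)[of "f r" x "embed f s S"]
    by (simp only: rename.simps embed_upd embed_apply)
next
  case (3 r s)
  then show ?case using exec.intros(3)[of "f r" "embed f s S"]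
    by (simp only: rename.simps embed_upd embed_apply)
next
  case (9 s r p t s' t' s'')
  then show ?case using exec.intros(9)[of "embed f s S" "f r" "rename f p"] by (simp add: embed_apply)
qed (auto intro: exec.intros exec.intros(1,8)[unfolded One_nat_def] simp: embed_apply)

subsection \<open>Elementary programs\<close>

definition move :: "nat \<Rightarrow> nat \<Rightarrow> prog" where
  "move a b = Loop a (Branch a Skip (Seq (Pop a) (Push b False)) (Seq (Pop a) (Push b True)))"

lemma runs_move:
  assumes "a \<noteq> b"
  shows "runs (move a b) s (Suc (8 * length (s a))) (s(a := [], b := rev (s a) @ s b))"
proof (induction "s a" arbitrary: s)
  case Nil
  then have "s(a := [], b := rev (s a) @ s b) = s" by (auto simp: fun_eq_iff)
  note eq = this
  have "runs (move a b) s (Suc 0) s" unfolding move_def by (rule runs_Loop_Nil) (simp flip: Nil)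
  then show ?case unfolding eq by (rule runs_mono) simp
next
  case (Cons c x)
  let ?p = "Branch a Skip (Seq (Pop a) (Push b False)) (Seq (Pop a) (Push b True))"
  have e: "effect ?p s = s(a := x, b := c # s b)" using Cons(2)[symmetric] assms by (auto simp: fun_eq_iff)
  have "runs (move a b) (effect ?p s) (Suc (8 * length x)) (s(a := [], b := rev (s a) @ s b))"
    using Cons(1)[of "effect ?p s"] assms unfolding e Cons(2)[symmetric] by (simp add: fun_upd_twist)
  then have "runs (move a b) s (Suc (cost ?p + Suc (8 * length x))) (s(a := [], b := rev (s a) @ s b))"
    unfolding move_def by (intro runs_Loop_effect) (use Cons(2)[symmetric] in auto)
  then show ?case by (rule runs_mono) (simp flip: Cons(2))
qed

definition move2 :: "nat \<Rightarrow> nat \<Rightarrow> nat \<Rightarrow> prog" where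
  "move2 a b c = Loop a (Branch a Skip (Seq (Pop a) (Seq (Push b False) (Push c False)))
     (Seq (Pop a) (Seq (Push b True) (Push c True))))"

lemma runs_move2:
  assumes "a \<noteq> b" "a \<noteq> c" "b \<noteq> c"
  shows "runs (move2 a b c) s (Suc (12 * length (s a)))
           (s(a := [], b := rev (s a) @ s b, c := rev (s a) @ s c))"
proof (induction "s a" arbitrary: s)
  case Nil
  then have "s(a := [], b := rev (s a) @ s b, c := rev (s a) @ s c) = s" by (auto simp: fun_eq_iff)
  note eq = this
  have "runs (move2 a b c) s (Suc 0) s" unfolding move2_def by (rule runs_Loop_Nil) (simp flip: Nil)
  then show ?case unfolding eq by (rule runs_mono) simp
next
  case (Cons d x)
  let ?p = "Branch a Skip (Seq (Pop a) (Seq (Push b False) (Push c False)))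
     (Seq (Pop a) (Seq (Push b True) (Push c True)))"
  let ?s = "s(a := [], b := rev (s a) @ s b, c := rev (s a) @ s c)"
  have e: "effect ?p s = s(a := x, b := d # s b, c := d # s c)"
    using Cons(2)[symmetric] assms by (auto simp: fun_eq_iff)
  let ?t = "s(a := x, b := d # s b, c := d # s c)"
  have "?t(a := [], b := rev (?t a) @ ?t b, c := rev (?t a) @ ?t c) = ?s"
    using Cons(2)[symmetric] assms by (auto simp: fun_eq_iff)
  with Cons(1)[of ?t] have "runs (move2 a b c) (effect ?p s) (Suc (12 * length x)) ?s"
    using assms unfolding e by simp
  then have "runs (move2 a b c) s (Suc (cost ?p + Suc (12 * length x))) ?s"
    unfolding move2_def by (intro runs_Loop_effect) (use Cons(2)[symmetric] in auto)
  then show ?case by (rule runs_mono) (simp flip: Cons(2))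
qed

definition clear :: "nat \<Rightarrow> prog" where
  "clear a = Loop a (Pop a)"

lemma runs_clear: "runs (clear a) s (Suc (2 * length (s a))) (s(a := []))"
proof (induction "s a" arbitrary: s)
  case Nil
  then have "s(a := []) = s" by (auto simp: fun_eq_iff)
  note eq = this
  have "runs (clear a) s (Suc 0) s" unfolding clear_def by (rule runs_Loop_Nil) (simp flip: Nil)
  then show ?case unfolding eq by (rule runs_mono) simp
next
  case (Cons c x)
  have "runs (clear a) (effect (Pop a) s) (Suc (2 * length x)) (s(a := []))"
    using Cons(1)[of "s(a := x)"] Cons(2)[symmetric] by simp
  then have "runs (clear a) s (Suc (cost (Pop a) + Suc (2 * length x))) (s(a := []))"
    unfolding clear_def by (intro runs_Loop_effect) (use Cons(2)[symmetric] in auto)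
  then show ?case by (rule runs_mono) (simp flip: Cons(2))
qed

text \<open>Splits the encoding of a string off stack \<open>a\<close> and leaves the string, reversed, on stack \<open>b\<close>;
  stack \<open>c\<close> serves as the loop flag.\<close>

definition decode_step :: "nat \<Rightarrow> nat \<Rightarrow> nat \<Rightarrow> prog" where
  "decode_step a b c = Branch a (Pop c) (Seq (Pop a) (Pop c))
     (Seq (Pop a) (Branch a (Pop c) (Seq (Pop a) (Push b False)) (Seq (Pop a) (Push b True))))"

text \<open>The first equation and the third give defaults for strings that are not encodings, since
  the decoder has to halt in time on every string.\<close>

fun split_enc :: "bool list \<Rightarrow> bool list \<times> bool list" where
  "split_enc [] = ([], [])"
| "split_enc (False # y) = ([], y)"
| "split_enc [True] = ([], [])"
| "split_enc (True # c # y) = (c # fst (split_enc y), snd (split_enc y))"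

lemma split_enc_enc: "split_enc (enc x @ y) = (x, y)"
  by (induction x) (auto simp: enc_def)

lemma length_split_enc: "length (fst (split_enc x)) + length (snd (split_enc x)) \<le> length x"
  by (induction x rule: split_enc.induct) auto

lemma runs_decode_loop:
  assumes "distinct [a, b, c]" "s c = [True]"
  shows "runs (Loop c (decode_step a b c)) s (30 * Suc (length (s a)))
    (s(a := snd (split_enc (s a)), b := rev (fst (split_enc (s a))) @ s b, c := []))"
  using assms(2)
proof (induction "s a" arbitrary: s rule: split_enc.induct)
  case 1
  have "effect (decode_step a b c) s =
      s(a := snd (split_enc (s a)), b := rev (fst (split_enc (s a))) @ s b, c := [])"
    using 1(1)[symmetric] 1(2) assms(1) by (auto simp: decode_step_def fun_eq_iff)
  from runs_Loop_last[OF _ _ this] show ?case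
    by (rule runs_mono) (use 1(2) in \<open>auto simp: decode_step_def\<close>)
next
  case (2 y)
  have "effect (decode_step a b c) s =
      s(a := snd (split_enc (s a)), b := rev (fst (split_enc (s a))) @ s b, c := [])"
    using 2(1)[symmetric] 2(2) assms(1) by (auto simp: decode_step_def fun_eq_iff)
  from runs_Loop_last[OF _ _ this] show ?case
    by (rule runs_mono) (use 2(2) in \<open>auto simp: decode_step_def\<close>)
next
  case 3
  have "effect (decode_step a b c) s =
      s(a := snd (split_enc (s a)), b := rev (fst (split_enc (s a))) @ s b, c := [])"
    using 3(1)[symmetric] 3(2) assms(1) by (auto simp: decode_step_def fun_eq_iff)
  from runs_Loop_last[OF _ _ this] show ?case
    by (rule runs_mono) (use 3(2) in \<open>auto simp: decode_step_def\<close>)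
next
  case (4 d y)
  let ?s = "effect (decode_step a b c) s"
  have e: "?s = s(a := y, b := d # s b)"
    using 4(3)[symmetric] 4(4) assms(1) by (cases d) (auto simp: decode_step_def fun_eq_iff)
  have "runs (Loop c (decode_step a b c)) ?s (30 * Suc (length y))
      (?s(a := snd (split_enc y), b := rev (fst (split_enc y)) @ d # s b, c := []))"
    using 4(1)[of ?s] assms(1) 4(4) by (simp add: e)
  also have "?s(a := snd (split_enc y), b := rev (fst (split_enc y)) @ d # s b, c := []) =
      s(a := snd (split_enc (s a)), b := rev (fst (split_enc (s a))) @ s b, c := [])"
    using 4(3)[symmetric] assms(1) by (auto simp: e fun_eq_iff)
  finally have "runs (Loop c (decode_step a b c)) s
      (Suc (cost (decode_step a b c) + 30 * Suc (length y)))
      (s(a := snd (split_enc (s a)), b := rev (fst (split_enc (s a))) @ s b, c := []))"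
    by (rule runs_Loop_effect[rotated 2]) (use 4(4) in \<open>auto simp: decode_step_def\<close>)
  then show ?case by (rule runs_mono) (simp add: decode_step_def flip: 4(3))
qed

definition decode :: "nat \<Rightarrow> nat \<Rightarrow> nat \<Rightarrow> prog" where
  "decode a b c = Seq (Push c True) (Loop c (decode_step a b c))"

lemma runs_decode:
  assumes "distinct [a, b, c]" "s c = []"
  shows "runs (decode a b c) s (Suc (30 * Suc (length (s a))))
    (s(a := snd (split_enc (s a)), b := rev (fst (split_enc (s a))) @ s b))"
proof -
  let ?s = "effect (Push c True) s"
  let ?s' = "s(a := snd (split_enc (s a)), b := rev (fst (split_enc (s a))) @ s b)"
  have "?s(a := snd (split_enc (?s a)), b := rev (fst (split_enc (?s a))) @ ?s b, c := []) = ?s'"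
    using assms by (auto simp: fun_eq_iff)
  moreover have "?s c = [True]" "?s a = s a" using assms by auto
  ultimately have "runs (Loop c (decode_step a b c)) ?s (30 * Suc (length (s a))) ?s'"
    using runs_decode_loop[OF assms(1), of ?s] assms by simp
  from runs_Seq[OF runs_loopfree this] show ?thesis unfolding decode_def by simp
qed

subsection \<open>Matching patterns\<close>

text \<open>A clause is a pattern for the input and a string, which is emitted if the pattern matches.\<close>

type_synonym clause = "bool option list \<times> bool list"

definition matches :: "bool option list \<Rightarrow> bool list \<Rightarrow> bool" where
  "matches p u \<longleftrightarrow> list_all2 (\<lambda>a c. a \<noteq> Some (\<not> c)) p u"

text \<open>A table is a list of clauses with mutually exclusive patterns: exactly one entry is
  emitted. Concatenation of clause lists is concatenation of outputs.\<close>

definition emit :: "clause list \<Rightarrow> bool list \<Rightarrow> bool list" where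
  "emit cls u = concat (map (\<lambda>(p, x). if matches p u then x else []) cls)"

text \<open>
  Clauses are compiled to instructions of three bits for a machine with a head on \<open>u\<close> (\<open>xs\<close> to the
  right, reversed \<open>ys\<close> to the left), a flag \<open>k\<close> and the reversed output \<open>z\<close>.
\<close>

type_synonym config = "bool list \<times> bool list \<times> bool list \<times> bool list"

text \<open>A move beyond either end of the tape changes nothing, and \<open>True # tl k\<close>
  sets the flag while keeping it at most one bit long.\<close>

fun instr :: "bool \<times> bool \<times> bool \<Rightarrow> config \<Rightarrow> config" where
  "instr (False, care, c) (xs, ys, k, z) =
     (tl xs, take 1 xs @ ys, if care \<and> xs \<noteq> [] \<and> hd xs \<noteq> c then tl k else k, z)"
| "instr (True, False, c) (xs, ys, k, z) = (xs, ys, k, if k = [] then z else c # z)"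
| "instr (True, True, False) (xs, ys, k, z) = (take 1 ys @ xs, tl ys, k, z)"
| "instr (True, True, True) (xs, ys, k, z) = (xs, ys, True # tl k, z)"

fun instrs :: "bool list \<Rightarrow> (bool \<times> bool \<times> bool) list" where
  "instrs (a # b # c # d) = (a, b, c) # instrs d"
| "instrs _ = []"

definition shift_right :: "prog" where
  "shift_right = Branch 3 Skip (Seq (Pop 3) (Push 5 False)) (Seq (Pop 3) (Push 5 True))"

definition shift_left :: "prog" where
  "shift_left = Branch 5 Skip (Seq (Pop 5) (Push 3 False)) (Seq (Pop 5) (Push 3 True))"

text \<open>Stack 1 holds the instructions, stacks 3, 5, 7, 9 the configuration.\<close>

definition interp_step :: "prog" where
  "interp_step = Branch 1 Skip
     (Seq (Pop 1) (Branch 1 Skip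
       (Seq (Pop 1) (Branch 1 Skip (Seq (Pop 1) shift_right) (Seq (Pop 1) shift_right)))
       (Seq (Pop 1) (Branch 1 Skip
         (Seq (Pop 1) (Seq (Branch 3 Skip Skip (Pop 7)) shift_right))
         (Seq (Pop 1) (Seq (Branch 3 Skip (Pop 7) Skip) shift_right))))))
     (Seq (Pop 1) (Branch 1 Skip
       (Seq (Pop 1) (Branch 1 Skip
         (Seq (Pop 1) (Branch 7 Skip (Push 9 False) (Push 9 False)))
         (Seq (Pop 1) (Branch 7 Skip (Push 9 True) (Push 9 True)))))
       (Seq (Pop 1) (Branch 1 Skip
         (Seq (Pop 1) shift_left)
         (Seq (Pop 1) (Seq (Pop 7) (Push 7 True)))))))"

definition set_config :: "store \<Rightarrow> config \<Rightarrow> store" where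
  "set_config s C = (case C of (xs, ys, k, z) \<Rightarrow> s(3 := xs, 5 := ys, 7 := k, 9 := z))"

lemma effect_shift_right: "effect shift_right s = s(3 := tl (s 3), 5 := take 1 (s 3) @ s 5)"
  by (cases "s 3") (auto simp: shift_right_def fun_eq_iff)

lemma effect_shift_left: "effect shift_left s = s(5 := tl (s 5), 3 := take 1 (s 5) @ s 3)"
  by (cases "s 5") (auto simp: shift_left_def fun_eq_iff)

lemma effect_interp_step:
  assumes "s 1 = a # b # c # d"
  shows "effect interp_step s =
    set_config (s(1 := d)) (instr (a, b, c) (s 3, s 5, s 7, s 9))"
proof -
  let ?s = "s(1 := d)"
  let ?r = "effect shift_right" and ?l = "effect shift_left"
  have test: "effect (Branch 3 Skip Skip (Pop 7)) ?s = ?s(7 := if s 3 \<noteq> [] \<and> hd (s 3) \<noteq> False then tl (s 7) else s 7)"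
    "effect (Branch 3 Skip (Pop 7) Skip) ?s = ?s(7 := if s 3 \<noteq> [] \<and> hd (s 3) \<noteq> True then tl (s 7) else s 7)"
    by (cases "s 3"; simp add: fun_eq_iff)+
  have emit: "effect (Branch 7 Skip (Push 9 c) (Push 9 c)) ?s = ?s(9 := if s 7 = [] then s 9 else c # s 9)" for c
    by (cases "s 7"; simp add: fun_eq_iff)
  have "effect interp_step s =
    (if a then if b then if c then effect (Seq (Pop 7) (Push 7 True)) ?s else ?l ?s
       else effect (Branch 7 Skip (Push 9 c) (Push 9 c)) ?s
     else if b then ?r (if c then effect (Branch 3 Skip (Pop 7) Skip) ?s else effect (Branch 3 Skip Skip (Pop 7)) ?s)
       else ?r ?s)"
    using assms by (simp add: interp_step_def del: effect.simps(5)) (simp add: effect.simps(5)[of 1])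
  then show ?thesis
    unfolding test emit effect_shift_right effect_shift_left set_config_def
    by (cases a; cases b; cases c; simp add: fun_eq_iff)
qed

lemma set_config_simps [simp]:
  "set_config s C 3 = fst C" "set_config s C 5 = fst (snd C)" "set_config s C 7 = fst (snd (snd C))"
  "set_config s C 9 = snd (snd (snd C))" "q \<notin> {3, 5, 7, 9} \<Longrightarrow> set_config s C q = s q"
  by (auto simp: set_config_def split: prod.splits)

definition interp_loop :: "prog" where
  "interp_loop = Loop 1 interp_step"

lemma loopfree_interp_step: "loopfree interp_step"
  by (simp add: interp_step_def shift_right_def shift_left_def)

text \<open>Only the output stack and the untouched stacks are described, as the rest is never read
  again. An incomplete instruction of one or two bits at the end is discarded, which bounds the time
  also for malformed code. All stacks used are odd; the even ones stay free for the tester.\<close>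

lemma runs_interp_loop:
  "\<exists>s'. runs interp_loop s (Suc (Suc (cost interp_step) * length (s 1))) s' \<and>
     (\<forall>q. q \<notin> {1, 3, 5, 7, 9} \<longrightarrow> s' q = s q) \<and>
     s' 9 = snd (snd (snd (fold instr (instrs (s 1)) (s 3, s 5, s 7, s 9))))"
proof (induction "s 1" arbitrary: s rule: instrs.induct)
  case (1 a b c d)
  let ?s = "effect interp_step s"
  have e: "?s = set_config (s(1 := d)) (instr (a, b, c) (s 3, s 5, s 7, s 9))"
    using 1(2)[symmetric] by (rule effect_interp_step)
  have "d = ?s 1" by (simp add: e)
  from 1(1)[of ?s, OF this] obtain s' where s': "runs interp_loop ?s (Suc (Suc (cost interp_step) * length (?s 1))) s'"
    "\<forall>q. q \<notin> {1, 3, 5, 7, 9} \<longrightarrow> s' q = ?s q"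
    "s' 9 = snd (snd (snd (fold instr (instrs (?s 1)) (?s 3, ?s 5, ?s 7, ?s 9))))" by blast
  have "runs interp_loop s (Suc (cost interp_step + Suc (Suc (cost interp_step) * length (?s 1)))) s'"
    unfolding interp_loop_def
    by (rule runs_Loop_effect) (use 1(2)[symmetric] s'(1) loopfree_interp_step in \<open>auto simp: interp_loop_def\<close>)
  moreover have "Suc (cost interp_step + Suc (Suc (cost interp_step) * length (?s 1)))
      \<le> Suc (Suc (cost interp_step) * length (s 1))"
  proof -
    have "length (s 1) = Suc (Suc (Suc (length d)))" "length (?s 1) = length d"
      using arg_cong[OF 1(2), of length] by (simp_all add: e)
    then show ?thesis by (simp only:) simp
  qed
  ultimately have "runs interp_loop s (Suc (Suc (cost interp_step) * length (s 1))) s'"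
    by (rule runs_mono)
  moreover have "\<forall>q. q \<notin> {1, 3, 5, 7, 9} \<longrightarrow> s' q = s q" using s'(2) by (simp add: e)
  moreover have "s' 9 = snd (snd (snd (fold instr (instrs (s 1)) (s 3, s 5, s 7, s 9))))"
  proof -
    have "instrs (s 1) = (a, b, c) # instrs d" using 1(2) by (metis instrs.simps(1))
    then show ?thesis unfolding s'(3) by (simp only:) (simp add: e)
  qed
  ultimately show ?case by blast
next
  case "2_1"
  have "runs interp_loop s (Suc 0) s" unfolding interp_loop_def by (rule runs_Loop_Nil) (use "2_1" in simp)
  moreover have "s (Suc 0) = []" using "2_1" by simp
  ultimately show ?case by (intro exI[of _ s]) simp
next
  case ("2_2" a)
  have "effect interp_step s = s(1 := [])"
    using "2_2"[symmetric] by (cases a) (auto simp: interp_step_def fun_eq_iff)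
  moreover have "s 1 \<noteq> []" using "2_2" by auto
  ultimately have "runs interp_loop s (cost interp_step + 2) (s(1 := []))"
    unfolding interp_loop_def using runs_Loop_last[of s 1 interp_step] loopfree_interp_step by simp
  note r = this
  have eq: "s 1 = [a]" using "2_2" by simp
  show ?case
  proof (intro exI[of _ "s(1 := [])"] conjI)
    show "runs interp_loop s (Suc (Suc (cost interp_step) * length (s 1))) (s(1 := []))"
      by (rule runs_mono[OF r]) (simp add: eq[simplified])
    show "(s(1 := [])) 9 = snd (snd (snd (fold instr (instrs (s 1)) (s 3, s 5, s 7, s 9))))"
      by (simp add: eq[simplified])
  qed simp
next
  case ("2_3" a b)
  have "effect interp_step s = s(1 := [])"
    using "2_3"[symmetric] by (cases a; cases b) (auto simp: interp_step_def fun_eq_iff)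
  moreover have "s 1 \<noteq> []" using "2_3" by auto
  ultimately have "runs interp_loop s (cost interp_step + 2) (s(1 := []))"
    unfolding interp_loop_def using runs_Loop_last[of s 1 interp_step] loopfree_interp_step by simp
  note r = this
  have eq: "s 1 = [a, b]" using "2_3" by simp
  show ?case
  proof (intro exI[of _ "s(1 := [])"] conjI)
    show "runs interp_loop s (Suc (Suc (cost interp_step) * length (s 1))) (s(1 := []))"
      by (rule runs_mono[OF r]) (simp add: eq[simplified])
    show "(s(1 := [])) 9 = snd (snd (snd (fold instr (instrs (s 1)) (s 3, s 5, s 7, s 9))))"
      by (simp add: eq[simplified])
  qed simp
qed

lemma length_instr_output:
  "length (snd (snd (snd (fold instr is C)))) \<le> length (snd (snd (snd C))) + length is"
proof (induction "is" arbitrary: C)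
  case (Cons i "is")
  have "length (snd (snd (snd (instr i C)))) \<le> Suc (length (snd (snd (snd C))))"
    by (cases "(i, C)" rule: instr.cases) auto
  then show ?case using Cons[of "instr i C"] by simp
qed simp

lemma length_instrs: "length (instrs x) \<le> length x"
  by (induction x rule: instrs.induct) auto

text \<open>The head is rewound by \<open>l\<close> left moves, the flag set, the pattern compared,
  and the string emitted under the flag. Surplus left moves are harmless, so the same code also
  serves for the first clause, when the head is still at the left end.\<close>

definition compile_clause :: "nat \<Rightarrow> clause \<Rightarrow> (bool \<times> bool \<times> bool) list" where
  "compile_clause l cl = replicate l (True, True, False) @ [(True, True, True)] @
     map (\<lambda>a. case a of None \<Rightarrow> (False, False, False) | Some c \<Rightarrow> (False, True, c)) (fst cl) @
     map (\<lambda>c. (True, False, c)) (snd cl)"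

lemma fold_rewind: "fold instr (replicate (length ys) (True, True, False)) (xs, ys, k, z) = (rev ys @ xs, [], k, z)"
  by (induction ys arbitrary: xs) auto

lemma fold_match:
  assumes "length p = length xs" "k = [] \<or> k = [True]"
  shows "fold instr (map (\<lambda>a. case a of None \<Rightarrow> (False, False, False) | Some c \<Rightarrow> (False, True, c)) p) (xs, ys, k, z) =
    ([], rev xs @ ys, if matches p xs then k else [], z)"
  using assms
proof (induction p xs arbitrary: ys k rule: list_induct2)
  case (Cons a p c xs)
  from Cons.IH[of "if a = None \<or> a = Some c then k else []"] Cons.prems show ?case
    by (cases a; cases c) (auto simp: matches_def)
qed (auto simp: matches_def)

lemma fold_emit: "fold instr (map (\<lambda>c. (True, False, c)) x) (xs, ys, k, z) = (xs, ys, k, if k = [] then z else rev x @ z)"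
  by (induction x arbitrary: z) auto

text \<open>Between clauses the head is at one of the two ends: at the left one initially, at the
  right one after any clause. This is the invariant that the induction over the clauses
  needs.\<close>

lemma fold_clause:
  assumes "length (fst cl) = length u" "rev ys @ xs = u" "ys = [] \<or> xs = []" "k = [] \<or> k = [True]"
  shows "\<exists>k'. (k' = [] \<or> k' = [True]) \<and> fold instr (compile_clause (length u) cl) (xs, ys, k, z) =
    ([], rev u, k', rev (emit [cl] u) @ z)"
proof -
  have "fold instr (replicate (length u) (True, True, False)) (xs, ys, k, z) = (u, [], k, z)"
  proof (cases "ys = []")
    case True
    have "fold instr (replicate n (True, True, False)) (xs, [], k, z) = (xs, [], k, z)" for n
      by (induction n) auto
    then show ?thesis using True assms(2) by simp
  next
    case False
    then have "length u = length ys" using assms by auto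
    then show ?thesis using fold_rewind[of ys xs k z] assms(2) by simp
  qed
  moreover have "True # tl k = [True]" using assms(4) by auto
  ultimately show ?thesis
    using fold_match[OF assms(1), of "[True]" "[]" z]
    by (cases cl) (auto simp: compile_clause_def fold_emit emit_def)
qed

lemma fold_clauses:
  assumes "\<forall>cl\<in>set cls. length (fst cl) = length u" "rev ys @ xs = u" "ys = [] \<or> xs = []" "k = [] \<or> k = [True]"
  shows "snd (snd (snd (fold instr (concat (map (compile_clause (length u)) cls)) (xs, ys, k, z)))) =
    rev (emit cls u) @ z"
  using assms
proof (induction cls arbitrary: xs ys k z)
  case Nil
  then show ?case by (simp add: emit_def)
next
  case (Cons cl cls)
  obtain k' where k': "k' = [] \<or> k' = [True]" "fold instr (compile_clause (length u) cl) (xs, ys, k, z) =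
    ([], rev u, k', rev (emit [cl] u) @ z)"
    using fold_clause[of cl u ys xs k z] Cons.prems by auto
  show ?case
    using Cons.IH[of "rev u" "[]" k' "rev (emit [cl] u) @ z"] Cons.prems k' by (simp add: emit_def)
qed

definition bits :: "(bool \<times> bool \<times> bool) list \<Rightarrow> bool list" where
  "bits is = concat (map (\<lambda>(a, b, c). [a, b, c]) is)"

lemma instrs_bits: "instrs (bits is) = is"
  by (induction "is") (auto simp: bits_def)

lemma length_bits: "length (bits is) = 3 * length is"
  by (induction "is") (auto simp: bits_def)

definition cls_size :: "clause list \<Rightarrow> nat" where
  "cls_size cls = (\<Sum>(p, x)\<leftarrow>cls. Suc (length p + length x))"

lemma length_compile:
  "\<forall>cl\<in>set cls. length (fst cl) = l \<Longrightarrow> length (concat (map (compile_clause l) cls)) \<le> 2 * cls_size cls"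
  by (induction cls) (auto simp: compile_clause_def cls_size_def)

section \<open>Polynomial bounds\<close>

definition poly_bounded :: "(nat \<Rightarrow> nat) \<Rightarrow> bool" where
  "poly_bounded f \<longleftrightarrow> (\<exists>q. \<forall>x. f x \<le> poly q x)"

lemma poly_nat_mono: "x \<le> y \<Longrightarrow> poly (q :: nat poly) x \<le> poly q y"
  by (induction q) (auto intro: add_mono mult_mono)

named_theorems poly_bounded_intros

lemma poly_bounded_mono: "poly_bounded g \<Longrightarrow> (\<And>x. f x \<le> g x) \<Longrightarrow> poly_bounded f"
  unfolding poly_bounded_def using le_trans by blast

lemma poly_bounded_const [poly_bounded_intros]: "poly_bounded (\<lambda>x. c)"
  unfolding poly_bounded_def by (rule exI[of _ "[:c:]"]) simp

lemma poly_bounded_id [poly_bounded_intros]: "poly_bounded (\<lambda>x. x)"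
  unfolding poly_bounded_def by (rule exI[of _ "[:0, 1:]"]) simp

lemma poly_bounded_add [poly_bounded_intros]:
  assumes "poly_bounded f" "poly_bounded g" shows "poly_bounded (\<lambda>x. f x + g x)"
proof -
  obtain p q where "\<And>x. f x \<le> poly p x" "\<And>x. g x \<le> poly q x"
    using assms by (auto simp: poly_bounded_def)
  then show ?thesis unfolding poly_bounded_def by (intro exI[of _ "p + q"]) (simp add: add_mono)
qed

lemma poly_bounded_mult [poly_bounded_intros]:
  assumes "poly_bounded f" "poly_bounded g" shows "poly_bounded (\<lambda>x. f x * g x)"
proof -
  obtain p q where "\<And>x. f x \<le> poly p x" "\<And>x. g x \<le> poly q x"
    using assms by (auto simp: poly_bounded_def)
  then show ?thesis unfolding poly_bounded_def by (intro exI[of _ "p * q"]) (simp add: mult_mono)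
qed

lemma poly_bounded_Suc [poly_bounded_intros]: "poly_bounded f \<Longrightarrow> poly_bounded (\<lambda>x. Suc (f x))"
  using poly_bounded_add[of f "\<lambda>_. 1"] poly_bounded_const by simp

lemma poly_bounded_power [poly_bounded_intros]: "poly_bounded f \<Longrightarrow> poly_bounded (\<lambda>x. f x ^ k)"
  by (induction k) (auto intro: poly_bounded_intros)

lemma poly_bounded_poly [poly_bounded_intros]:
  assumes "poly_bounded f" shows "poly_bounded (\<lambda>x. poly q (f x))"
proof -
  obtain p where "\<And>x. f x \<le> poly p x" using assms by (auto simp: poly_bounded_def)
  then show ?thesis unfolding poly_bounded_def
    by (intro exI[of _ "pcompose q p"]) (simp add: poly_pcompose poly_nat_mono)
qed

section \<open>Nonuniform computations\<close>

definition init :: "nat set \<Rightarrow> store \<Rightarrow> store" where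
  "init I g = (\<lambda>r. if r \<in> I then g r else [])"

text \<open>
  The variant of \<open>P_poly\<close> in which the input and the components of the advice are given on
  separate stacks: those in \<open>X\<close> hold the input and those in \<open>I - X\<close> the advice. The program
  has to halt in polynomial time also if these stacks have arbitrary contents.
\<close>

definition computes ::
  "prog \<Rightarrow> nat set \<Rightarrow> nat set \<Rightarrow> (nat \<Rightarrow> store) \<Rightarrow> (nat \<Rightarrow> nat) \<Rightarrow> (bool list \<Rightarrow> bool) \<Rightarrow> bool" where
  "computes p I X adv T A \<longleftrightarrow> (finite I \<and> poly_bounded T \<and>
     (\<forall>g. \<exists>s. runs p (init I g) (T (\<Sum>r\<in>I. length (g r))) s) \<and>
     (\<forall>r\<in>I. poly_bounded (\<lambda>l. length (adv l r))) \<and>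
     (\<forall>u. \<exists>t s. exec p (init I (\<lambda>r. if r \<in> X then u else adv (length u) r)) t s \<and> s 0 = [A u]))"

definition nonuniform :: "(bool list \<Rightarrow> bool) \<Rightarrow> bool" where
  "nonuniform A \<longleftrightarrow> (\<exists>p I X adv T. computes p I X adv T A)"

lemma computesD:
  assumes "computes p I X adv T A"
  shows "finite I" "poly_bounded T" "\<exists>s. runs p (init I g) (T (\<Sum>r\<in>I. length (g r))) s"
    "r \<in> I \<Longrightarrow> poly_bounded (\<lambda>l. length (adv l r))"
    "\<exists>t s. exec p (init I (\<lambda>r. if r \<in> X then u else adv (length u) r)) t s \<and> s 0 = [A u]"
  using assms by (auto simp: computes_def)

subsection \<open>Tests\<close>

definition compare_step :: "prog" where
  "compare_step = Branch 0 Skip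
     (Seq (Branch 11 (Pop 13) Skip (Pop 13)) (Seq (Pop 11) (Pop 0)))
     (Seq (Branch 11 (Pop 13) (Pop 13) Skip) (Seq (Pop 11) (Pop 0)))"

lemma effect_compare_step:
  assumes "s 0 = c # x"
  shows "effect compare_step s =
    s(0 := x, 11 := tl (s 11), 13 := if take 1 (s 11) = [c] then s 13 else tl (s 13))"
  using assms by (cases "s 11"; cases c) (auto simp: compare_step_def fun_eq_iff)

lemma loopfree_compare_step: "loopfree compare_step"
  by (simp add: compare_step_def)

lemma runs_compare_loop:
  assumes "s 13 = [] \<or> s 13 = [True]"
  shows "runs (Loop 0 compare_step) s (Suc (Suc (cost compare_step) * length (s 0)))
    (s(0 := [], 11 := drop (length (s 0)) (s 11),
       13 := if take (length (s 0)) (s 11) = s 0 then s 13 else []))"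
  using assms
proof (induction "s 0" arbitrary: s)
  case Nil
  then have eq: "s(0 := [], 11 := drop (length (s 0)) (s 11),
       13 := if take (length (s 0)) (s 11) = s 0 then s 13 else []) = s" by (auto simp: fun_eq_iff)
  have "runs (Loop 0 compare_step) s (Suc 0) s" by (rule runs_Loop_Nil) (simp flip: Nil(1))
  then show ?case unfolding eq by (rule runs_mono) simp
next
  case (Cons c x)
  define s1 where "s1 = effect compare_step s"
  have e: "s1 = s(0 := x, 11 := tl (s 11), 13 := if take 1 (s 11) = [c] then s 13 else tl (s 13))"
    unfolding s1_def using Cons(2)[symmetric] by (rule effect_compare_step)
  have "x = s1 0" "s1 13 = [] \<or> s1 13 = [True]" using Cons(3) by (auto simp: e)
  note IH = Cons(1)[OF this]
  have eq: "s1(0 := [], 11 := drop (length (s1 0)) (s1 11),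
       13 := if take (length (s1 0)) (s1 11) = s1 0 then s1 13 else []) =
     s(0 := [], 11 := drop (length (s 0)) (s 11),
       13 := if take (length (s 0)) (s 11) = s 0 then s 13 else [])"
    using Cons(2)[symmetric] Cons(3) by (cases "s 11") (auto simp: e fun_eq_iff)
  have "s 0 \<noteq> []" by (simp flip: Cons(2))
  from runs_Loop_effect[of s 0, OF this loopfree_compare_step, folded s1_def, OF IH[unfolded eq]]
  show ?case by (rule runs_mono) (simp add: e flip: Cons(2))
qed

definition compare :: "prog" where
  "compare = Seq (Push 13 True) (Seq (Loop 0 compare_step)
     (Seq (Branch 11 Skip (Pop 13) (Pop 13)) (Branch 13 (Push 0 False) Skip (Push 0 True))))"

text \<open>Stack 13 keeps its bit as long as stack 0 agrees with a prefix of stack 11; at the end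
  the rest of stack 11 has to be empty.\<close>

lemma runs_compare:
  assumes "s 13 = []"
  shows "\<exists>s'. runs compare s (20 + Suc (cost compare_step) * length (s 0)) s' \<and> s' 0 = [s 0 = s 11]"
proof -
  let ?p = "Seq (Branch 11 Skip (Pop 13) (Pop 13)) (Branch 13 (Push 0 False) Skip (Push 0 True))"
  let ?s = "effect (Push 13 True) s"
  define s1 where "s1 = ?s(0 := [], 11 := drop (length (?s 0)) (?s 11),
       13 := if take (length (?s 0)) (?s 11) = ?s 0 then ?s 13 else [])"
  have 1: "runs (Push 13 True) s 1 ?s" using runs_loopfree[of "Push 13 True" s] by simp
  have 2: "runs (Loop 0 compare_step) ?s (Suc (Suc (cost compare_step) * length (s 0))) s1"
    using runs_compare_loop[of ?s] assms unfolding s1_def by simp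
  have 3: "runs ?p s1 (cost ?p) (effect ?p s1)" by (rule runs_loopfree) simp
  have "runs compare s (1 + (Suc (Suc (cost compare_step) * length (s 0)) + cost ?p)) (effect ?p s1)"
    unfolding compare_def using runs_Seq[OF 1 runs_Seq[OF 2 3]] .
  then have "runs compare s (20 + Suc (cost compare_step) * length (s 0)) (effect ?p s1)"
    by (rule runs_mono) simp
  moreover have "effect ?p s1 0 = [s 0 = s 11]"
  proof (cases "take (length (s 0)) (s 11) = s 0")
    case True
    then have "s 0 = s 11 \<longleftrightarrow> drop (length (s 0)) (s 11) = []"
      by (metis append_take_drop_id append_self_conv)
    then show ?thesis using True assms by (auto simp: s1_def split: list.split)
  next
    case False
    then have "s 0 \<noteq> s 11" by auto
    then show ?thesis using False assms by (auto simp: s1_def split: list.split)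
  qed
  ultimately show ?thesis by blast
qed

lemma embed_self: "inj f \<Longrightarrow> embed f (\<lambda>r. S (f r)) S = S"
  by (auto simp: embed_def fun_eq_iff)

text \<open>Stack 1 holds the compiled clauses, stack 3 the input, stack 11 the expected value. The
  contents are arbitrary and the time bound depends on their total length only, as
  \<open>computes\<close> demands.\<close>

lemma runs_test:
  assumes G: "\<And>x. \<exists>t s. exec pG ((\<lambda>_. [])(0 := x)) t s \<and> s 0 = G x \<and> t \<le> poly qG (length x)"
    and L: "L = length (g 1) + length (g 3) + length (g 11)"
  shows "\<exists>s. runs (Seq interp_loop (Seq (move 9 0) (Seq (rename (\<lambda>r. 2 * r) pG) compare)))
      (init {1, 3, 11} g)
      (Suc (Suc (cost interp_step) * L) + (Suc (8 * L) + (poly qG L +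
         (20 + Suc (cost compare_step) * (L + poly qG L))))) s \<and>
    s 0 = [G (rev (snd (snd (snd (fold instr (instrs (g 1)) (g 3, [], [], [])))))) = g 11]"
proof -
  let ?s = "init {1, 3, 11} g" and ?f = "\<lambda>r::nat. 2 * r"
  define z where "z = snd (snd (snd (fold instr (instrs (g 1)) (g 3, [], [], []))))"
  have z: "length z \<le> L"
    unfolding z_def using length_instr_output[of "instrs (g 1)" "(g 3, [], [], [])"] length_instrs[of "g 1"] L
    by simp
  obtain s1 where s1: "runs interp_loop ?s (Suc (Suc (cost interp_step) * length (g 1))) s1"
    "\<forall>q. q \<notin> {1, 3, 5, 7, 9} \<longrightarrow> s1 q = ?s q" "s1 9 = z"
    using runs_interp_loop[of ?s] by (auto simp: init_def z_def)
  define s2 where "s2 = s1(9 := [], 0 := rev z)"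
  have "s1 0 = []" using s1(2) by (simp add: init_def)
  then have 2: "runs (move 9 0) s1 (Suc (8 * length z)) s2"
    using runs_move[of 9 0 s1] s1(3) unfolding s2_def by simp
  have inj: "inj ?f" by (simp add: inj_def)
  have sub: "(\<lambda>r. s2 (?f r)) = (\<lambda>_. [])(0 := rev z)"
  proof
    fix r :: nat
    have "2 * r \<notin> {1, 3, 5, 7, 9, 11}" by simp presburger
    then show "s2 (?f r) = ((\<lambda>_. [])(0 := rev z)) r" using s1(2) by (auto simp: s2_def init_def)
  qed
  obtain t s where s: "exec pG ((\<lambda>_. [])(0 := rev z)) t s" "s 0 = G (rev z)" "t \<le> poly qG (length z)"
    using G[of "rev z"] by auto
  define s3 where "s3 = embed ?f s s2"
  have "exec (rename ?f pG) s2 t s3"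
    using exec_rename[OF s(1)[folded sub] inj, of s2] embed_self[OF inj, of s2] by (simp add: s3_def)
  then have 3: "runs (rename ?f pG) s2 (poly qG (length z)) s3"
    using s(3) unfolding runs_def by blast
  have odd: "2 * k + 1 \<notin> range ?f" for k by (auto simp: image_def) presburger
  have "s3 11 = g 11" "s3 13 = []"
    using embed_other[OF odd[of 5], of s s2] embed_other[OF odd[of 6], of s s2] s1(2)
    by (simp_all add: s3_def s2_def init_def)
  moreover have "s3 0 = G (rev z)" using embed_apply[OF inj, of s s2 0] s(2) by (simp add: s3_def)
  ultimately obtain s4 where 4: "runs compare s3 (20 + Suc (cost compare_step) * length (G (rev z))) s4"
    "s4 0 = [G (rev z) = g 11]" using runs_compare[of s3] by auto
  have "length (G (rev z)) \<le> length z + poly qG (length z)"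
    using exec_length[OF s(1), of 0] s(2,3) by simp
  also have "\<dots> \<le> L + poly qG L" using z by (intro add_mono poly_nat_mono)
  finally have len: "length (G (rev z)) \<le> L + poly qG L" .
  have "runs interp_loop ?s (Suc (Suc (cost interp_step) * L)) s1"
  proof (rule runs_mono[OF s1(1)])
    have "length (g 1) \<le> L" using L by simp
    from mult_le_mono2[OF this, of "Suc (cost interp_step)"]
    show "Suc (Suc (cost interp_step) * length (g 1)) \<le> Suc (Suc (cost interp_step) * L)"
      by (simp only: Suc_le_mono)
  qed
  moreover have "runs (move 9 0) s1 (Suc (8 * L)) s2" by (rule runs_mono[OF 2]) (use z in auto)
  moreover have "runs (rename ?f pG) s2 (poly qG L) s3"
    by (rule runs_mono[OF 3]) (use z in \<open>auto intro: poly_nat_mono\<close>)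
  moreover have "runs compare s3 (20 + Suc (cost compare_step) * (L + poly qG L)) s4"
    by (rule runs_mono[OF 4(1)]) (use len in \<open>auto simp del: mult_Suc intro!: mult_le_mono2\<close>)
  ultimately show ?thesis using 4(2) unfolding z_def by (blast intro: runs_Seq)
qed

lemma nonuniform_test:
  assumes "polytime G" "\<And>l. \<forall>cl\<in>set (cls l). length (fst cl) = l"
    and "poly_bounded (\<lambda>l. cls_size (cls l))" "poly_bounded (\<lambda>l. length (e l))"
  shows "nonuniform (\<lambda>u. G (emit (cls (length u)) u) = e (length u))"
proof -
  obtain pG and qG :: "nat poly" where
    G: "\<And>x. \<exists>t s. exec pG ((\<lambda>_. [])(0 := x)) t s \<and> s 0 = G x \<and> t \<le> poly qG (length x)"
    using assms(1) unfolding polytime_def by blast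
  let ?p = "Seq interp_loop (Seq (move 9 0) (Seq (rename (\<lambda>r. 2 * r) pG) compare))"
  let ?T = "\<lambda>L. Suc (Suc (cost interp_step) * L) + (Suc (8 * L) + (poly qG L +
         (20 + Suc (cost compare_step) * (L + poly qG L))))"
  let ?I = "{1, 3, 11} :: nat set" and ?X = "{3} :: nat set"
  define adv where "adv l r = (if r = 1 then bits (concat (map (compile_clause l) (cls l))) else e l)" for l r :: nat
  have sum: "(\<Sum>r\<in>?I. length (g r)) = length (g 1) + length (g 3) + length (g 11)" for g :: store
    by simp
  have "poly_bounded (\<lambda>l. length (adv l r))" for r
  proof (cases "r = 1")
    case True
    \<comment> \<open>There are at most \<open>2 * cls_size\<close> instructions of three bits
      each.\<close>
    have "poly_bounded (\<lambda>l. 6 * cls_size (cls l))" by (intro poly_bounded_intros assms(3))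
    then show ?thesis
      by (rule poly_bounded_mono) (use length_compile[OF assms(2)] True in \<open>simp add: adv_def length_bits mult.assoc[symmetric]\<close>)
  qed (use assms(4) in \<open>simp add: adv_def\<close>)
  moreover have "\<exists>t s. exec ?p (init ?I (\<lambda>r. if r \<in> ?X then u else adv (length u) r)) t s \<and>
      s 0 = [G (emit (cls (length u)) u) = e (length u)]" for u
    using runs_test[OF G refl, of "\<lambda>r. if r \<in> ?X then u else adv (length u) r"]
      fold_clauses[of "cls (length u)" u "[]" u "[]" "[]"] assms(2)[of "length u"]
    by (auto simp: runs_def adv_def instrs_bits)
  moreover have "\<exists>s. runs ?p (init ?I g) (?T (\<Sum>r\<in>?I. length (g r))) s" for g
    unfolding sum using runs_test[OF G refl, of g] by blast
  moreover have "poly_bounded ?T" by (intro poly_bounded_intros)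
  ultimately show ?thesis unfolding nonuniform_def computes_def
    by (intro exI[of _ ?p] exI[of _ ?I] exI[of _ ?X] exI[of _ adv] exI[of _ ?T] conjI) auto
qed

subsection \<open>Boolean combinations\<close>

text \<open>The programs run on the even and on the odd stacks, so each needs its own copies of the
  input. This is why \<open>computes\<close> allows a whole set \<open>X\<close> of input
  stacks.\<close>

lemma nonuniform_combine:
  assumes "nonuniform A" "nonuniform A'"
  shows "nonuniform (\<lambda>u. F (A u) (A' u))"
proof -
  let ?f = "\<lambda>r::nat. 2 * r" and ?f' = "\<lambda>r::nat. 2 * r + 1"
  have inj: "inj ?f" "inj ?f'" by (auto simp: inj_def)
  have disj: "?f r \<noteq> ?f' r'" "?f' r' \<noteq> ?f r" for r r' by presburger+
  obtain p I X adv T where "computes p I X adv T A"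
    using assms(1) unfolding nonuniform_def by blast
  note p = computesD[OF this]
  obtain p' I' X' adv' T' where "computes p' I' X' adv' T' A'"
    using assms(2) unfolding nonuniform_def by blast
  note p' = computesD[OF this]
  obtain q where q: "\<And>x. T x \<le> poly q x" using p(2) by (auto simp: poly_bounded_def)
  obtain q' where q': "\<And>x. T' x \<le> poly q' x" using p'(2) by (auto simp: poly_bounded_def)
  let ?J = "?f ` I \<union> ?f' ` I'" and ?Y = "?f ` X \<union> ?f' ` X'"
  define padv where "padv l r = (if even r then adv l (r div 2) else adv' l (r div 2))" for l r :: nat
  \<comment> \<open>The two results are on stacks 0 and 1, the images of stack 0 under the
    renamings.\<close>
  let ?fin = "\<lambda>a. Branch 1 Skip (Seq (Pop 0) (Push 0 (F a False))) (Seq (Pop 0) (Push 0 (F a True)))"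
  let ?fin' = "Branch 0 Skip (?fin False) (?fin True)"
  let ?p = "Seq (rename ?f p) (Seq (rename ?f' p') ?fin')"
  let ?T = "\<lambda>L. poly q L + (poly q' L + cost ?fin')"
  have sub: "(\<lambda>r. init ?J g (?f r)) = init I (\<lambda>r. g (?f r))"
    "(\<lambda>r. init ?J g (?f' r)) = init I' (\<lambda>r. g (?f' r))" for g
    using disj by (auto simp: init_def fun_eq_iff)
  have seq: "\<exists>s. exec (rename ?f p) (init ?J g) t1 (embed ?f s1 (init ?J g)) \<and>
      exec (rename ?f' p') (embed ?f s1 (init ?J g)) t2 s \<and> s 0 = s1 0 \<and> s 1 = s2 0"
    if "exec p (init I (\<lambda>r. g (?f r))) t1 s1" "exec p' (init I' (\<lambda>r. g (?f' r))) t2 s2" for g t1 t2 s1 s2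
  proof -
    define S where "S = embed ?f s1 (init ?J g)"
    have "exec (rename ?f p) (init ?J g) t1 S"
      using exec_rename[OF that(1) inj(1), of "init ?J g"] embed_self[OF inj(1), of "init ?J g"]
      unfolding S_def sub by simp
    moreover have nin: "?f' r \<notin> range ?f" "?f r \<notin> range ?f'" for r using disj by blast+
    have "(\<lambda>r. S (?f' r)) = init I' (\<lambda>r. g (?f' r))"
      unfolding S_def embed_other[OF nin(1)] by (rule sub(2))
    then have "exec (rename ?f' p') S t2 (embed ?f' s2 S)"
      using exec_rename[OF that(2) inj(2), of S] embed_self[OF inj(2), of S] by simp
    moreover have "embed ?f' s2 S 0 = s1 0"
      using embed_other[OF nin(2)[of 0], of s2 S] embed_apply[OF inj(1), of s1 "init ?J g" 0] by (simp add: S_def)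
    moreover have "embed ?f' s2 S 1 = s2 0" using embed_apply[OF inj(2), of s2 S 0] by simp
    ultimately show ?thesis unfolding S_def by blast
  qed
  have "finite ?J" using p(1) p'(1) by simp
  moreover have "poly_bounded ?T" by (intro poly_bounded_intros)
  moreover have "\<exists>s. runs ?p (init ?J g) (?T (\<Sum>r\<in>?J. length (g r))) s" for g
  proof -
    let ?L = "\<Sum>r\<in>?J. length (g r)"
    have "?L = (\<Sum>r\<in>?f ` I. length (g r)) + (\<Sum>r\<in>?f' ` I'. length (g r))"
      using disj p(1) p'(1) by (intro sum.union_disjoint) auto
    then have L: "?L = (\<Sum>r\<in>I. length (g (?f r))) + (\<Sum>r\<in>I'. length (g (?f' r)))"
      using inj by (simp add: sum.reindex inj_on_subset[OF _ subset_UNIV])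
    obtain t1 s1 where 1: "exec p (init I (\<lambda>r. g (?f r))) t1 s1" "t1 \<le> T (\<Sum>r\<in>I. length (g (?f r)))"
      using p(3)[of "\<lambda>r. g (?f r)"] by (auto simp: runs_def)
    obtain t2 s2 where 2: "exec p' (init I' (\<lambda>r. g (?f' r))) t2 s2" "t2 \<le> T' (\<Sum>r\<in>I'. length (g (?f' r)))"
      using p'(3)[of "\<lambda>r. g (?f' r)"] by (auto simp: runs_def)
    have "t1 \<le> poly q ?L"
      by (rule order.trans[OF 1(2) order.trans[OF q poly_nat_mono]]) (simp only: L le_add1)
    moreover have "t2 \<le> poly q' ?L"
      by (rule order.trans[OF 2(2) order.trans[OF q' poly_nat_mono]]) (simp only: L le_add2)
    moreover obtain s where "exec (rename ?f p) (init ?J g) t1 (embed ?f s1 (init ?J g))"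
      "exec (rename ?f' p') (embed ?f s1 (init ?J g)) t2 s" using seq[OF 1(1) 2(1)] by blast
    ultimately have "runs (rename ?f p) (init ?J g) (poly q ?L) (embed ?f s1 (init ?J g))"
      "runs (rename ?f' p') (embed ?f s1 (init ?J g)) (poly q' ?L) s" unfolding runs_def by blast+
    moreover have "runs ?fin' s (cost ?fin') (effect ?fin' s)" by (rule runs_loopfree) simp
    ultimately show ?thesis using runs_Seq by blast
  qed
  moreover have "poly_bounded (\<lambda>l. length (padv l r))" if "r \<in> ?J" for r
    using that p(4) p'(4) by (auto simp: padv_def)
  moreover have "\<exists>t s. exec ?p (init ?J (\<lambda>r. if r \<in> ?Y then u else padv (length u) r)) t s \<and>
      s 0 = [F (A u) (A' u)]" for u
  proof -
    let ?g = "\<lambda>r. if r \<in> ?Y then u else padv (length u) r"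
    have g: "(\<lambda>r. ?g (?f r)) = (\<lambda>r. if r \<in> X then u else adv (length u) r)"
      "(\<lambda>r. ?g (?f' r)) = (\<lambda>r. if r \<in> X' then u else adv' (length u) r)"
      using disj by (auto simp: fun_eq_iff padv_def)
    obtain t1 s1 where 1: "exec p (init I (\<lambda>r. ?g (?f r))) t1 s1" "s1 0 = [A u]"
      unfolding g using p(5)[of u] by blast
    obtain t2 s2 where 2: "exec p' (init I' (\<lambda>r. ?g (?f' r))) t2 s2" "s2 0 = [A' u]"
      unfolding g using p'(5)[of u] by blast
    obtain s where s: "exec (rename ?f p) (init ?J ?g) t1 (embed ?f s1 (init ?J ?g))"
      "exec (rename ?f' p') (embed ?f s1 (init ?J ?g)) t2 s" "s 0 = [A u]" "s 1 = [A' u]"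
      using seq[OF 1(1) 2(1)] 1(2) 2(2) by auto
    have "runs ?fin' s (cost ?fin') (effect ?fin' s)" by (rule runs_loopfree) simp
    then obtain t3 where "exec ?fin' s t3 (effect ?fin' s)" by (auto simp: runs_def)
    moreover have "effect ?fin' s 0 = [F (A u) (A' u)]"
      using s(3,4) by (cases "A u"; cases "A' u") auto
    ultimately show ?thesis using s(1,2) exec.intros(4) by blast
  qed
  ultimately show ?thesis unfolding nonuniform_def computes_def
    by (intro exI[of _ ?p] exI[of _ ?J] exI[of _ ?Y] exI[of _ padv] exI[of _ ?T] conjI ballI allI)
qed

subsection \<open>Nonuniform computations as advice machines\<close>

text \<open>Stacks in \<open>X\<close> receive the input, the others successive components of the
  advice. The defaults of \<open>split_enc\<close> make this total, also for advice with too few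
  components.\<close>

fun distribute :: "nat set \<Rightarrow> nat list \<Rightarrow> bool list \<Rightarrow> bool list \<Rightarrow> store" where
  "distribute X [] a u = (\<lambda>_. [])"
| "distribute X (r # rs) a u = (if r \<in> X then (distribute X rs a u)(r := u)
     else (distribute X rs (snd (split_enc a)) u)(r := fst (split_enc a)))"

text \<open>Stack 2 holds the advice, stack 4 the input; stacks 6 and 8 are scratch.\<close>

fun distributor :: "nat set \<Rightarrow> nat list \<Rightarrow> prog" where
  "distributor X [] = Skip"
| "distributor X (r # rs) = Seq (if r \<in> X then Seq (move 4 8) (move2 8 4 (2 * r + 1))
     else Seq (decode 2 8 6) (move 8 (2 * r + 1))) (distributor X rs)"

lemma runs_distributor:
  assumes "distinct rs" "s 6 = []" "s 8 = []" "\<forall>r\<in>set rs. s (2 * r + 1) = []"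
    and "length (s 2) \<le> L" "length (s 4) \<le> L"
  shows "\<exists>s'. runs (distributor X rs) s (length rs * (100 * Suc L) + 1) s' \<and>
    (\<forall>r. s' (2 * r + 1) = (if r \<in> set rs then distribute X rs (s 2) (s 4) r else s (2 * r + 1))) \<and> s' 8 = [] \<and> s' 0 = s 0"
  using assms
proof (induction rs arbitrary: s)
  case Nil
  have "runs Skip s 1 s" using runs_loopfree[of Skip s] by simp
  then show ?case using Nil by (intro exI[of _ s]) simp
next
  case (Cons r rs)
  let ?r = "2 * r + 1"
  define a where "a = (if r \<in> X then s 2 else snd (split_enc (s 2)))"
  define x where "x = (if r \<in> X then s 4 else fst (split_enc (s 2)))"
  define s1 where "s1 = s(2 := a, ?r := x)"
  have r: "?r \<noteq> 0" "?r \<noteq> 2" "?r \<noteq> 4" "?r \<noteq> 6" "?r \<noteq> 8" by presburger+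
  have r': "2 * q + 1 \<noteq> (2::nat)" for q :: nat by presburger
  have le: "length (fst (split_enc (s 2))) \<le> L" "length a \<le> L"
    using length_split_enc[of "s 2"] Cons.prems(5) by (auto simp: a_def)
  have "runs (if r \<in> X then Seq (move 4 8) (move2 8 4 ?r) else Seq (decode 2 8 6) (move 8 ?r)) s
      (100 * Suc L) s1"
  proof (cases "r \<in> X")
    case True
    let ?s = "s(4 := [], 8 := rev (s 4) @ s 8)"
    have 1: "runs (move 4 8) s (Suc (8 * length (s 4))) ?s" using runs_move[of 4 8 s] by simp
    have 2: "runs (move2 8 4 ?r) ?s (Suc (12 * length (?s 8)))
       (?s(8 := [], 4 := rev (?s 8) @ ?s 4, ?r := rev (?s 8) @ ?s ?r))"
      using runs_move2[of 8 4 ?r ?s] r by simp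
    have "?s(8 := [], 4 := rev (?s 8) @ ?s 4, ?r := rev (?s 8) @ ?s ?r) = s1"
      using Cons.prems True r by (auto simp: s1_def a_def x_def fun_eq_iff)
    note runs_Seq[OF 1 2[unfolded this]]
    then show ?thesis using True Cons.prems(3,6) by (auto elim!: runs_mono)
  next
    case False
    let ?s = "s(2 := snd (split_enc (s 2)), 8 := rev (fst (split_enc (s 2))) @ s 8)"
    have 1: "runs (decode 2 8 6) s (Suc (30 * Suc (length (s 2)))) ?s"
      using runs_decode[of 2 8 6 s] Cons.prems(2) by simp
    have 2: "runs (move 8 ?r) ?s (Suc (8 * length (?s 8))) (?s(8 := [], ?r := rev (?s 8) @ ?s ?r))"
      using runs_move[of 8 ?r ?s] r by simp
    have "?s(8 := [], ?r := rev (?s 8) @ ?s ?r) = s1"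
      using Cons.prems False r by (auto simp: s1_def a_def x_def fun_eq_iff)
    note runs_Seq[OF 1 2[unfolded this]]
    then show ?thesis using False Cons.prems(3,5) le(1) by (auto elim!: runs_mono)
  qed
  moreover have "\<exists>s'. runs (distributor X rs) s1 (length rs * (100 * Suc L) + 1) s' \<and>
    (\<forall>r. s' (2 * r + 1) = (if r \<in> set rs then distribute X rs (s1 2) (s1 4) r else s1 (2 * r + 1))) \<and> s' 8 = [] \<and> s' 0 = s1 0"
    by (rule Cons.IH) (use Cons.prems r r' le in \<open>auto simp: s1_def\<close>)
  then obtain s' where s': "runs (distributor X rs) s1 (length rs * (100 * Suc L) + 1) s'"
    "\<forall>r. s' (2 * r + 1) = (if r \<in> set rs then distribute X rs (s1 2) (s1 4) r else s1 (2 * r + 1))" "s' 8 = []" "s' 0 = s1 0"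
    by blast
  ultimately have "runs (distributor X (r # rs)) s (100 * Suc L + (length rs * (100 * Suc L) + 1)) s'"
    by (simp only: distributor.simps runs_Seq)
  moreover have "s' (2 * q + 1) = (if q \<in> set (r # rs) then distribute X (r # rs) (s 2) (s 4) q else s (2 * q + 1))" for q
  proof -
    have "s1 2 = a" "s1 4 = s 4" "s1 (2 * q + 1) = (if q = r then x else s (2 * q + 1))"
      using r r' by (auto simp: s1_def)
    then show ?thesis using s'(2)[rule_format, of q] Cons.prems(1) by (auto simp: a_def x_def)
  qed
  moreover have "s' 0 = s 0" using s'(4) r by (auto simp: s1_def)
  ultimately show ?case using s'(3) by (intro exI[of _ s']) (auto simp: algebra_simps)
qed

lemma length_distribute:
  "length a \<le> L \<Longrightarrow> length u \<le> L \<Longrightarrow> length (distribute X rs a u r) \<le> L"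
proof (induction rs arbitrary: a)
  case (Cons q rs)
  show ?case using Cons.IH[of a] Cons.IH[of "snd (split_enc a)"] Cons.prems length_split_enc[of a] by auto
qed simp

lemma distribute_tuple:
  "distinct rs \<Longrightarrow> r \<in> set rs \<Longrightarrow>
    distribute X rs (tuple (map a (filter (\<lambda>r. r \<notin> X) rs))) u r = (if r \<in> X then u else a r)"
  by (induction rs) (auto simp: split_enc_enc)

lemma length_enc: "length (enc x) = Suc (2 * length x)"
  by (induction x) (auto simp: enc_def)

lemma length_tuple: "length (tuple xs) = (\<Sum>x\<leftarrow>xs. Suc (2 * length x))"
  by (induction xs) (auto simp: length_enc)

lemma poly_bounded_sum_list:
  "(\<And>i. i \<in> set is \<Longrightarrow> poly_bounded (f i)) \<Longrightarrow> poly_bounded (\<lambda>x. \<Sum>i\<leftarrow>is. f i x)"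
  by (induction "is") (auto intro: poly_bounded_intros)

text \<open>The advice machine unpacks the pair of advice and input, distributes the components to
  the odd stacks and runs the renamed program there. \<open>F\<close> is defined on every string by
  what this yields, whether or not the string is a proper pair, so that it is polynomial-time as a
  total function.\<close>

lemma nonuniform_imp_P_poly:
  assumes "nonuniform A" shows "P_poly A"
proof -
  let ?f = "\<lambda>r::nat. 2 * r + 1"
  have inj: "inj ?f" by (auto simp: inj_def)
  obtain p I X adv T where "computes p I X adv T A"
    using assms unfolding nonuniform_def by blast
  note p = computesD[OF this]
  obtain q where q: "\<And>x. T x \<le> poly q x" using p(2) by (auto simp: poly_bounded_def)
  obtain rs where rs: "set rs = I" "distinct rs" using finite_distinct_list[OF p(1)] by blast
  define D where "D x = distribute X rs (fst (split_enc x)) (fst (split_enc (snd (split_enc x))))" for x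
  have "\<exists>t s. exec p (init I (D x)) t s \<and> t \<le> T (\<Sum>r\<in>I. length (D x r))" for x
    using p(3)[of "D x"] unfolding runs_def by blast
  then obtain t s where ts: "\<And>x. exec p (init I (D x)) (t x) (s x)"
    "\<And>x. t x \<le> T (\<Sum>r\<in>I. length (D x r))" by metis
  define F where "F x = s x 0" for x
  let ?pre = "Seq (decode 0 8 6) (Seq (move 8 2) (Seq (decode 0 8 6) (move 8 4)))"
  let ?post = "Seq (clear 0) (Seq (move 1 8) (move 8 0))"
  let ?p = "Seq ?pre (Seq (distributor X rs) (Seq (rename ?f p) ?post))"
  \<comment> \<open>Each of the \<open>card I\<close> stacks receives at most \<open>L\<close> bits
    from a string of length \<open>L\<close>.\<close>
  let ?B = "\<lambda>L. card I * L"
  let ?S = "\<lambda>L. poly q (?B L)"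
  let ?T = "\<lambda>L. (4 + 100 * Suc L) + ((length rs * (100 * Suc L) + 1) + (?S L + (3 + 2 * L + 16 * (L + ?S L))))"
  have len: "t x \<le> ?S (length x)" "length (F x) \<le> length x + ?S (length x)" for x
  proof -
    have D: "length (D x r) \<le> length x" for r
      unfolding D_def using length_split_enc[of x] length_split_enc[of "snd (split_enc x)"]
      by (intro length_distribute) auto
    have "(\<Sum>r\<in>I. length (D x r)) \<le> ?B (length x)"
      using sum_bounded_above[of I "\<lambda>r. length (D x r)" "length x"] D by simp
    from order.trans[OF ts(2) order.trans[OF q poly_nat_mono[OF this]]] show t: "t x \<le> ?S (length x)" .
    have "length (F x) \<le> length (init I (D x) 0) + t x" unfolding F_def by (rule exec_length[OF ts(1)])
    then show "length (F x) \<le> length x + ?S (length x)" using D[of 0] t by (auto simp: init_def split: if_splits)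
  qed
  have "\<exists>s'. runs ?p ((\<lambda>_. [])(0 := x)) (?T (length x)) s' \<and> s' 0 = F x" for x
  proof -
    define a where "a = fst (split_enc x)"
    define y where "y = snd (split_enc x)"
    define u where "u = fst (split_enc y)"
    define z where "z = snd (split_enc y)"
    have l: "length a + length y \<le> length x" "length u + length z \<le> length y"
      unfolding a_def y_def u_def z_def by (rule length_split_enc)+
    let ?s0 = "(\<lambda>_. [])(0 := x) :: store"
    let ?s1 = "(\<lambda>_. [])(0 := y, 8 := rev a) :: store"
    let ?s2 = "(\<lambda>_. [])(0 := y, 2 := a) :: store"
    let ?s3 = "(\<lambda>_. [])(0 := z, 2 := a, 8 := rev u) :: store"
    let ?s4 = "(\<lambda>_. [])(0 := z, 2 := a, 4 := u) :: store"
    have e1: "?s0(0 := snd (split_enc (?s0 0)), 8 := rev (fst (split_enc (?s0 0))) @ ?s0 8) = ?s1"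
      by (auto simp: a_def y_def)
    have 1: "runs (decode 0 8 6) ?s0 (Suc (30 * Suc (length x))) ?s1"
      using runs_decode[of 0 8 6 ?s0, unfolded e1] by simp
    have e2: "?s1(8 := [], 2 := rev (?s1 8) @ ?s1 2) = ?s2" by (auto simp: fun_eq_iff)
    have 2: "runs (move 8 2) ?s1 (Suc (8 * length a)) ?s2"
      using runs_move[of 8 2 ?s1, unfolded e2] by simp
    have e3: "?s2(0 := snd (split_enc (?s2 0)), 8 := rev (fst (split_enc (?s2 0))) @ ?s2 8) = ?s3"
      by (auto simp: u_def z_def fun_eq_iff)
    have 3: "runs (decode 0 8 6) ?s2 (Suc (30 * Suc (length y))) ?s3"
      using runs_decode[of 0 8 6 ?s2, unfolded e3] by simp
    have e4: "?s3(8 := [], 4 := rev (?s3 8) @ ?s3 4) = ?s4" by (auto simp: fun_eq_iff)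
    have 4: "runs (move 8 4) ?s3 (Suc (8 * length u)) ?s4"
      using runs_move[of 8 4 ?s3, unfolded e4] by simp
    have p0: "runs ?pre ?s0 (4 + 100 * Suc (length x)) ?s4"
      by (rule runs_mono[OF runs_Seq[OF 1 runs_Seq[OF 2 runs_Seq[OF 3 4]]]]) (use l in auto)
    have Dx: "D x = distribute X rs a u" by (simp add: D_def a_def u_def y_def)
    have odd: "2 * r + 1 \<noteq> (0::nat)" "2 * r + 1 \<noteq> (2::nat)" "2 * r + 1 \<noteq> (4::nat)" for r by presburger+
    have s4: "?s4 (2 * r + 1) = []" "?s4 2 = a" "?s4 4 = u" "?s4 6 = []" "?s4 8 = []" "?s4 0 = z" for r
      using odd[of r] by auto
    have "\<exists>s'. runs (distributor X rs) ?s4 (length rs * (100 * Suc (length x)) + 1) s' \<and>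
        (\<forall>r. s' (2 * r + 1) = (if r \<in> set rs then distribute X rs (?s4 2) (?s4 4) r else ?s4 (2 * r + 1))) \<and> s' 8 = [] \<and> s' 0 = ?s4 0"
      by (rule runs_distributor) (use rs s4 l in auto)
    then obtain s5 where 5: "runs (distributor X rs) ?s4 (length rs * (100 * Suc (length x)) + 1) s5"
      "\<And>r. s5 (2 * r + 1) = (if r \<in> I then D x r else [])" "s5 8 = []" "s5 0 = z"
      unfolding s4 rs(1) Dx by blast
    define s6 where "s6 = embed ?f (s x) s5"
    have "(\<lambda>r. s5 (?f r)) = init I (D x)" using 5(2) by (simp add: init_def)
    then have "exec (rename ?f p) s5 (t x) s6"
      using exec_rename[OF ts(1)[of x] inj, of s5] embed_self[OF inj, of s5] by (simp add: s6_def)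
    then have 6: "runs (rename ?f p) s5 (?S (length x)) s6" using len(1) unfolding runs_def by blast
    have "2 * r \<notin> range ?f" for r by (auto simp: image_def) presburger
    from embed_other[OF this[of 4]] embed_other[OF this[of 0]]
    have s6: "s6 1 = F x" "s6 8 = []" "s6 0 = z"
      using embed_apply[OF inj, of "s x" s5 0] 5(3,4) by (simp_all add: s6_def F_def)
    have 7: "runs (clear 0) s6 (Suc (2 * length z)) (s6(0 := []))"
      using runs_clear[of 0 s6] s6(3) by simp
    have 8: "runs (move 1 8) (s6(0 := [])) (Suc (8 * length (F x))) (s6(0 := [], 1 := [], 8 := rev (F x)))"
      using runs_move[of 1 8 "s6(0 := [])"] s6 by simp
    have 9: "runs (move 8 0) (s6(0 := [], 1 := [], 8 := rev (F x))) (Suc (8 * length (F x)))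
        (s6(0 := [], 1 := [], 8 := rev (F x), 8 := [], 0 := F x))"
      using runs_move[of 8 0 "s6(0 := [], 1 := [], 8 := rev (F x))"] by simp
    have "runs ?post s6 (3 + 2 * length x + 16 * (length x + ?S (length x)))
        (s6(0 := [], 1 := [], 8 := rev (F x), 8 := [], 0 := F x))"
      by (rule runs_mono[OF runs_Seq[OF 7 runs_Seq[OF 8 9]]]) (use l len(2)[of x] in simp)
    note r = runs_Seq[OF p0 runs_Seq[OF 5(1) runs_Seq[OF 6 this]]]
    show ?thesis by (rule exI, rule conjI, rule r) simp
  qed
  note F = this
  have "poly_bounded ?T" by (intro poly_bounded_intros)
  then obtain Q where "\<And>L. ?T L \<le> poly Q L" unfolding poly_bounded_def by blast
  then have "\<exists>t s'. exec ?p ((\<lambda>_. [])(0 := x)) t s' \<and> s' 0 = F x \<and> t \<le> poly Q (length x)" for x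
    using F[of x] unfolding runs_def by (meson le_trans)
  then have "polytime F" unfolding polytime_def by blast
  moreover define c where "c l = tuple (map (adv l) (filter (\<lambda>r. r \<notin> X) rs))" for l
  have "poly_bounded (\<lambda>l. \<Sum>r\<leftarrow>filter (\<lambda>r. r \<notin> X) rs. Suc (2 * length (adv l r)))"
    by (intro poly_bounded_sum_list poly_bounded_intros p(4)) (use rs(1) in auto)
  then have "poly_bounded (\<lambda>l. length (c l))"
    unfolding c_def length_tuple map_map comp_def .
  then obtain Q' where "\<And>l. length (c l) \<le> poly Q' l" unfolding poly_bounded_def by blast
  moreover have "F (tuple [c (length u), u]) = [A u]" for u
  proof -
    let ?x = "tuple [c (length u), u]"
    have "split_enc ?x = (c (length u), enc u)" "split_enc (enc u) = (u, [])"
      using split_enc_enc[of "c (length u)" "enc u"] split_enc_enc[of u "[]"] by simp_all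
    then have "D ?x = distribute X rs (c (length u)) u" by (simp only: D_def fst_conv snd_conv)
    then have "init I (D ?x) = init I (\<lambda>r. if r \<in> X then u else adv (length u) r)"
      using distribute_tuple[OF rs(2)] rs(1) by (auto simp: init_def c_def fun_eq_iff)
    moreover obtain t1 s1 where "exec p (init I (\<lambda>r. if r \<in> X then u else adv (length u) r)) t1 s1" "s1 0 = [A u]"
      using p(5)[of u] by blast
    ultimately show ?thesis using ts(1)[of ?x] exec_determ unfolding F_def by metis
  qed
  ultimately show ?thesis unfolding P_poly_def by blast
qed

section \<open>Hardness of the bit conditioned on nonuniform tests\<close>

lemma polytime_id: "polytime (\<lambda>x. x)"
  unfolding polytime_def
proof (intro exI allI conjI)
  fix x
  show "exec Skip ((\<lambda>_. [])(0 := x)) 1 ((\<lambda>_. [])(0 := x))" by (rule exec.intros)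
  show "1 \<le> poly [:1:] (length x)" by simp
qed simp

text \<open>The truth value is stored in the advice: without clauses the emitted string is empty,
  and the expected string is chosen empty exactly if \<open>P\<close> holds. \<open>P\<close> may be
  any property.\<close>

lemma nonuniform_length: "nonuniform (\<lambda>u. P (length u))"
proof -
  have "nonuniform (\<lambda>u. (\<lambda>x. x) (emit [] u) = (if P (length u) then [] else [True]))"
    by (rule nonuniform_test[where cls = "\<lambda>_. []" and e = "\<lambda>l. if P l then [] else [True]"])
      (auto simp: polytime_id cls_size_def poly_bounded_const
        intro: poly_bounded_mono[OF poly_bounded_const[of 1]])
  moreover have "(\<lambda>x. x) (emit [] u) = (if P (length u) then [] else [True]) \<longleftrightarrow> P (length u)" for u
    by (simp add: emit_def)
  ultimately show ?thesis by (simp only:)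
qed

lemma nonuniform_tests:
  assumes "\<And>G. G \<in> set Gs \<Longrightarrow> polytime G" "poly_bounded q"
    and "\<And>l j. j < length Gs \<Longrightarrow> cls_size (clss l j) \<le> q l \<and> (\<forall>cl\<in>set (clss l j). length (fst cl) = l) \<and>
      length (es l j) \<le> q l"
  shows "nonuniform (\<lambda>u. \<forall>j<length Gs. (Gs ! j) (emit (clss (length u) j) u) = es (length u) j)"
proof -
  have "nonuniform (\<lambda>u. \<forall>j<k. (Gs ! j) (emit (clss (length u) j) u) = es (length u) j)"
    if "k \<le> length Gs" for k using that
  proof (induction k)
    case 0
    show ?case using nonuniform_length[of "\<lambda>_. True"] by simp
  next
    case (Suc k)
    have "nonuniform (\<lambda>u. (Gs ! k) (emit (clss (length u) k) u) = es (length u) k)"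
    proof (rule nonuniform_test[where cls = "\<lambda>l. clss l k" and e = "\<lambda>l. es l k"])
      show "\<forall>cl\<in>set (clss l k). length (fst cl) = l" for l
        using assms(3)[of k] Suc.prems by simp
    qed (use Suc.prems assms in \<open>auto intro: poly_bounded_mono[OF assms(2)]\<close>)
    from nonuniform_combine[OF this Suc.IH, of "(\<and>)"] Suc.prems show ?case
      by (simp add: All_less_Suc)
  qed
  then show ?thesis by simp
qed

lemma card_cube: "finite (cube l)" "card (cube l) = 2 ^ l"
proof -
  have "cube l = {xs. set xs \<subseteq> UNIV \<and> length xs = l}" by (auto simp: cube_def)
  then show "finite (cube l)" "card (cube l) = 2 ^ l"
    using finite_lists_length_eq[of "UNIV :: bool set" l] card_lists_length_eq[of "UNIV :: bool set" l]
    by simp_all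
qed

definition valid_tests :: "(nat \<Rightarrow> nat) \<Rightarrow> nat \<Rightarrow> nat \<Rightarrow> (nat \<Rightarrow> clause list) \<Rightarrow> (nat \<Rightarrow> bool list) \<Rightarrow> bool" where
  "valid_tests q l k clss es \<longleftrightarrow> (\<forall>j<k. cls_size (clss j) \<le> q l \<and>
     (\<forall>cl\<in>set (clss j). length (fst cl) = l) \<and> length (es j) \<le> q l)"

definition passing :: "(bool list \<Rightarrow> bool list) list \<Rightarrow> nat \<Rightarrow> (nat \<Rightarrow> clause list) \<Rightarrow> (nat \<Rightarrow> bool list) \<Rightarrow> bool list set" where
  "passing Gs l clss es = {u \<in> cube l. \<forall>j<length Gs. (Gs ! j) (emit (clss j) u) = es j}"

definition hard_for ::
  "(bool list \<Rightarrow> bool list) \<Rightarrow> (bool list \<Rightarrow> bool) \<Rightarrow> (nat \<Rightarrow> nat) \<Rightarrow> nat \<Rightarrow>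
   (bool list \<Rightarrow> bool list) list \<Rightarrow> nat \<Rightarrow> bool" where
  "hard_for h B q k Gs l \<longleftrightarrow> (\<forall>clss es d. valid_tests q l (length Gs) clss es \<longrightarrow>
    real (card {u \<in> passing Gs l clss es. B (preimage h u) \<noteq> d}) \<le>
      real (card (passing Gs l clss es)) / 2 + 2 ^ l / real l ^ k)"

text \<open>
  If the inequality failed for infinitely many \<open>l\<close>, the test data of these \<open>l\<close> would serve as
  advice for a predictor: answer the complement of \<open>d\<close> if the tests are passed and a constant
  \<open>b\<close> otherwise. The two choices of \<open>b\<close> balance each other outside of the tested set.
\<close>

lemma hardness_tests:
  assumes hb: "hard_bit_permutation h B" and Gs: "\<And>G. G \<in> set Gs \<Longrightarrow> polytime G"
    and q: "poly_bounded q" and k: "k \<ge> 1"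
  shows "\<forall>\<^sub>F l in sequentially. hard_for h B q k Gs l"
proof -
  define bad where "bad l D = (case D of (clss, es, d) \<Rightarrow> valid_tests q l (length Gs) clss es \<and>
    \<not> real (card {u \<in> passing Gs l clss es. B (preimage h u) \<noteq> d}) \<le>
      real (card (passing Gs l clss es)) / 2 + 2 ^ l / real l ^ k)" for l D
  \<comment> \<open>At lengths without counterexample the default is empty clause lists and strings,
    which satisfy every size bound; the advice is thus valid at all lengths.\<close>
  define dat where "dat l = (if \<exists>D. bad l D then SOME D. bad l D else (\<lambda>_. [], \<lambda>_. [], True))" for l
  define clss es d where "clss l = fst (dat l)" "es l = fst (snd (dat l))" "d l = snd (snd (dat l))" for l
  have bad: "bad l (clss l, es l, d l)" if "bad l D" for l D
  proof -
    have "dat l = (SOME D. bad l D)" by (simp only: dat_def if_P[OF exI[of "bad l", OF that]])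
    then show ?thesis using someI[of "bad l", OF that] by (simp add: clss_es_d_def)
  qed
  have valid: "valid_tests q l (length Gs) (clss l) (es l)" for l
  proof (cases "\<exists>D. bad l D")
    case True
    then show ?thesis using bad by (auto simp: bad_def)
  next
    case False
    then show ?thesis by (simp add: clss_es_d_def dat_def valid_tests_def cls_size_def)
  qed
  let ?A = "\<lambda>u. \<forall>j<length Gs. (Gs ! j) (emit (clss (length u) j) u) = es (length u) j"
  have A: "nonuniform ?A"
    by (rule nonuniform_tests[OF Gs q]) (use valid in \<open>auto simp: valid_tests_def\<close>)
  have P: "P_poly (\<lambda>u. if ?A u then \<not> d (length u) else b)" for b
    using nonuniform_imp_P_poly[OF nonuniform_combine[OF A nonuniform_length[of d], of "\<lambda>x y. if x then \<not> y else b"]] .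
  have ev: "\<forall>\<^sub>F l in sequentially. real (card {u \<in> cube l. (if ?A u then \<not> d (length u) else b) = B (preimage h u)}) / 2 ^ l
      \<le> 1 / 2 + 1 / real l ^ k" for b
    using hb k P unfolding hard_bit_permutation_def by blast
  show ?thesis
    using eventually_conj[OF ev[of True] ev[of False]]
  proof (rule eventually_mono)
    fix l
    assume *: "real (card {u \<in> cube l. (if ?A u then \<not> d (length u) else True) = B (preimage h u)}) / 2 ^ l
        \<le> 1 / 2 + 1 / real l ^ k \<and>
      real (card {u \<in> cube l. (if ?A u then \<not> d (length u) else False) = B (preimage h u)}) / 2 ^ l
        \<le> 1 / 2 + 1 / real l ^ k"
    let ?P = "passing Gs l (clss l) (es l)"
    let ?W = "{u \<in> ?P. B (preimage h u) \<noteq> d l}"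
    let ?V = "\<lambda>b. {u \<in> cube l - ?P. B (preimage h u) = b}"
    have fin: "finite (cube l)" "?P \<subseteq> cube l" by (auto simp: card_cube passing_def)
    then have finP: "finite ?P" by (rule finite_subset[rotated])
    have eq: "{u \<in> cube l. (if ?A u then \<not> d (length u) else b) = B (preimage h u)} = ?W \<union> ?V b" for b
      by (auto simp: passing_def cube_def)
    have c: "card (?W \<union> ?V b) = card ?W + card (?V b)" for b
      using fin finP by (intro card_Un_disjoint) auto
    have "cube l - ?P = ?V True \<union> ?V False" by auto
    then have "card (cube l - ?P) = card (?V True \<union> ?V False)" by (rule arg_cong)
    also have "\<dots> = card (?V True) + card (?V False)"
      using fin by (intro card_Un_disjoint) auto
    finally have "card (cube l - ?P) = card (?V True) + card (?V False)" .
    then have sum: "real (card (?V True)) + real (card (?V False)) = 2 ^ l - real (card ?P)"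
    proof -
      have "card (cube l - ?P) + card ?P = 2 ^ l"
        using fin finP card_mono[OF fin] by (simp add: card_Diff_subset card_cube)
      then have "real (card (cube l - ?P) + card ?P) = 2 ^ l" by simp
      then show ?thesis using \<open>card (cube l - ?P) = card (?V True) + card (?V False)\<close> by simp
    qed
    have "real (card ?W) + real (card (?V b)) \<le> (1 / 2 + 1 / real l ^ k) * 2 ^ l" for b
      using * unfolding eq c by (cases b) (simp_all add: divide_le_eq)
    \<comment> \<open>In the sum of the two bounds, the tested inputs that are predicted correctly
      count twice and the inputs outside of the tested set count once.\<close>
    from this[of True] this[of False] sum
    have "2 * real (card ?W) + 2 ^ l - real (card ?P) \<le> 2 * ((1 / 2 + 1 / real l ^ k) * 2 ^ l)"
      by linarith
    then have "real (card ?W) \<le> real (card ?P) / 2 + 2 ^ l / real l ^ k"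
      by (simp add: algebra_simps)
    then have "\<not> bad l D" for D using bad[of l D] by (auto simp: bad_def)
    then show "hard_for h B q k Gs l"
      unfolding bad_def hard_for_def by fastforce
  qed
qed

section \<open>Embedding an input into a sample\<close>

fun mix :: "nat set \<Rightarrow> bool list \<Rightarrow> bool list \<Rightarrow> bool list" where
  "mix A [] u = []"
| "mix A (x # xs) u = (if 0 \<in> A then hd u # mix {j. Suc j \<in> A} xs (tl u) else x # mix {j. Suc j \<in> A} xs u)"

lemma length_mix [simp]: "length (mix A x u) = length x"
  by (induction A x u rule: mix.induct) auto

lemma nths_mix: "length u = length (nths x A) \<Longrightarrow> nths (mix A x u) A = u"
proof (induction A x u rule: mix.induct)
  case (2 A x xs u)
  then show ?case by (cases u) (auto simp: nths_Cons)
qed simp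

lemma mix_mix: "length u = length (nths x A) \<Longrightarrow> mix A (mix A x u) (nths x A) = x"
proof (induction A x u rule: mix.induct)
  case (2 A x xs u)
  then show ?case by (cases u) (auto simp: nths_Cons)
qed simp

text \<open>For \<open>j\<close> in \<open>A\<close>, the index in \<open>u\<close> of the bit that
  \<open>mix A x u\<close> has at position \<open>j\<close>.\<close>

definition rank :: "nat set \<Rightarrow> nat \<Rightarrow> nat" where
  "rank A j = card (A \<inter> {..<j})"

lemma rank_0 [simp]: "rank A 0 = 0"
  by (simp add: rank_def)

lemma rank_Suc: "rank A (Suc j) = (if 0 \<in> A then Suc (rank {i. Suc i \<in> A} j) else rank {i. Suc i \<in> A} j)"
proof -
  have "A \<inter> {..<Suc j} = (if 0 \<in> A then {0} else {}) \<union> Suc ` ({i. Suc i \<in> A} \<inter> {..<j})"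
  proof (intro set_eqI iffI)
    fix i assume "i \<in> A \<inter> {..<Suc j}"
    then show "i \<in> (if 0 \<in> A then {0} else {}) \<union> Suc ` ({i. Suc i \<in> A} \<inter> {..<j})"
      by (cases i) auto
  qed (auto split: if_splits)
  then show ?thesis unfolding rank_def by (auto simp: card_image card_insert_if)
qed

lemma nth_mix:
  "j < length x \<Longrightarrow> length u = length (nths x A) \<Longrightarrow>
    mix A x u ! j = (if j \<in> A then u ! rank A j else x ! j) \<and> (j \<in> A \<longrightarrow> rank A j < length u)"
proof (induction A x u arbitrary: j rule: mix.induct)
  case (2 A x xs u)
  show ?case
  proof (cases j)
    case 0
    then show ?thesis using 2 by (cases u) (auto simp: nths_Cons)
  next
    case (Suc i)
    show ?thesis
    proof (cases "0 \<in> A")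
      case True
      then obtain c u' where u: "u = c # u'" using 2(4) by (cases u) (auto simp: nths_Cons)
      show ?thesis using 2(1)[OF True, of i] 2(3,4) Suc u True by (auto simp: nths_Cons rank_Suc)
    next
      case False
      show ?thesis using 2(2)[OF False, of i] 2(3,4) Suc False by (auto simp: nths_Cons rank_Suc)
    qed
  qed
qed simp

lemma nths_cong:
  "length x = length y \<Longrightarrow> (\<And>j. j \<in> A \<Longrightarrow> j < length x \<Longrightarrow> x ! j = y ! j) \<Longrightarrow> nths x A = nths y A"
proof (induction x y arbitrary: A rule: list_induct2)
  case (Cons a x b y)
  have "nths x {j. Suc j \<in> A} = nths y {j. Suc j \<in> A}"
    by (rule Cons.IH) (use Cons.prems[of "Suc _"] in auto)
  then show ?case using Cons.prems[of 0] by (auto simp: nths_Cons)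
qed simp

lemma length_nths_subset:
  assumes "A \<subseteq> {..<length x}" shows "length (nths x A) = card A"
proof -
  have "{i. i < length x \<and> i \<in> A} = A" using assms by auto
  then show ?thesis by (simp add: length_nths)
qed

text \<open>Exchanging \<open>u\<close> with the bits of \<open>x\<close> on \<open>A\<close> is an involution.\<close>

lemma sum_mix:
  assumes "A \<subseteq> {..<n}" "card A = l"
  shows "(\<Sum>x\<in>cube n. card {u \<in> cube l. P (mix A x u)}) = 2 ^ l * card {x \<in> cube n. P x}"
proof -
  have len: "length (nths x A) = l" if "x \<in> cube n" for x
    using length_nths_subset[of A x] that assms by (simp add: cube_def)
  have "(\<Sum>x\<in>cube n. card {u \<in> cube l. P (mix A x u)}) = (\<Sum>x\<in>cube n. \<Sum>u\<in>cube l. of_bool (P (mix A x u)))"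
    by (simp add: card_cube sum_of_bool_eq Int_def)
  also have "\<dots> = (\<Sum>(x, u)\<in>cube n \<times> cube l. of_bool (P (mix A x u)))"
    by (rule sum.cartesian_product)
  also have "\<dots> = (\<Sum>(x, u)\<in>cube n \<times> cube l. of_bool (P x))"
    by (rule sum.reindex_bij_witness[where i = "\<lambda>(x, u). (mix A x u, nths x A)" and j = "\<lambda>(x, u). (mix A x u, nths x A)"])
      (use len in \<open>auto simp: mix_mix nths_mix cube_def\<close>)
  also have "\<dots> = (\<Sum>x\<in>cube n. \<Sum>u\<in>cube l. of_bool (P x))"
    by (rule sum.cartesian_product[symmetric])
  also have "\<dots> = 2 ^ l * card {x \<in> cube n. P x}"
    by (simp add: card_cube sum_of_bool_eq Int_def flip: sum_distrib_left)
  finally show ?thesis .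
qed

section \<open>Functions computed by clauses\<close>

text \<open>One length and an explicit size: the polynomial bound common to all instances is formed
  only at the end, in \<open>input_bound\<close>.\<close>

definition emits :: "nat \<Rightarrow> (bool list \<Rightarrow> bool list) \<Rightarrow> nat \<Rightarrow> bool" where
  "emits l \<phi> s \<longleftrightarrow> (\<exists>cls. (\<forall>cl\<in>set cls. length (fst cl) = l) \<and> cls_size cls \<le> s \<and>
     (\<forall>u\<in>cube l. emit cls u = \<phi> u))"

lemma emits_mono: "emits l \<phi> s \<Longrightarrow> s \<le> s' \<Longrightarrow> emits l \<phi> s'"
  unfolding emits_def using le_trans by blast

lemma emits_append:
  assumes "emits l \<phi> s" "emits l \<psi> s'" shows "emits l (\<lambda>u. \<phi> u @ \<psi> u) (s + s')"
proof -
  obtain c c' where "\<forall>cl\<in>set c. length (fst cl) = l" "cls_size c \<le> s" "\<forall>u\<in>cube l. emit c u = \<phi> u"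
    "\<forall>cl\<in>set c'. length (fst cl) = l" "cls_size c' \<le> s'" "\<forall>u\<in>cube l. emit c' u = \<psi> u"
    using assms unfolding emits_def by metis
  then show ?thesis unfolding emits_def
    by (intro exI[of _ "c @ c'"]) (auto simp: cls_size_def emit_def)
qed

lemma emits_concat:
  assumes "\<And>j. j \<in> set is \<Longrightarrow> emits l (\<phi> j) s"
  shows "emits l (\<lambda>u. concat (map (\<lambda>j. \<phi> j u) is)) (length is * s)"
  using assms
proof (induction "is")
  case Nil
  show ?case unfolding emits_def by (intro exI[of _ "[]"]) (auto simp: cls_size_def emit_def)
next
  case (Cons j "is")
  then show ?case using emits_append[of l "\<phi> j" s] by simp
qed

lemma concat_if_eq: "distinct xs \<Longrightarrow> a \<in> set xs \<Longrightarrow> concat (map (\<lambda>x. if x = a then g x else []) xs) = g a"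
proof (induction xs)
  case (Cons x xs)
  have "concat (map (\<lambda>x. if x = a then g x else []) xs) = []" if "a \<notin> set xs"
    using that by (induction xs) auto
  then show ?case using Cons by auto
qed simp

text \<open>One clause per assignment to the positions in \<open>T\<close>.\<close>

lemma emits_local:
  assumes T: "T \<subseteq> {..<l}" and loc: "\<And>u u'. u \<in> cube l \<Longrightarrow> u' \<in> cube l \<Longrightarrow> (\<And>i. i \<in> T \<Longrightarrow> u ! i = u' ! i) \<Longrightarrow> \<phi> u = \<phi> u'"
    and len: "\<And>u. u \<in> cube l \<Longrightarrow> length (\<phi> u) \<le> s"
  shows "emits l \<phi> (2 ^ card T * Suc (l + s))"
proof -
  have fin: "finite T" using T finite_subset by blast
  then obtain Ss where Ss: "set Ss = Pow T" "distinct Ss" using finite_distinct_list[of "Pow T"] by auto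
  have card: "length Ss = 2 ^ card T" using distinct_card[OF Ss(2)] Ss(1) fin by (simp add: card_Pow)
  \<comment> \<open>An assignment to \<open>T\<close> is given by the set \<open>S\<close> of its
    true positions. \<open>w S\<close> is a representative input, false outside of \<open>S\<close>,
    and \<open>p S\<close> the pattern fixing exactly the positions in \<open>T\<close>.\<close>
  define w where "w S = map (\<lambda>i. i \<in> S) [0..<l]" for S :: "nat set"
  define p where "p S = map (\<lambda>i. if i \<in> T then Some (i \<in> S) else None) [0..<l]" for S :: "nat set"
  define cls where "cls = map (\<lambda>S. (p S, \<phi> (w S))) Ss"
  have w: "w S \<in> cube l" for S by (simp add: w_def cube_def)
  have lp: "length (p S) = l" for S by (simp add: p_def)
  have "(\<Sum>S\<leftarrow>xs. Suc (length (p S) + length (\<phi> (w S)))) \<le> length xs * Suc (l + s)" for xs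
  proof (induction xs)
    case (Cons S xs)
    then show ?case using len[OF w[of S]] lp[of S] by simp
  qed simp
  from this[of Ss] have "cls_size cls \<le> length Ss * Suc (l + s)"
    by (simp add: cls_def cls_size_def comp_def)
  moreover have "emit cls u = \<phi> u" if u: "u \<in> cube l" for u
  proof -
    define S where "S = {i \<in> T. u ! i}"
    have "matches (p S') u \<longleftrightarrow> S' = S" if "S' \<in> Pow T" for S'
    proof -
      have "matches (p S') u \<longleftrightarrow> (\<forall>i<l. i \<in> T \<longrightarrow> (i \<in> S') = u ! i)"
        using u by (auto simp: matches_def p_def list_all2_conv_all_nth cube_def)
      also have "\<dots> \<longleftrightarrow> S' = S" using T that by (auto simp: S_def)
      finally show ?thesis .
    qed
    then have "emit cls u = concat (map (\<lambda>S'. if S' = S then \<phi> (w S') else []) Ss)"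
      unfolding emit_def cls_def map_map comp_def using Ss(1)
      by (intro arg_cong[of _ _ concat] map_cong) auto
    also have "\<dots> = \<phi> (w S)" using Ss by (intro concat_if_eq) (auto simp: S_def)
    also have "\<dots> = \<phi> u"
      using T by (intro loc[OF w u]) (auto simp: w_def S_def)
    finally show ?thesis .
  qed
  moreover have "\<forall>cl\<in>set cls. length (fst cl) = l" by (auto simp: cls_def p_def)
  ultimately show ?thesis unfolding emits_def card by blast
qed

lemma emits_const: "emits l (\<lambda>_. x) (Suc (l + length x))"
  using emits_local[of "{}" l "\<lambda>_. x" "length x"] by simp

definition ans :: "(bool list \<Rightarrow> bool list) \<Rightarrow> bool list \<Rightarrow> nat \<Rightarrow> bool list \<Rightarrow> bool list" where
  "ans h J i \<omega> = preimage h (nths \<omega> (row (length \<omega>) J i))"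

lemma enc_concat: "enc x = concat (map (\<lambda>j. [True, x ! j]) [0..<length x]) @ [False]"
proof -
  have "map (\<lambda>j. [True, x ! j]) [0..<length x] = map (\<lambda>c. [True, c]) (map ((!) x) [0..<length x])" by simp
  then show ?thesis by (simp only: enc_def map_nth)
qed

lemma length_preimage:
  assumes "\<And>l. bij_betw h (cube l) (cube l)" shows "length (preimage h u) = length u"
proof -
  have "preimage h u \<in> cube (length u)"
    unfolding preimage_def using assms[of "length u"]
    by (intro inv_into_into) (simp add: bij_betw_def cube_def)
  then show ?thesis by (simp add: cube_def)
qed

text \<open>Each bit of the sample depends on at most one bit of \<open>u\<close>, so two clauses
  per position suffice; the last summand pays for the terminating bit of the encoding.\<close>

lemma emits_mix:
  assumes x: "x \<in> cube n" and A: "A \<subseteq> {..<n}" "card A = l"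
  shows "emits l (\<lambda>u. enc (mix A x u)) (n * (2 * (l + 3)) + (l + 2))"
proof -
  have len: "length x = n" using x by (simp add: cube_def)
  then have lA: "length (nths x A) = l"
    using length_nths_subset[of A x] A by simp
  have "emits l (\<lambda>u. [True, mix A x u ! j]) (2 * (l + 3))" if j: "j < n" for j
  proof -
    have nth: "mix A x u ! j = (if j \<in> A then u ! rank A j else x ! j)" "j \<in> A \<Longrightarrow> rank A j < l" if "u \<in> cube l" for u
      using nth_mix[of j x u A] that j len lA by (auto simp: cube_def)
    have "replicate l True \<in> cube l" by (simp add: cube_def)
    note r = nth(2)[OF this]
    show ?thesis
    proof (rule emits_mono[OF emits_local])
      show "(if j \<in> A then {rank A j} else {}) \<subseteq> {..<l}" using r by auto
    qed (auto simp: nth split: if_splits)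
  qed
  then have "emits l (\<lambda>u. concat (map (\<lambda>j. [True, mix A x u ! j]) [0..<n])) (length [0..<n] * (2 * (l + 3)))"
    by (intro emits_concat) auto
  from emits_append[OF this emits_const[of l "[False]"]] show ?thesis
    by (simp add: enc_concat len)
qed

lemma nths_mix_cong:
  assumes x: "length x = n" "length (nths x A) = l" and u: "u \<in> cube l" "u' \<in> cube l"
    and eq: "\<And>i. i \<in> rank A ` (A \<inter> C) \<Longrightarrow> u ! i = u' ! i" and "C \<subseteq> {..<n}"
  shows "nths (mix A x u) C = nths (mix A x u') C"
proof (rule nths_cong)
  fix j assume "j \<in> C" "j < length (mix A x u)"
  then show "mix A x u ! j = mix A x u' ! j"
    using nth_mix[of j x u A] nth_mix[of j x u' A] x u eq by (auto simp: cube_def)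
qed simp

text \<open>A row other than \<open>A\<close> meets \<open>A\<close> in at most \<open>log m\<close> positions, so the answer on it depends on
  that few bits of \<open>u\<close>.\<close>

lemma emits_ans:
  assumes h: "\<And>l. bij_betw h (cube l) (cube l)" and ss: "set_system n m l J" and x: "x \<in> cube n"
    and ij: "i < m" "j < m" "i \<noteq> j" and g: "\<And>v. length v = l \<Longrightarrow> length (g v) \<le> s"
  shows "emits l (\<lambda>u. g (ans h J j (mix (row n J i) x u))) (m * Suc (l + s))"
proof -
  let ?A = "row n J i" and ?C = "row n J j"
  let ?T = "rank ?A ` (?A \<inter> ?C)"
  have len: "length x = n" using x by (simp add: cube_def)
  have sub: "row n J k \<subseteq> {..<n}" for k by (auto simp: row_def)
  have card: "card (row n J k) = l" if "k < m" for k using ss that by (simp add: set_system_def)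
  have lk: "length (nths y (row n J k)) = l" if "length y = n" "k < m" for y k
    using length_nths_subset[of "row n J k" y] sub[of k] card[OF that(2)] that(1) by simp
  have lans: "length (ans h J j (mix ?A x u)) = l" for u
    unfolding ans_def length_preimage[OF h] length_mix len by (rule lk) (use len ij in simp_all)
  have fin: "finite (?A \<inter> ?C)" using sub finite_subset[OF _ finite_lessThan] by blast
  have "card ?T \<le> card (?A \<inter> ?C)" by (rule card_image_le[OF fin])
  then have "real (card ?T) \<le> log 2 (real m)" using ss ij unfolding set_system_def by force
  then have "2 powr real (card ?T) \<le> real m" using ij by (simp add: le_log_iff)
  then have "real (2 ^ card ?T) \<le> real m" by (simp add: powr_realpow)
  then have T: "2 ^ card ?T \<le> m" by linarith
  show ?thesis
  proof (rule emits_mono[OF emits_local[where T = ?T and s = s]])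
    have "rank ?A k < l" if "k \<in> ?A" for k
      using nth_mix[of k x "replicate l True" ?A] that len lk[OF len ij(1)] sub by auto
    then show "?T \<subseteq> {..<l}" by auto
    show "g (ans h J j (mix ?A x u)) = g (ans h J j (mix ?A x u'))"
      if "u \<in> cube l" "u' \<in> cube l" "\<And>i. i \<in> ?T \<Longrightarrow> u ! i = u' ! i" for u u'
      using nths_mix_cong[OF len lk[OF len ij(1)] that sub] len by (simp add: ans_def)
    show "length (g (ans h J j (mix ?A x u))) \<le> s" for u using lans by (rule g)
    show "2 ^ card ?T * Suc (l + s) \<le> m * Suc (l + s)" using T by (rule mult_le_mono1)
  qed
qed

section \<open>Hardness of the bit conditioned on a trace\<close>

text \<open>
  A trace of a Student records its moves, obtained from the answers to earlier queries, and the
  queries whose answers were consistent with \<open>b\<close>.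
\<close>

datatype event = Move "bool list \<Rightarrow> bool list" "nat list" "bool list" | Consistent nat

primrec queries :: "event \<Rightarrow> nat set" where
  "queries (Move G is e) = set is"
| "queries (Consistent i) = {i}"

text \<open>Both kinds of events get the same shape: a polynomial-time function, applied to a string
  that clauses can emit, must give a prescribed string. For \<open>Consistent\<close> the comparison
  with \<open>b ! i\<close> is done by the clauses, and the function is the identity.\<close>

primrec tester :: "event \<Rightarrow> bool list \<Rightarrow> bool list" where
  "tester (Move G is e) = G"
| "tester (Consistent i) = (\<lambda>x. x)"

primrec expected :: "event \<Rightarrow> bool list" where
  "expected (Move G is e) = e"
| "expected (Consistent i) = [True]"

primrec tester_input ::
  "(bool list \<Rightarrow> bool list) \<Rightarrow> (bool list \<Rightarrow> bool) \<Rightarrow> bool list \<Rightarrow> bool list \<Rightarrow> bool list \<Rightarrow>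
   event \<Rightarrow> bool list \<Rightarrow> bool list" where
  "tester_input h B J b w (Move G is e) \<omega> = tuple (J # b # w # \<omega> # map (\<lambda>i. ans h J i \<omega>) is)"
| "tester_input h B J b w (Consistent i) \<omega> = [B (ans h J i \<omega>) = b ! i]"

definition occurs ::
  "(bool list \<Rightarrow> bool list) \<Rightarrow> (bool list \<Rightarrow> bool) \<Rightarrow> bool list \<Rightarrow> bool list \<Rightarrow> bool list \<Rightarrow>
   event \<Rightarrow> bool list \<Rightarrow> bool" where
  "occurs h B J b w \<tau> \<omega> \<longleftrightarrow> tester \<tau> (tester_input h B J b w \<tau> \<omega>) = expected \<tau>"

definition samples ::
  "(bool list \<Rightarrow> bool list) \<Rightarrow> (bool list \<Rightarrow> bool) \<Rightarrow> nat \<Rightarrow> bool list \<Rightarrow> bool list \<Rightarrow> bool list \<Rightarrow>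
   event list \<Rightarrow> bool list set" where
  "samples h B n J b w \<tau>s = {\<omega> \<in> cube n. \<forall>\<tau>\<in>set \<tau>s. occurs h B J b w \<tau> \<omega>}"

text \<open>The bound \<open>m\<close> on \<open>e\<close> is generous: an expected move is empty or
  \<open>True # str i\<close> with \<open>i < m\<close>, and \<open>str i\<close> has length at most
  \<open>i\<close>.\<close>

definition event_ok :: "(bool list \<Rightarrow> bool list) set \<Rightarrow> nat \<Rightarrow> nat \<Rightarrow> event \<Rightarrow> bool" where
  "event_ok Gs a m \<tau> \<longleftrightarrow> queries \<tau> \<subseteq> {..<m} \<and>
     (case \<tau> of Move G is e \<Rightarrow> G \<in> Gs \<and> length is \<le> a \<and> length e \<le> m | Consistent i \<Rightarrow> True)"

text \<open>Here \<open>(l + 1) ^ 3\<close> replaces \<open>n\<close>, as \<open>l\<close> is the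
  cube root of \<open>n\<close> rounded down. The summands account for the fixed part
  \<open>J\<close>, \<open>b\<close>, \<open>w\<close>, for the sample, for \<open>a\<close>
  tabulated answers, for the expected string and for a consistency event.\<close>

definition input_bound :: "nat poly \<Rightarrow> nat \<Rightarrow> nat \<Rightarrow> nat" where
  "input_bound q a l = (let n = (l + 1) ^ 3; m = n + 1 in
     (Suc (l + (2 * (m * n) + 2 * m + 2 * poly q n + 3)) + (n * (2 * (l + 3)) + (l + 2)) +
       a * (m * Suc (l + Suc (2 * l)))) + m + m * (l + 2))"

lemma poly_bounded_input_bound: "poly_bounded (input_bound q a)"
  unfolding input_bound_def Let_def by (intro poly_bounded_intros)

text \<open>Row \<open>i\<close>, into which \<open>u\<close> is written, is not queried by the
  event; so every answer involved falls under \<open>emits_ans\<close>.\<close>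

lemma emits_tester_input:
  assumes h: "\<And>l. bij_betw h (cube l) (cube l)" and ss: "set_system n m l J" and x: "x \<in> cube n"
    and m: "m = Suc n" and n: "n \<le> (l + 1) ^ 3" and b: "length b = m" and w: "length w \<le> poly q n"
    and \<tau>: "event_ok Gs a m \<tau>" and i: "i < m" "i \<notin> queries \<tau>"
  shows "emits l (\<lambda>u. tester_input h B J b w \<tau> (mix (row n J i) x u)) (input_bound q a l)"
    and "length (expected \<tau>) \<le> input_bound q a l"
proof -
  define N where "N = (l + 1) ^ 3"
  have mN: "m \<le> N + 1" "n \<le> N" using n m by (simp_all add: N_def)
  have bound: "input_bound q a l = (Suc (l + (2 * ((N + 1) * N) + 2 * (N + 1) + 2 * poly q N + 3)) +
      (N * (2 * (l + 3)) + (l + 2)) + a * ((N + 1) * Suc (l + Suc (2 * l)))) + (N + 1) + (N + 1) * (l + 2)"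
    by (simp only: input_bound_def N_def Let_def)
  show "length (expected \<tau>) \<le> input_bound q a l"
    using \<tau> mN by (cases \<tau>) (auto simp: event_ok_def bound)
  have A: "row n J i \<subseteq> {..<n}" "card (row n J i) = l"
    using ss i by (auto simp: row_def set_system_def)
  show "emits l (\<lambda>u. tester_input h B J b w \<tau> (mix (row n J i) x u)) (input_bound q a l)"
  proof (cases \<tau>)
    case (Consistent j)
    have "emits l (\<lambda>u. (\<lambda>v. [B v = b ! j]) (ans h J j (mix (row n J i) x u))) (m * Suc (l + 1))"
      by (rule emits_ans[OF h ss x i(1)]) (use \<tau> i Consistent in \<open>auto simp: event_ok_def\<close>)
    moreover have "Suc (l + 1) = l + 2" by simp
    then have "m * Suc (l + 1) \<le> (N + 1) * (l + 2)" by (simp only:) (rule mult_le_mono1[OF mN(1)])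
    then have "m * Suc (l + 1) \<le> input_bound q a l" unfolding bound by linarith
    ultimately show ?thesis using emits_mono Consistent by simp
  next
    case (Move G "is" e)
    have ans: "emits l (\<lambda>u. enc (ans h J j (mix (row n J i) x u))) (m * Suc (l + Suc (2 * l)))"
      if "j \<in> set is" for j
      by (rule emits_ans[OF h ss x i(1)]) (use \<tau> i Move that in \<open>auto simp: event_ok_def length_enc\<close>)
    have tup: "tuple (map f is) = concat (map (\<lambda>j. enc (f j)) is)" for f :: "nat \<Rightarrow> bool list"
      by (induction "is") auto
    let ?c = "enc J @ enc b @ enc w"
    have e: "emits l (\<lambda>u. ?c @ enc (mix (row n J i) x u) @ concat (map (\<lambda>j. enc (ans h J j (mix (row n J i) x u))) is))
       (Suc (l + length ?c) + ((n * (2 * (l + 3)) + (l + 2)) + length is * (m * Suc (l + Suc (2 * l)))))"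
      by (intro emits_append emits_const emits_mix[OF x A] emits_concat ans)
    have "length ?c \<le> 2 * ((N + 1) * N) + 2 * (N + 1) + 2 * poly q N + 3"
    proof -
      have "length J = m * n" using ss by (simp add: set_system_def)
      also have "\<dots> \<le> (N + 1) * N" using mN by (intro mult_le_mono)
      finally have "length J \<le> (N + 1) * N" .
      moreover have "length w \<le> poly q N" using w poly_nat_mono[OF mN(2)] by (rule order.trans)
      moreover have "Suc (2 * j) + (Suc (2 * m) + Suc (2 * k)) \<le> 2 * P + 2 * (N + 1) + 2 * Q + 3"
        if "j \<le> P" "k \<le> Q" for j k P Q using that mN(1) by presburger
      ultimately show ?thesis using b unfolding length_append length_enc by metis
    qed
    moreover have "n * (2 * (l + 3)) \<le> N * (2 * (l + 3))" using mN by (intro mult_le_mono) auto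
    moreover have "length is * (m * Suc (l + Suc (2 * l))) \<le> a * ((N + 1) * Suc (l + Suc (2 * l)))"
      using \<tau> Move mN by (intro mult_le_mono) (auto simp: event_ok_def)
    ultimately have "Suc (l + length ?c) + ((n * (2 * (l + 3)) + (l + 2)) + length is * (m * Suc (l + Suc (2 * l)))) \<le> input_bound q a l"
      unfolding bound by linarith
    moreover have "tester_input h B J b w \<tau> \<omega> = ?c @ enc \<omega> @ concat (map (\<lambda>j. enc (ans h J j \<omega>)) is)" for \<omega>
      by (simp add: Move tup)
    ultimately show ?thesis using emits_mono[OF e] by simp
  qed
qed

text \<open>For given \<open>l\<close> all instances and traces are quantified here, so that the
  threshold on \<open>l\<close> found below serves them all.\<close>

definition trace_hard ::
  "(bool list \<Rightarrow> bool list) \<Rightarrow> (bool list \<Rightarrow> bool) \<Rightarrow> (bool list \<Rightarrow> bool list) set \<Rightarrow> nat \<Rightarrow>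
   nat poly \<Rightarrow> nat \<Rightarrow> nat \<Rightarrow> bool" where
  "trace_hard h B Gs a q k l \<longleftrightarrow> (\<forall>n m J b w \<tau>s i d.
    set_system n m l J \<longrightarrow> m = Suc n \<longrightarrow> n \<le> (l + 1) ^ 3 \<longrightarrow> length b = m \<longrightarrow> length w \<le> poly q n \<longrightarrow>
    length \<tau>s \<le> a \<longrightarrow> (\<forall>\<tau>\<in>set \<tau>s. event_ok Gs a m \<tau> \<and> i \<notin> queries \<tau>) \<longrightarrow> i < m \<longrightarrow>
    real (card {\<omega> \<in> samples h B n J b w \<tau>s. B (ans h J i \<omega>) \<noteq> d}) \<le>
      real (card (samples h B n J b w \<tau>s)) / 2 + 2 ^ n / real l ^ k)"

text \<open>For each fixed completion \<open>x\<close> the events are tests on \<open>u\<close>, and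
  \<open>hard_for\<close> bounds the bias of the bit. Averaging over \<open>x\<close> turns this
  into a statement on samples, with the relative error unchanged.\<close>

lemma trace_hardness:
  assumes hb: "hard_bit_permutation h B" and Gs: "finite Gs" "\<And>G. G \<in> Gs \<Longrightarrow> polytime G" and k: "k \<ge> 1"
  shows "\<forall>\<^sub>F l in sequentially. trace_hard h B Gs a q k l"
proof -
  have h: "\<And>l. bij_betw h (cube l) (cube l)" using hb by (simp add: hard_bit_permutation_def)
  let ?q = "input_bound q a"
  let ?Gs = "insert (\<lambda>x. x) Gs"
  \<comment> \<open>The threshold of \<open>hardness_tests\<close> depends on the list of testers,
    but there are only finitely many lists of length at most \<open>a\<close>. The identity is
    included as the tester of \<open>Consistent\<close>.\<close>
  let ?shapes = "{xs. set xs \<subseteq> ?Gs \<and> length xs \<le> a}"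
  have "finite ?shapes" using Gs(1) by (intro finite_lists_length_le) simp
  moreover have "\<forall>Gs\<in>?shapes. \<forall>\<^sub>F l in sequentially. hard_for h B ?q k Gs l"
    using Gs(2) polytime_id by (intro ballI hardness_tests[OF hb _ poly_bounded_input_bound k]) blast
  ultimately have "\<forall>\<^sub>F l in sequentially. \<forall>Gs\<in>?shapes. hard_for h B ?q k Gs l"
    by (rule eventually_ball_finite)
  then show ?thesis
  proof (rule eventually_mono, unfold trace_hard_def, intro allI impI)
    fix l n m :: nat and J b w :: "bool list" and \<tau>s i d
    assume hard: "\<forall>Gs\<in>?shapes. hard_for h B ?q k Gs l"
      and ss: "set_system n m l J" and m: "m = Suc n" and n: "n \<le> (l + 1) ^ 3" and b: "length b = m"
      and w: "length w \<le> poly q n" and \<tau>s: "length \<tau>s \<le> a"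
      and ok: "\<forall>\<tau>\<in>set \<tau>s. event_ok Gs a m \<tau> \<and> i \<notin> queries \<tau>" and i: "i < m"
    let ?A = "row n J i" and ?S = "samples h B n J b w \<tau>s"
    have A: "?A \<subseteq> {..<n}" "card ?A = l" using ss i by (auto simp: row_def set_system_def)
    let ?P = "\<lambda>\<omega>. \<forall>\<tau>\<in>set \<tau>s. occurs h B J b w \<tau> \<omega>" and ?F = "\<lambda>\<omega>. B (ans h J i \<omega>) \<noteq> d"
    have main: "real (card {u \<in> cube l. ?P (mix ?A x u) \<and> ?F (mix ?A x u)}) \<le>
       real (card {u \<in> cube l. ?P (mix ?A x u)}) / 2 + 2 ^ l / real l ^ k" if x: "x \<in> cube n" for x
    proof -
      have len: "length x = n" using x by (simp add: cube_def)
      have "\<exists>cls. (\<forall>cl\<in>set cls. length (fst cl) = l) \<and> cls_size cls \<le> ?q l \<and>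
          (\<forall>u\<in>cube l. emit cls u = tester_input h B J b w (\<tau>s ! j) (mix ?A x u))" if "j < length \<tau>s" for j
        using emits_tester_input(1)[OF h ss x m n b w _ i, of Gs a "\<tau>s ! j" B] ok that
        unfolding emits_def by auto
      then obtain clss where clss: "\<And>j. j < length \<tau>s \<Longrightarrow> (\<forall>cl\<in>set (clss j). length (fst cl) = l) \<and>
          cls_size (clss j) \<le> ?q l \<and>
          (\<forall>u\<in>cube l. emit (clss j) u = tester_input h B J b w (\<tau>s ! j) (mix ?A x u))" by metis
      let ?Ts = "map tester \<tau>s" and ?es = "\<lambda>j. expected (\<tau>s ! j)"
      have shape: "?Ts \<in> ?shapes"
      proof -
        have "tester \<tau> \<in> ?Gs" if "\<tau> \<in> set \<tau>s" for \<tau> using ok that by (cases \<tau>) (auto simp: event_ok_def)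
        then show ?thesis using \<tau>s by auto
      qed
      have valid: "valid_tests ?q l (length ?Ts) clss ?es"
        unfolding valid_tests_def
      proof (intro allI impI conjI)
        fix j assume "j < length ?Ts"
        then show "length (expected (\<tau>s ! j)) \<le> ?q l"
          using emits_tester_input(2)[OF h ss x m n b w _ i, of Gs a "\<tau>s ! j"] ok by auto
      qed (use clss in auto)
      have pass: "passing ?Ts l clss ?es = {u \<in> cube l. ?P (mix ?A x u)}"
        using clss by (auto simp: passing_def occurs_def all_set_conv_all_nth)
      have "length (nths x ?A) = l"
        using length_nths_subset[of ?A x] A len by simp
      then have "ans h J i (mix ?A x u) = preimage h u" if "u \<in> cube l" for u
        using that by (simp add: ans_def len nths_mix cube_def)
      then have "{u \<in> passing ?Ts l clss ?es. B (preimage h u) \<noteq> d} =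
          {u \<in> cube l. ?P (mix ?A x u) \<and> ?F (mix ?A x u)}"
        unfolding pass by auto
      moreover have "real (card {u \<in> passing ?Ts l clss ?es. B (preimage h u) \<noteq> d}) \<le>
          real (card (passing ?Ts l clss ?es)) / 2 + 2 ^ l / real l ^ k"
        using hard[rule_format, OF shape, unfolded hard_for_def, rule_format, OF valid] .
      ultimately show ?thesis by (simp only: pass)
    qed
    have S: "{\<omega> \<in> cube n. ?P \<omega> \<and> ?F \<omega>} = {\<omega> \<in> ?S. ?F \<omega>}" "{\<omega> \<in> cube n. ?P \<omega>} = ?S"
      by (auto simp: samples_def)
    \<comment> \<open>By \<open>sum_mix\<close>, each sample arises from exactly
      \<open>2 ^ l\<close> pairs of a completion and an input.\<close>
    have "2 ^ l * real (card {\<omega> \<in> ?S. ?F \<omega>}) = real (\<Sum>x\<in>cube n. card {u \<in> cube l. ?P (mix ?A x u) \<and> ?F (mix ?A x u)})"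
      using sum_mix[OF A, of "\<lambda>\<omega>. ?P \<omega> \<and> ?F \<omega>"] unfolding S by simp
    also have "\<dots> \<le> (\<Sum>x\<in>cube n. real (card {u \<in> cube l. ?P (mix ?A x u)}) / 2 + 2 ^ l / real l ^ k)"
      unfolding of_nat_sum by (rule sum_mono) (rule main)
    also have "\<dots> = real (\<Sum>x\<in>cube n. card {u \<in> cube l. ?P (mix ?A x u)}) / 2 + 2 ^ n * (2 ^ l / real l ^ k)"
      by (simp add: sum.distrib card_cube sum_divide_distrib)
    also have "\<dots> = 2 ^ l * (real (card ?S) / 2 + 2 ^ n / real l ^ k)"
      using sum_mix[OF A, of ?P] unfolding S by (simp add: algebra_simps)
    finally show "real (card {\<omega> \<in> ?S. ?F \<omega>}) \<le> real (card ?S) / 2 + 2 ^ n / real l ^ k"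
      by simp
  qed
qed

section \<open>Counting the samples on which all Students finish\<close>

text \<open>All outputs are identified: a trace only has to know that a Student has finished. A
  legal move then has only \<open>m + 1\<close> possible query parts, while the outputs may be far
  more numerous.\<close>

definition query_part :: "(bool list \<Rightarrow> bool list) \<Rightarrow> bool list \<Rightarrow> bool list" where
  "query_part S x = (case S x of True # y \<Rightarrow> True # y | _ \<Rightarrow> [])"

lemma polytime_query_part:
  assumes "polytime S" shows "polytime (query_part S)"
proof -
  obtain p and q :: "nat poly" where
    p: "\<And>x. \<exists>t s. exec p ((\<lambda>_. [])(0 := x)) t s \<and> s 0 = S x \<and> t \<le> poly q (length x)"
    using assms unfolding polytime_def by blast
  let ?b = "Branch 0 Skip (clear 0) Skip"
  let ?T = "\<lambda>L. poly q L + (2 + (2 * (L + poly q L)))"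
  have "poly_bounded ?T" by (intro poly_bounded_intros)
  then obtain Q where Q: "\<And>L. ?T L \<le> poly Q L" unfolding poly_bounded_def by blast
  have "\<exists>t s. exec (Seq p ?b) ((\<lambda>_. [])(0 := x)) t s \<and> s 0 = query_part S x \<and> t \<le> poly Q (length x)" for x
  proof -
    obtain t s where s: "exec p ((\<lambda>_. [])(0 := x)) t s" "s 0 = S x" "t \<le> poly q (length x)" using p by blast
    have len: "length (s 0) \<le> length x + poly q (length x)"
      using exec_length[OF s(1), of 0] s(3) by simp
    have "\<exists>t' s'. exec ?b s t' s' \<and> s' 0 = query_part S x \<and> t' \<le> 2 + 2 * length (s 0)"
    proof (cases "s 0")
      case Nil
      then show ?thesis using exec.intros(5)[of s 0, OF Nil exec.intros(1)] s(2) by (force simp: query_part_def)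
    next
      case (Cons c y)
      show ?thesis
      proof (cases c)
        case True
        have "exec ?b s (Suc 1) s"
          by (rule exec.intros(7)[OF _ exec.intros(1)]) (use Cons True in simp)
        then show ?thesis using Cons True s(2)
          by (intro exI[of _ "Suc 1"] exI[of _ s]) (simp add: query_part_def)
      next
        case False
        obtain t' where t': "exec (clear 0) s t' (s(0 := []))" "t' \<le> Suc (2 * length (s 0))"
          using runs_clear[of 0 s] by (auto simp: runs_def)
        have "exec ?b s (Suc t') (s(0 := []))" using exec.intros(6)[OF _ t'(1)] Cons False by simp
        then show ?thesis using t'(2) False Cons s(2)
          by (intro exI[of _ "Suc t'"] exI[of _ "s(0 := [])"]) (simp add: query_part_def)
      qed
    qed
    then obtain t' s' where "exec ?b s t' s'" "s' 0 = query_part S x" "t' \<le> 2 + 2 * length (s 0)" by blast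
    moreover from this have "exec (Seq p ?b) ((\<lambda>_. [])(0 := x)) (t + t') s'" using s(1) exec.intros(4) by blast
    moreover have "t + t' \<le> poly Q (length x)"
      using calculation(3) s(3) len Q[of "length x"] by simp
    ultimately show ?thesis by blast
  qed
  then show ?thesis unfolding polytime_def by blast
qed

locale instance_hardness =
  fixes h :: "bool list \<Rightarrow> bool list" and B :: "bool list \<Rightarrow> bool" and n m :: nat and J b w :: "bool list"
    and Gs :: "(bool list \<Rightarrow> bool list) set" and a :: nat and \<delta> :: real
  assumes length_b: "length b = m" and \<delta>: "\<delta> \<ge> 0"
    and hardness: "length \<tau>s \<le> a \<Longrightarrow> (\<And>\<tau>. \<tau> \<in> set \<tau>s \<Longrightarrow> event_ok Gs a m \<tau> \<and> i \<notin> queries \<tau>) \<Longrightarrow> i < m \<Longrightarrow>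
      real (card {\<omega> \<in> samples h B n J b w \<tau>s. B (ans h J i \<omega>) \<noteq> d}) \<le>
        real (card (samples h B n J b w \<tau>s)) / 2 + \<delta>"
begin

text \<open>Earlier queries are recorded instead of their answers; the answers are functions of the
  sample, so one trace covers samples with different answers.\<close>

definition run :: "(bool list \<Rightarrow> bool list) \<Rightarrow> nat \<Rightarrow> nat list \<Rightarrow> bool list \<Rightarrow> outcome" where
  "run S c is \<omega> = student_run h B S J b w \<omega> c (map (\<lambda>i. ans h J i \<omega>) is)"

text \<open>In a list of Students the first one has already received the answers to the queries \<open>is\<close>.\<close>

fun finish :: "((bool list \<Rightarrow> bool list) \<times> nat) list \<Rightarrow> nat list \<Rightarrow> bool list \<Rightarrow> bool" where
  "finish [] is \<omega> \<longleftrightarrow> True"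
| "finish ((S, c) # rem) is \<omega> \<longleftrightarrow> (\<exists>y. run S c is \<omega> = Output y) \<and> finish rem [] \<omega>"

fun legal :: "((bool list \<Rightarrow> bool list) \<times> nat) list \<Rightarrow> nat list \<Rightarrow> bool list \<Rightarrow> bool" where
  "legal [] is \<omega> \<longleftrightarrow> True"
| "legal ((S, c) # rem) is \<omega> \<longleftrightarrow> run S c is \<omega> \<noteq> Illegal \<and> legal rem [] \<omega>"

abbreviation "\<Omega> \<equiv> samples h B n J b w"

abbreviation "told is \<omega> \<equiv> tuple (J # b # w # \<omega> # map (\<lambda>i. ans h J i \<omega>) is)"

lemma finite_\<Omega>: "finite (\<Omega> \<tau>s)"
  using card_cube by (auto simp: samples_def)

lemma \<Omega>_append: "\<Omega> (\<tau>s @ \<tau>s') = \<Omega> \<tau>s \<inter> \<Omega> \<tau>s'"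
  by (auto simp: samples_def)

lemma \<Omega>_Move: "\<omega> \<in> \<Omega> [Move (query_part S) is e] \<longleftrightarrow> \<omega> \<in> cube n \<and> query_part S (told is \<omega>) = e"
  by (auto simp: samples_def occurs_def)

lemma \<Omega>_Consistent: "\<omega> \<in> \<Omega> [Consistent i] \<longleftrightarrow> \<omega> \<in> cube n \<and> B (ans h J i \<omega>) = b ! i"
  by (auto simp: samples_def occurs_def)

lemma run_output: "query_part S (told is \<omega>) = [] \<Longrightarrow> \<exists>y. run S c is \<omega> = Output y"
  by (cases c) (auto simp: run_def query_part_def split: list.splits bool.splits)

lemma run_query:
  assumes "query_part S (told is \<omega>) = True # str i" "i < m"
  shows "run S 0 is \<omega> = Illegal"
    and "B (ans h J i \<omega>) = b ! i \<Longrightarrow> run S (Suc c) is \<omega> = run S c (is @ [i]) \<omega>"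
proof -
  have "code (str i) = i" by simp
  moreover have "S (told is \<omega>) = True # str i"
    using assms(1) by (auto simp: query_part_def split: list.splits bool.splits)
  ultimately show "run S 0 is \<omega> = Illegal"
    and "B (ans h J i \<omega>) = b ! i \<Longrightarrow> run S (Suc c) is \<omega> = run S c (is @ [i]) \<omega>"
    using assms(2) length_b by (auto simp: run_def ans_def Let_def)
qed

lemma run_legal_query:
  assumes "run S c is \<omega> \<noteq> Illegal"
  shows "query_part S (told is \<omega>) \<in> insert [] ((\<lambda>i. True # str i) ` {..<m})"
proof (cases "S (told is \<omega>)")
  case (Cons q x)
  show ?thesis
  proof (cases q)
    case True
    then have "code x < m" using assms Cons length_b by (cases c) (auto simp: run_def Let_def split: if_splits)
    then show ?thesis using Cons True
      by (auto simp: query_part_def intro!: image_eqI[of _ _ "code x"])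
  qed (use Cons in \<open>simp add: query_part_def\<close>)
qed (simp add: query_part_def)

lemma length_str_le: "length (str k) \<le> k"
  by (induction k rule: str.induct) auto

text \<open>Induction on the number \<open>K\<close> of remaining rounds; a Student with bound
  \<open>c\<close> takes at most \<open>c\<close> queries and one final move, hence
  \<open>Suc c\<close>. The samples split by the next query part into \<open>m + 1\<close> classes.
  Output costs nothing, and a new query keeps half of its class up to \<open>\<delta>\<close>;
  adding the errors of the classes in each round gives \<open>K * (m + 1) ^ K * \<delta>\<close>. A
  round adds at most two events, whence \<open>2 * K\<close>. As all queries in the trace are known
  to be consistent, an index without a \<open>Consistent\<close> event is fresh, as
  \<open>hardness\<close> requires.\<close>

lemma survivors:
  assumes "(\<Sum>(S, c)\<leftarrow>rem. Suc c) \<le> K" "2 * K + length \<tau>s \<le> a" "K + length is \<le> a"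
    and "\<And>S c. (S, c) \<in> set rem \<Longrightarrow> query_part S \<in> Gs"
    and "\<And>\<tau>. \<tau> \<in> set \<tau>s \<Longrightarrow> event_ok Gs a m \<tau> \<and> queries \<tau> \<subseteq> {j. Consistent j \<in> set \<tau>s}"
    and "set is \<subseteq> {j. Consistent j \<in> set \<tau>s}"
    and "\<And>\<omega>. \<omega> \<in> \<Omega> \<tau>s \<Longrightarrow> legal rem is \<omega>"
  shows "real (card (\<Omega> \<tau>s)) / 2 ^ K - real K * real (Suc m) ^ K * \<delta> \<le> real (card {\<omega> \<in> \<Omega> \<tau>s. finish rem is \<omega>})"
  using assms
proof (induction K arbitrary: rem "is" \<tau>s)
  case 0
  then have "rem = []" by (cases rem) auto
  then show ?case by simp
next
  case (Suc K)
  show ?case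
  proof (cases rem)
    case Nil
    have "real (card (\<Omega> \<tau>s)) / 2 ^ Suc K \<le> real (card (\<Omega> \<tau>s))"
      using one_le_power[of "2::real" "Suc K"] by (intro divide_le_eq[THEN iffD2]) (auto simp: mult_le_cancel_left1)
    moreover have "0 \<le> real (Suc K) * real (Suc m) ^ Suc K * \<delta>" using \<delta> by simp
    ultimately have "real (card (\<Omega> \<tau>s)) / 2 ^ Suc K - real (Suc K) * real (Suc m) ^ Suc K * \<delta> \<le> real (card (\<Omega> \<tau>s))"
      by linarith
    then show ?thesis using Nil by simp
  next
    case (Cons Sc rest)
    obtain S c where Sc: "Sc = (S, c)" by fastforce
    have rem: "rem = (S, c) # rest" using Cons Sc by simp
    let ?E = "insert [] ((\<lambda>i. True # str i) ` {..<m})"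
    let ?\<tau> = "\<lambda>e. \<tau>s @ [Move (query_part S) is e]"
    let ?err = "real K * real (Suc m) ^ K * \<delta>"
    have E: "finite ?E" "card ?E = Suc m"
    proof -
      have "inj_on (\<lambda>i. True # str i) {..<m}" by (rule inj_onI) (metis code_str list.inject)
      then show "card ?E = Suc m" by (subst card_insert_disjoint) (auto simp: card_image)
    qed simp
    have G: "query_part S \<in> Gs" using Suc.prems(4) rem by auto
    \<comment> \<open>Legality makes the listed moves exhaustive; they are disjoint since the query
      part is a function of the sample.\<close>
    have part: "real (card {\<omega> \<in> \<Omega> \<tau>s. P \<omega>}) = (\<Sum>e\<in>?E. real (card {\<omega> \<in> \<Omega> (?\<tau> e). P \<omega>}))" for P
    proof -
      have "{\<omega> \<in> \<Omega> \<tau>s. P \<omega>} = (\<Union>e\<in>?E. {\<omega> \<in> \<Omega> (?\<tau> e). P \<omega>})"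
      proof (intro set_eqI iffI)
        fix \<omega> assume \<omega>: "\<omega> \<in> {\<omega> \<in> \<Omega> \<tau>s. P \<omega>}"
        then have "run S c is \<omega> \<noteq> Illegal" using Suc.prems(7)[of \<omega>] rem by auto
        from run_legal_query[OF this] \<omega> show "\<omega> \<in> (\<Union>e\<in>?E. {\<omega> \<in> \<Omega> (?\<tau> e). P \<omega>})"
          unfolding \<Omega>_append Int_iff \<Omega>_Move by (auto simp: samples_def)
      qed (auto simp: \<Omega>_append)
      moreover have "card (\<Union>e\<in>?E. {\<omega> \<in> \<Omega> (?\<tau> e). P \<omega>}) = (\<Sum>e\<in>?E. card {\<omega> \<in> \<Omega> (?\<tau> e). P \<omega>})"
        using E(1) finite_\<Omega> by (intro card_UN_disjoint) (auto simp: \<Omega>_append \<Omega>_Move)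
      ultimately show ?thesis by simp
    qed
    have ok: "event_ok Gs a m \<tau> \<and> queries \<tau> \<subseteq> {j. Consistent j \<in> set \<tau>s}"
      if "e \<in> ?E" "\<tau> \<in> set (?\<tau> e)" for e \<tau>
    proof (cases "\<tau> \<in> set \<tau>s")
      case False
      then have \<tau>: "\<tau> = Move (query_part S) is e" using that by auto
      have "length e \<le> m" using that(1) length_str_le by (auto simp: Suc_le_eq intro: le_less_trans[OF length_str_le])
      moreover have "set is \<subseteq> {..<m}" using Suc.prems(5,6) by (fastforce simp: event_ok_def)
      ultimately show ?thesis using Suc.prems(3,6) G by (auto simp: \<tau> event_ok_def)
    qed (use Suc.prems(5) in auto)
    have bound: "real (card (\<Omega> (?\<tau> e))) / 2 ^ Suc K - (\<delta> + ?err) \<le>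
        real (card {\<omega> \<in> \<Omega> (?\<tau> e). finish rem is \<omega>})" if "e \<in> ?E" for e
    proof (cases "e = []")
      case True
      \<comment> \<open>The Student has finished. The next one starts without answers, but the trace
        is kept: all Students run on the same sample.\<close>
      have "real (card (\<Omega> (?\<tau> e))) / 2 ^ K - ?err \<le> real (card {\<omega> \<in> \<Omega> (?\<tau> e). finish rest [] \<omega>})"
      proof (rule Suc.IH)
        show "event_ok Gs a m \<tau> \<and> queries \<tau> \<subseteq> {j. Consistent j \<in> set (?\<tau> e)}" if "\<tau> \<in> set (?\<tau> e)" for \<tau>
          using ok[OF \<open>e \<in> ?E\<close> that] by auto
        show "legal rest [] \<omega>" if "\<omega> \<in> \<Omega> (?\<tau> e)" for \<omega>
          using Suc.prems(7)[of \<omega>] that rem by (auto simp: \<Omega>_append)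
      qed (use Suc.prems(1-4) rem in auto)
      moreover have "{\<omega> \<in> \<Omega> (?\<tau> e). finish rest [] \<omega>} = {\<omega> \<in> \<Omega> (?\<tau> e). finish rem is \<omega>}"
        using run_output[of S _ "is"] True by (auto simp: rem \<Omega>_append \<Omega>_Move)
      moreover have "real (card (\<Omega> (?\<tau> e))) / 2 ^ Suc K \<le> real (card (\<Omega> (?\<tau> e))) / 2 ^ K"
        by (intro divide_left_mono) auto
      ultimately show ?thesis using \<delta> by simp
    next
      case False
      then obtain i where i: "i < m" "e = True # str i" using \<open>e \<in> ?E\<close> by blast
      let ?\<tau>' = "?\<tau> e @ [Consistent i]"
      have half: "real (card (\<Omega> (?\<tau> e))) / 2 - \<delta> \<le> real (card (\<Omega> ?\<tau>'))"
      proof (cases "Consistent i \<in> set \<tau>s")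
        case True
        \<comment> \<open>A repeated query, possibly by another Student, loses no sample: its answer
          is already known to be consistent.\<close>
        then have "\<Omega> ?\<tau>' = \<Omega> (?\<tau> e)" by (auto simp: samples_def)
        then show ?thesis using \<delta> by simp
      next
        case False
        have "real (card {\<omega> \<in> \<Omega> (?\<tau> e). B (ans h J i \<omega>) \<noteq> b ! i}) \<le> real (card (\<Omega> (?\<tau> e))) / 2 + \<delta>"
          by (rule hardness) (use Suc.prems(2) ok[OF that] False i in auto)
        moreover have "\<Omega> (?\<tau> e) = {\<omega> \<in> \<Omega> (?\<tau> e). B (ans h J i \<omega>) \<noteq> b ! i} \<union> \<Omega> ?\<tau>'"
          unfolding \<Omega>_append[of "?\<tau> e"] using \<Omega>_Consistent by (auto simp: samples_def)
        then have "card (\<Omega> (?\<tau> e)) = card ({\<omega> \<in> \<Omega> (?\<tau> e). B (ans h J i \<omega>) \<noteq> b ! i} \<union> \<Omega> ?\<tau>')"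
          by (rule arg_cong)
        then have "card (\<Omega> (?\<tau> e)) \<le> card {\<omega> \<in> \<Omega> (?\<tau> e). B (ans h J i \<omega>) \<noteq> b ! i} + card (\<Omega> ?\<tau>')"
          using card_Un_le by (rule ord_eq_le_trans)
        ultimately show ?thesis by linarith
      qed
      have query: "query_part S (told is \<omega>) = True # str i" if "\<omega> \<in> \<Omega> (?\<tau> e)" for \<omega>
        using that i unfolding \<Omega>_append Int_iff \<Omega>_Move by simp
      show ?thesis
      proof (cases c)
        case 0
        \<comment> \<open>A query without queries left would be illegal, so this class is
          empty.\<close>
        have "\<omega> \<notin> \<Omega> (?\<tau> e)" for \<omega>
          using run_query(1)[OF query i(1), of \<omega>] Suc.prems(7)[of \<omega>] rem 0 by (auto simp: \<Omega>_append)
        then have empty: "\<Omega> (?\<tau> e) = {}" by blast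
        have "0 \<le> ?err" "real (card (\<Omega> (?\<tau> e))) / 2 ^ Suc K = 0"
          "0 \<le> real (card {\<omega> \<in> \<Omega> (?\<tau> e). finish rem is \<omega>})"
          using \<delta> unfolding empty by simp_all
        then show ?thesis using \<delta> by linarith
      next
        case (Suc c')
        let ?rem = "(S, c') # rest"
        have run: "run S c is \<omega> = run S c' (is @ [i]) \<omega>" if "\<omega> \<in> \<Omega> ?\<tau>'" for \<omega>
          using run_query(2)[OF query i(1), of \<omega>] that Suc
          unfolding \<Omega>_append[of "?\<tau> e"] Int_iff \<Omega>_Consistent by simp
        have "real (card (\<Omega> ?\<tau>')) / 2 ^ K - ?err \<le> real (card {\<omega> \<in> \<Omega> ?\<tau>'. finish ?rem (is @ [i]) \<omega>})"
        proof (rule Suc.IH)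
          show "event_ok Gs a m \<tau> \<and> queries \<tau> \<subseteq> {j. Consistent j \<in> set ?\<tau>'}" if "\<tau> \<in> set ?\<tau>'" for \<tau>
            using ok[OF \<open>e \<in> ?E\<close>, of \<tau>] that i by (auto simp: event_ok_def)
          show "legal ?rem (is @ [i]) \<omega>" if "\<omega> \<in> \<Omega> ?\<tau>'" for \<omega>
            using Suc.prems(7)[of \<omega>] that rem run[OF that] by (auto simp: \<Omega>_append)
        qed (use Suc.prems(1-4,6) rem Suc in auto)
        also have "\<dots> \<le> real (card {\<omega> \<in> \<Omega> (?\<tau> e). finish rem is \<omega>})"
        proof -
          have "{\<omega> \<in> \<Omega> ?\<tau>'. finish ?rem (is @ [i]) \<omega>} \<subseteq> {\<omega> \<in> \<Omega> (?\<tau> e). finish rem is \<omega>}"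
          proof
            fix \<omega> assume \<omega>: "\<omega> \<in> {\<omega> \<in> \<Omega> ?\<tau>'. finish ?rem (is @ [i]) \<omega>}"
            then have "\<omega> \<in> \<Omega> (?\<tau> e)" by (simp add: samples_def)
            then show "\<omega> \<in> {\<omega> \<in> \<Omega> (?\<tau> e). finish rem is \<omega>}" using \<omega> run[of \<omega>] by (simp add: rem)
          qed
          then show ?thesis using finite_\<Omega> by (intro of_nat_mono card_mono) auto
        qed
        finally have "real (card (\<Omega> ?\<tau>')) / 2 ^ K - ?err \<le> real (card {\<omega> \<in> \<Omega> (?\<tau> e). finish rem is \<omega>})" .
        moreover have "(real (card (\<Omega> (?\<tau> e))) / 2 - \<delta>) / 2 ^ K \<le> real (card (\<Omega> ?\<tau>')) / 2 ^ K"
          using half by (intro divide_right_mono) auto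
        moreover have "\<delta> / 2 ^ K \<le> \<delta>"
          using \<delta> one_le_power[of "2::real" K] by (simp add: divide_le_eq mult_le_cancel_left1)
        ultimately show ?thesis by (simp add: diff_divide_distrib)
      qed
    qed
    have "real (card (\<Omega> \<tau>s)) / 2 ^ Suc K - real (Suc m) * (\<delta> + ?err) =
        (\<Sum>e\<in>?E. real (card (\<Omega> (?\<tau> e))) / 2 ^ Suc K - (\<delta> + ?err))"
      using part[of "\<lambda>_. True"] E(2) by (simp only: sum_subtractf sum_constant sum_divide_distrib[symmetric]) simp
    also have "\<dots> \<le> (\<Sum>e\<in>?E. real (card {\<omega> \<in> \<Omega> (?\<tau> e). finish rem is \<omega>}))"
      by (intro sum_mono bound)
    also have "\<dots> = real (card {\<omega> \<in> \<Omega> \<tau>s. finish rem is \<omega>})" by (rule part[symmetric])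
    finally have *: "real (card (\<Omega> \<tau>s)) / 2 ^ Suc K - real (Suc m) * (\<delta> + ?err) \<le>
        real (card {\<omega> \<in> \<Omega> \<tau>s. finish rem is \<omega>})" .
    \<comment> \<open>The new error is absorbed by raising the factor \<open>K\<close> to
      \<open>Suc K\<close>; the sum over \<open>Suc m\<close> classes then raises the
      exponent.\<close>
    have "1 * \<delta> \<le> real (Suc m) ^ K * \<delta>" using \<delta> by (intro mult_right_mono one_le_power) auto
    then have "\<delta> + ?err \<le> real (Suc K) * real (Suc m) ^ K * \<delta>" by (simp add: algebra_simps)
    then have "real (Suc m) * (\<delta> + ?err) \<le> real (Suc m) * (real (Suc K) * real (Suc m) ^ K * \<delta>)"
      by (intro mult_left_mono) auto
    also have "\<dots> = real (Suc K) * real (Suc m) ^ Suc K * \<delta>" by simp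
    finally show ?thesis using * by linarith
  qed
qed

end

lemma (in instance_hardness) finish_Nil: "finish rem [] \<omega> \<longleftrightarrow> (\<forall>(S, c)\<in>set rem. \<exists>y. student_run h B S J b w \<omega> c [] = Output y)"
  by (induction rem) (auto simp: run_def)

lemma (in instance_hardness) legal_Nil: "legal rem [] \<omega> \<longleftrightarrow> (\<forall>(S, c)\<in>set rem. student_run h B S J b w \<omega> c [] \<noteq> Illegal)"
  by (induction rem) (auto simp: run_def)

definition finishing ::
  "(bool list \<Rightarrow> bool list) \<Rightarrow> (bool list \<Rightarrow> bool) \<Rightarrow> ((bool list \<Rightarrow> bool list) \<times> nat) list \<Rightarrow> nat \<Rightarrow>
   bool list \<Rightarrow> bool list \<Rightarrow> bool list \<Rightarrow> bool list set" where
  "finishing h B Ss n J b w = {\<omega> \<in> cube n. \<forall>(S, c)\<in>set Ss. \<exists>y. student_run h B S J b w \<omega> c [] = Output y}"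

text \<open>With \<open>m + 1\<close> at most \<open>9 * l ^ 3\<close> and exponent
  \<open>3 * K + 1\<close>, the total error is at most \<open>2 ^ n * K * 9 ^ K / l\<close>. For
  \<open>l\<close> at least \<open>K * 9 ^ K * 2 ^ Suc K\<close> this is at most half of the main
  term \<open>2 ^ n / 2 ^ K\<close>. The other half exceeds any constant \<open>C\<close> for large
  \<open>n\<close>.\<close>

lemma many_outputs:
  assumes hb: "hard_bit_permutation h B" and poly: "\<forall>s\<in>set Ss. polytime (fst s)"
  shows "\<forall>\<^sub>F n in sequentially. \<forall>m l J b w. m = Suc n \<longrightarrow> int l = \<lfloor>root 3 (real n)\<rfloor> \<longrightarrow>
    set_system n m l J \<longrightarrow> length b = m \<longrightarrow> length w \<le> poly q n \<longrightarrow>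
    (\<forall>(S, c)\<in>set Ss. \<forall>\<omega>\<in>cube n. student_run h B S J b w \<omega> c [] \<noteq> Illegal) \<longrightarrow>
    C \<le> card (finishing h B Ss n J b w)"
proof -
  define K where "K = (\<Sum>(S, c)\<leftarrow>Ss. Suc c)"
  let ?a = "2 * K" and ?k = "3 * K + 1"
  let ?Gs = "query_part ` fst ` set Ss"
  have G: "finite ?Gs" "\<And>G. G \<in> ?Gs \<Longrightarrow> polytime G"
    using poly by (auto intro: polytime_query_part)
  have "\<forall>\<^sub>F l in sequentially. l \<ge> max 1 (K * 9 ^ K * 2 ^ Suc K)" by (rule eventually_ge_at_top)
  note ev = eventually_conj[OF this trace_hardness[OF hb G, where k = ?k and q = q and a = ?a]]
  let ?H = "trace_hard h B ?Gs ?a q ?k"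
  have "\<forall>\<^sub>F l in sequentially. l \<ge> max 1 (K * 9 ^ K * 2 ^ Suc K) \<and> ?H l"
    by (rule ev) auto
  then obtain l0 where "\<forall>l\<ge>l0. l \<ge> max 1 (K * 9 ^ K * 2 ^ Suc K) \<and> ?H l"
    unfolding eventually_sequentially by (rule exE)
  then have l0: "\<And>l. l \<ge> l0 \<Longrightarrow> l \<ge> max 1 (K * 9 ^ K * 2 ^ Suc K)" "\<And>l. l \<ge> l0 \<Longrightarrow> ?H l"
    by blast+
  show ?thesis
    using eventually_ge_at_top[of "l0 ^ 3 + Suc K + C"]
  proof (rule eventually_mono, intro allI impI)
    fix n m l :: nat and J b w :: "bool list"
    assume n: "l0 ^ 3 + Suc K + C \<le> n" and m: "m = Suc n" and l: "int l = \<lfloor>root 3 (real n)\<rfloor>"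
      and ss: "set_system n m l J" and b: "length b = m" and w: "length w \<le> poly q n"
      and leg: "\<forall>(S, c)\<in>set Ss. \<forall>\<omega>\<in>cube n. student_run h B S J b w \<omega> c [] \<noteq> Illegal"
    have r3: "root 3 (real n) ^ 3 = real n" by simp
    have "real l0 = root 3 (real l0 ^ 3)" by (simp add: real_root_power_cancel)
    also have "\<dots> \<le> root 3 (real n)" using n by (simp flip: of_nat_power)
    finally have "l \<ge> l0" using l by linarith
    have "root 3 (real n) < real l + 1" using l by linarith
    then have "root 3 (real n) ^ 3 < (real l + 1) ^ 3" by (intro power_strict_mono) auto
    then have "real n < real ((l + 1) ^ 3)" unfolding r3 by (simp add: add.commute)
    then have n3: "n < (l + 1) ^ 3" by linarith
    then have n3': "n \<le> (l + 1) ^ 3" by simp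
    note l1 = l0(1)[OF \<open>l \<ge> l0\<close>]
    let ?\<delta> = "2 ^ n / real l ^ ?k"
    interpret instance_hardness h B n m J b w ?Gs ?a ?\<delta>
      using l0(2)[OF \<open>l \<ge> l0\<close>] ss m n3' b w unfolding trace_hard_def by unfold_locales auto
    have surv: "real (card (samples h B n J b w [])) / 2 ^ K - real K * real (Suc m) ^ K * ?\<delta> \<le>
        real (card {\<omega> \<in> samples h B n J b w []. finish Ss [] \<omega>})"
    proof (rule survivors)
      show "(\<Sum>(S, c)\<leftarrow>Ss. Suc c) \<le> K" by (simp add: K_def)
      show "legal Ss [] \<omega>" if "\<omega> \<in> samples h B n J b w []" for \<omega>
        using leg that by (auto simp: legal_Nil samples_def)
    qed force+
    have s: "samples h B n J b w [] = cube n" by (simp add: samples_def)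
    have "real K * real (Suc m) ^ K * ?\<delta> \<le> 2 ^ n / 2 ^ Suc K"
    proof -
      have lpos: "real l \<ge> 1" using l1 by simp
      \<comment> \<open>\<open>Suc m\<close> is \<open>n + 2\<close>, and \<open>n\<close> is
        smaller than \<open>(l + 1) ^ 3\<close>, which is at most \<open>8 * l ^ 3\<close>.\<close>
      have "Suc m \<le> 9 * l ^ 3"
      proof -
        have "(l + 1) ^ 3 \<le> (2 * l) ^ 3" using l1 by (intro power_mono) auto
        also have "\<dots> = 8 * l ^ 3" by (simp add: power_mult_distrib)
        finally show ?thesis using n3 m l1 one_le_power[of l 3] by simp
      qed
      from of_nat_mono[OF this, where 'a = real] have "real (Suc m) \<le> 9 * real l ^ 3" by simp
      then have "real (Suc m) ^ K \<le> (9 * real l ^ 3) ^ K" by (intro power_mono) auto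
      also have "\<dots> = 9 ^ K * real l ^ (3 * K)" by (simp add: power_mult_distrib power_mult)
      finally have 1: "real (Suc m) ^ K \<le> 9 ^ K * real l ^ (3 * K)" .
      have "real K * real (Suc m) ^ K * ?\<delta> \<le> real K * (9 ^ K * real l ^ (3 * K)) * ?\<delta>"
        using 1 by (intro mult_right_mono mult_left_mono) auto
      also have "\<dots> = 2 ^ n * (real K * 9 ^ K / real l)"
        using lpos by (simp add: power_add field_simps)
      also have "\<dots> \<le> 2 ^ n * (1 / 2 ^ Suc K)"
      proof -
        have "real (K * 9 ^ K * 2 ^ Suc K) \<le> real l" using l1 by (intro of_nat_mono) simp
        then have "real K * 9 ^ K / real l \<le> 1 / 2 ^ Suc K" using lpos by (simp add: field_simps)
        then show ?thesis by (intro mult_left_mono) auto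
      qed
      finally show ?thesis by simp
    qed
    then have "2 ^ n / 2 ^ Suc K \<le> real (card {\<omega> \<in> cube n. finish Ss [] \<omega>})"
      using surv unfolding s by (simp add: card_cube)
    moreover have "(2::real) ^ n / 2 ^ Suc K = 2 ^ (n - Suc K)"
      using n by (simp add: power_diff del: power_Suc)
    moreover have "real C \<le> 2 ^ (n - Suc K)"
    proof -
      have "C \<le> n - Suc K" using n by simp
      also have "\<dots> < 2 ^ (n - Suc K)" by (rule less_exp)
      finally have "real C \<le> real (2 ^ (n - Suc K))" by linarith
      then show ?thesis by simp
    qed
    ultimately have "real C \<le> real (card {\<omega> \<in> cube n. finish Ss [] \<omega>})" by linarith
    then show "C \<le> card (finishing h B Ss n J b w)"
      unfolding finish_Nil finishing_def by simp
  qed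
qed

section \<open>Transfer to the model\<close>

lemma fv_rename_fm: "fv (rename_fm \<sigma> \<phi>) \<subseteq> \<sigma> ` fv \<phi>"
proof (induction \<phi> arbitrary: \<sigma>)
  case (Eq t u)
  have "fvt (rename_tm \<sigma> t) = \<sigma> ` fvt t" for t :: "'a tm" by (induction t) auto
  then show ?case by auto
next
  case (Less t u)
  have "fvt (rename_tm \<sigma> t) = \<sigma> ` fvt t" for t :: "'a tm" by (induction t) auto
  then show ?case by auto
next
  case (Rl r ts)
  have "fvt (rename_tm \<sigma> t) = \<sigma> ` fvt t" for t :: "'a tm" by (induction t) auto
  then show ?case by auto
next
  case (Conj \<phi> \<psi>)
  then show ?case unfolding rename_fm.simps fv.simps image_Un by (intro Un_mono)
next
  case (Ex x \<phi>)
  let ?z = "Suc (\<Sum>y\<in>fv \<phi>. \<sigma> y)"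
  have "fv (rename_fm \<sigma> (Ex x \<phi>)) \<subseteq> (\<sigma>(x := ?z)) ` fv \<phi> - {?z}"
    unfolding rename_fm.simps fv.simps by (rule Diff_mono[OF Ex order_refl])
  then show ?case by (auto split: if_splits)
qed auto

locale std_model = std N for N :: "('f, 'r, nat) struct" +
  fixes M :: "('f, 'r, 'a) struct"
  assumes ta: "true_arithmetic N M"
begin

text \<open>\<open>true_arithmetic\<close> concerns sentences only, so the free variables are first
  bound by universal quantifiers, written as a negated \<open>exs\<close>.\<close>

lemma valid_transfer: assumes "\<And>e. sat N e \<phi>" shows "sat M e \<phi>"
proof -
  obtain K where K: "fv \<phi> \<subseteq> {..<K}"
    using finite_fv[of \<phi>] finite_nat_iff_bounded by auto
  let ?\<chi> = "Neg (exs K (Neg \<phi>))"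
  have "fv ?\<chi> = {}" using K by (auto simp: fv_exs)
  moreover have "\<forall>e. sat N e ?\<chi>" using assms by (simp add: sat_exs)
  ultimately have "sat M e ?\<chi>" using ta unfolding true_arithmetic_def by blast
  then show ?thesis by (auto simp: sat_exs)
qed

text \<open>Pitfall: \<open>holds R\<close> and \<open>holds (\<lambda>e. \<not> R e)\<close> are both false everywhere if \<open>R\<close> is not arithmetical.\<close>

definition holds :: "((nat \<Rightarrow> nat) \<Rightarrow> bool) \<Rightarrow> (nat \<Rightarrow> 'a) \<Rightarrow> bool" where
  "holds R e \<longleftrightarrow> (\<exists>\<phi>. (\<forall>e. sat N e \<phi> \<longleftrightarrow> R e) \<and> sat M e \<phi>)"

lemma holds_iff:
  assumes "\<And>e. sat N e \<phi> \<longleftrightarrow> R e" shows "holds R e \<longleftrightarrow> sat M e \<phi>"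
proof
  assume "holds R e"
  then obtain \<psi> where \<psi>: "\<forall>e. sat N e \<psi> \<longleftrightarrow> R e" "sat M e \<psi>" by (auto simp: holds_def)
  have "sat M e (Neg (Conj \<psi> (Neg \<phi>)))" by (rule valid_transfer) (simp add: \<psi>(1) assms)
  then show "sat M e \<phi>" using \<psi>(2) by simp
qed (use assms in \<open>auto simp: holds_def\<close>)

lemma arith_formula:
  assumes "arith_rel R" shows "\<exists>\<phi>. (\<forall>e. sat N e \<phi> \<longleftrightarrow> R e) \<and> (\<forall>e. holds R e \<longleftrightarrow> sat M e \<phi>)"
  using assms holds_iff unfolding arith_rel_def by blast

lemma holds_Not: assumes "arith_rel R" shows "holds (\<lambda>e. \<not> R e) e \<longleftrightarrow> \<not> holds R e"
proof -
  obtain \<phi> where \<phi>: "\<And>e. sat N e \<phi> \<longleftrightarrow> R e" "\<And>e. holds R e \<longleftrightarrow> sat M e \<phi>"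
    using arith_formula[OF assms] by blast
  have "holds (\<lambda>e. \<not> R e) e \<longleftrightarrow> sat M e (Neg \<phi>)" by (rule holds_iff) (simp add: \<phi>(1))
  then show ?thesis using \<phi>(2) by simp
qed

lemma holds_conj:
  assumes "arith_rel R" "arith_rel S" shows "holds (\<lambda>e. R e \<and> S e) e \<longleftrightarrow> holds R e \<and> holds S e"
proof -
  obtain \<phi> where \<phi>: "\<And>e. sat N e \<phi> \<longleftrightarrow> R e" "\<And>e. holds R e \<longleftrightarrow> sat M e \<phi>"
    using arith_formula[OF assms(1)] by blast
  obtain \<psi> where \<psi>: "\<And>e. sat N e \<psi> \<longleftrightarrow> S e" "\<And>e. holds S e \<longleftrightarrow> sat M e \<psi>"
    using arith_formula[OF assms(2)] by blast
  have "holds (\<lambda>e. R e \<and> S e) e \<longleftrightarrow> sat M e (Conj \<phi> \<psi>)" by (rule holds_iff) (simp add: \<phi>(1) \<psi>(1))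
  then show ?thesis using \<phi>(2) \<psi>(2) by simp
qed

lemma holds_conjI:
  assumes "arith_rel R \<and> holds R e" "arith_rel S \<and> holds S e"
  shows "arith_rel (\<lambda>e. R e \<and> S e) \<and> holds (\<lambda>e. R e \<and> S e) e"
  using assms by (simp add: holds_conj arith_rel_conj)

text \<open>The transfer principle in use below: an implication that is proved in HOL for all
  standard environments is a true sentence, provided that both sides are arithmetical.\<close>

lemma holds_mono:
  assumes "arith_rel R" "arith_rel S" "\<And>e. R e \<Longrightarrow> S e" "holds R e" shows "holds S e"
proof -
  obtain \<phi> where \<phi>: "\<And>e. sat N e \<phi> \<longleftrightarrow> R e" "\<And>e. holds R e \<longleftrightarrow> sat M e \<phi>"
    using arith_formula[OF assms(1)] by blast
  obtain \<psi> where \<psi>: "\<And>e. sat N e \<psi> \<longleftrightarrow> S e" "\<And>e. holds S e \<longleftrightarrow> sat M e \<psi>"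
    using arith_formula[OF assms(2)] by blast
  have "sat M e (Neg (Conj \<phi> (Neg \<psi>)))" by (rule valid_transfer) (use assms(3) in \<open>simp add: \<phi>(1) \<psi>(1)\<close>)
  then show ?thesis using assms(4) by (simp add: \<phi>(2) \<psi>(2))
qed

lemma holds_imp:
  assumes "arith_rel R" "arith_rel S" shows "holds (\<lambda>e. R e \<longrightarrow> S e) e \<longleftrightarrow> (holds R e \<longrightarrow> holds S e)"
  using holds_Not[OF arith_rel_conj[OF assms(1) arith_rel_Not[OF assms(2)]], of e]
    holds_conj[OF assms(1) arith_rel_Not[OF assms(2)], of e] holds_Not[OF assms(2), of e] by simp

lemma arith_rel_Ex_upd:
  assumes "arith_rel R" shows "arith_rel (\<lambda>e. \<exists>a. R (e(x := a)))"
    and "holds (\<lambda>e. \<exists>a. R (e(x := a))) e \<longleftrightarrow> (\<exists>a. holds R (e(x := a)))"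
proof -
  obtain \<phi> where \<phi>: "\<And>e. sat N e \<phi> \<longleftrightarrow> R e" "\<And>e. holds R e \<longleftrightarrow> sat M e \<phi>"
    using arith_formula[OF assms] by blast
  have *: "sat N e (Ex x \<phi>) \<longleftrightarrow> (\<exists>a. R (e(x := a)))" for e by (simp add: \<phi>(1))
  then show "arith_rel (\<lambda>e. \<exists>a. R (e(x := a)))" unfolding arith_rel_def by blast
  show "holds (\<lambda>e. \<exists>a. R (e(x := a))) e \<longleftrightarrow> (\<exists>a. holds R (e(x := a)))"
    by (simp add: holds_iff[OF *] \<phi>(2))
qed

lemma arith_rel_All_upd:
  assumes "arith_rel R" shows "arith_rel (\<lambda>e. \<forall>a. R (e(x := a)))"
    and "holds (\<lambda>e. \<forall>a. R (e(x := a))) e \<longleftrightarrow> (\<forall>a. holds R (e(x := a)))"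
proof -
  note n = arith_rel_Not[OF assms]
  have *: "(\<lambda>e. \<forall>a. R (e(x := a))) = (\<lambda>e. \<not> (\<exists>a. \<not> R (e(x := a))))" by simp
  show "arith_rel (\<lambda>e. \<forall>a. R (e(x := a)))" unfolding * by (rule arith_rel_Not[OF arith_rel_Ex_upd(1)[OF n]])
  show "holds (\<lambda>e. \<forall>a. R (e(x := a))) e \<longleftrightarrow> (\<forall>a. holds R (e(x := a)))"
    unfolding * holds_Not[OF arith_rel_Ex_upd(1)[OF n]] arith_rel_Ex_upd(2)[OF n] holds_Not[OF assms] by simp
qed

text \<open>Finitely many formulas have a conjunction. Infinite families have none in general; for
  these saturation is needed.\<close>

lemma arith_rel_Ball:
  assumes "finite C" "\<And>t. t \<in> C \<Longrightarrow> arith_rel (R t)"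
  shows "arith_rel (\<lambda>e. \<forall>t\<in>C. R t e)" and "holds (\<lambda>e. \<forall>t\<in>C. R t e) e \<longleftrightarrow> (\<forall>t\<in>C. holds (R t) e)"
proof -
  have "arith_rel (\<lambda>e. \<forall>t\<in>C. R t e) \<and> (holds (\<lambda>e. \<forall>t\<in>C. R t e) e \<longleftrightarrow> (\<forall>t\<in>C. holds (R t) e))"
    using assms
  proof (induction C rule: finite_induct)
    case empty
    have "holds (\<lambda>e. True) e \<longleftrightarrow> sat M e (Eq Zero Zero)" by (rule holds_iff) simp
    then show ?case by (simp add: arith_rel_const)
  next
    case (insert t C)
    then show ?case using holds_conj[of "R t" "\<lambda>e. \<forall>t\<in>C. R t e" e] arith_rel_conj[of "R t" "\<lambda>e. \<forall>t\<in>C. R t e"] by simp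
  qed
  then show "arith_rel (\<lambda>e. \<forall>t\<in>C. R t e)" "holds (\<lambda>e. \<forall>t\<in>C. R t e) e \<longleftrightarrow> (\<forall>t\<in>C. holds (R t) e)"
    by blast+
qed

text \<open>A true \<open>interp\<close> statement brings a defining formula along. So the
  hypotheses themselves supply the definability of the cube root, of the set system and of
  legality.\<close>

lemma interp_arith:
  assumes "interp N M R as" "length as = k" shows "arith_rel (\<lambda>e. R (map e [0..<k]))"
proof -
  obtain \<phi> where \<phi>: "definable_by N k \<phi> R" using assms by (auto simp: interp_def)
  have "sat N e \<phi> \<longleftrightarrow> R (map e [0..<k])" for e
  proof -
    have "sat N e \<phi> \<longleftrightarrow> sat N (env N (map e [0..<k])) \<phi>"
      by (rule sat_cong) (use \<phi> in \<open>auto simp: env_def definable_by_def\<close>)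
    then show ?thesis using \<phi> by (simp add: definable_by_def)
  qed
  then show ?thesis unfolding arith_rel_def by blast
qed

lemma arith_rel_map:
  assumes "arith_rel (\<lambda>e. R (map e [0..<length ps]))" shows "arith_rel (\<lambda>e. R (map e ps))"
proof -
  have "map (\<lambda>i. e (ps ! i)) [0..<length ps] = map e ps" for e :: "nat \<Rightarrow> nat"
    by (rule nth_equalityI) auto
  then show ?thesis using arith_rel_rename[OF assms, of "\<lambda>i. ps ! i"] by simp
qed

text \<open>Variables from \<open>k\<close> on are irrelevant for \<open>R\<close>; they are renamed to \<open>0\<close> to get a formula of the
  required form.\<close>

lemma interp_holds:
  assumes R: "arith_rel (\<lambda>e. R (map e [0..<length ps]))" and ps: "ps \<noteq> []"
  shows "interp N M R (map E ps) \<longleftrightarrow> holds (\<lambda>e. R (map e ps)) E"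
proof -
  let ?k = "length ps"
  obtain \<phi> where \<phi>: "\<And>e. sat N e \<phi> \<longleftrightarrow> R (map e [0..<?k])" using R by (auto simp: arith_rel_def)
  define \<sigma> where "\<sigma> i = (if i < ?k then i else 0)" for i
  let ?\<psi> = "rename_fm \<sigma> \<phi>"
  have fv: "fv ?\<psi> \<subseteq> {..<?k}"
    by (rule order.trans[OF fv_rename_fm]) (use ps in \<open>auto simp: \<sigma>_def\<close>)
  have \<psi>: "sat N e ?\<psi> \<longleftrightarrow> R (map e [0..<?k])" for e
  proof -
    have "map (\<lambda>i. e (\<sigma> i)) [0..<?k] = map e [0..<?k]" by (simp add: \<sigma>_def)
    then show ?thesis by (simp only: sat_rename_fm \<phi>)
  qed
  have "map (env N ns) [0..<?k] = ns" if "length ns = ?k" for ns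
    using that by (intro nth_equalityI) (auto simp: env_def)
  then have "definable_by N (length (map E ps)) ?\<psi> R"
    unfolding definable_by_def length_map using fv \<psi> by metis
  then have "interp N M R (map E ps) \<longleftrightarrow> sat M (env M (map E ps)) ?\<psi>" by (rule interp_iff[OF ta])
  also have "\<dots> \<longleftrightarrow> sat M (\<lambda>i. E (ps ! i)) ?\<psi>"
    by (rule sat_cong) (use fv in \<open>auto simp: env_def\<close>)
  also have "\<dots> \<longleftrightarrow> holds (\<lambda>e. R (map e ps)) E"
  proof -
    have "map (\<lambda>i. e (ps ! i)) [0..<?k] = map e ps" for e :: "nat \<Rightarrow> nat" by (rule nth_equalityI) auto
    then have "sat N e (rename_fm (\<lambda>i. ps ! i) ?\<psi>) \<longleftrightarrow> R (map e ps)" for e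
      by (simp only: sat_rename_fm[of N e] \<psi>)
    from holds_iff[OF this] show ?thesis by (simp only: sat_rename_fm[of M E])
  qed
  finally show ?thesis .
qed

lemma interp_transfer:
  assumes "interp N M R as" "as = map E ps" "ps \<noteq> []"
  shows "arith_rel (\<lambda>e. R (map e ps))" "holds (\<lambda>e. R (map e ps)) E"
  using interp_arith[of R as "length ps"] arith_rel_map[of R ps] interp_holds[of R ps E] assms
  by simp_all

lemma holds_eq_numeral: "holds (\<lambda>e. e x = k) E \<longleftrightarrow> E x = numeral_of M k"
proof -
  define num :: "nat \<Rightarrow> 'f tm" where "num = rec_nat Zero (\<lambda>_ t. Plus t One)"
  have "val N e (num k) = k" for e by (induction k) (auto simp: num_def)
  then have "holds (\<lambda>e. e x = k) E \<longleftrightarrow> sat M E (Eq (Var x) (num k))" by (intro holds_iff) simp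
  also have "val M E (num k) = numeral_of M k" by (induction k) (auto simp: num_def)
  then have "sat M E (Eq (Var x) (num k)) \<longleftrightarrow> E x = numeral_of M k" by simp
  finally show ?thesis .
qed

text \<open>Below a standard \<open>k\<close> there are only the finitely many numerals, and a
  nonstandard element equals none of them.\<close>

lemma holds_ge_nonstandard:
  assumes "nonstandard M (E x)" shows "holds (\<lambda>e. k \<le> e x) E"
proof (rule ccontr)
  assume *: "\<not> holds (\<lambda>e. k \<le> e x) E"
  have ar: "arith_rel (\<lambda>e. k \<le> e x)" "arith_rel (\<lambda>e. e x \<noteq> j)" for j by (intro arith_intros)+
  have "holds (\<lambda>e. \<forall>j\<in>{..<k}. e x \<noteq> j) E"
    using assms ar by (subst arith_rel_Ball(2))
      (auto simp: holds_Not arith_rel_eq arith_fun_var arith_fun_const holds_eq_numeral nonstandard_def)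
  then show False
    using * by (rule_tac notE[OF * holds_mono[OF arith_rel_Ball(1) ar(1)]]) (use ar in auto)
qed

end

section \<open>Countability of the Students and the saturation argument\<close>

instance prog :: countable by countable_datatype

text \<open>By determinism a program determines the function that it computes, and there are
  countably many programs.\<close>

lemma countable_polytime: "countable {S. polytime S}"
proof -
  define f where "f p x = (SOME y. \<exists>t s. exec p ((\<lambda>_. [])(0 := x)) t s \<and> s 0 = y)" for p x
  have "{S. polytime S} \<subseteq> range f"
  proof
    fix S assume "S \<in> {S. polytime S}"
    then obtain p where p: "\<And>x. \<exists>t s. exec p ((\<lambda>_. [])(0 := x)) t s \<and> s 0 = S x"
      unfolding polytime_def by blast
    have "S x = f p x" for x
    proof -
      have "\<exists>t s. exec p ((\<lambda>_. [])(0 := x)) t s \<and> s 0 = f p x"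
        unfolding f_def using p[of x] by (rule_tac someI[of _ "S x"])
      then show ?thesis using p[of x] exec_determ by metis
    qed
    then show "S \<in> range f" by blast
  qed
  moreover have "countable (range f)" by simp
  ultimately show ?thesis by (rule countable_subset)
qed

theorem theorem3p1:
  fixes N :: "('f, 'r, nat) struct"
    and M :: "('f, 'r, 'a) struct"
    and h :: "bool list \<Rightarrow> bool list"
    and B :: "bool list \<Rightarrow> bool"
    and n m l J b w :: 'a
    and q :: "nat poly"
  assumes "standard_model N"
    and "true_arithmetic N M"
    and "nonstandard_model M"
    and "aleph1_saturated M"
    and "hard_bit_permutation h B"
    and "nonstandard M n"
    and "m = plus M n (one M)"
    and "interp N M (\<lambda>v. int (v ! 1) = \<lfloor>root 3 (real (v ! 0))\<rfloor>) [n, l]"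
    and "interp N M (\<lambda>v. set_system (v ! 0) (v ! 1) (v ! 2) (str (v ! 3))) [n, m, l, J]"
    and "interp N M
           (\<lambda>v. str (v ! 3) \<in> cube (v ! 1)
                - NW (\<lambda>u. B (preimage h u)) (v ! 0) (v ! 1) (str (v ! 2)) ` cube (v ! 0))
           [n, m, J, b]"
    and "interp N M (\<lambda>v. length (str (v ! 1)) \<le> poly q (v ! 0)) [n, w]"
  shows "\<exists>H c. elemsM N M H \<subseteq> cubeM N M n
           \<and> cardM N M H c \<and> nonstandard M c
           \<and> (\<forall>\<alpha> \<in> F_unif N M h B n J b w. elemsM N M H \<subseteq> dom \<alpha>)"
proof -
  interpret std_model N M using assms(1,2) by unfold_locales
  have h: "polytime h" "\<And>l. bij_betw h (cube l) (cube l)" "polytime (\<lambda>v. [B v])"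
    using assms(5) by (auto simp: hard_bit_permutation_def)
  \<comment> \<open>Variable 0 is the unknown code of \<open>H\<close>, as in the definition of
    saturation; variables 1 to 6 hold the parameters. Variable 7 will hold a sample or a
    cardinality, variable 8 an output.\<close>
  define E where "E a = env M [a, n, m, l, J, b, w]" for a
  have E: "E a 0 = a" "E a 1 = n" "E a 2 = m" "E a 3 = l" "E a 4 = J" "E a 5 = b" "E a 6 = w" "E a (Suc 0) = n" for a
    by (simp_all add: E_def env_def)
  have E0: "(E x)(0 := a) = E a" for x a by (auto simp: E_def env_def fun_eq_iff nth_Cons')
  let ?z = "E (zero M)"

  have maps: "[n, l] = map ?z [1, 3]" "[n, m, l, J] = map ?z [1, 2, 3, 4]"
    "[n, m, J, b] = map ?z [1, 2, 4, 5]" "[n, w] = map ?z [1, 6]" by (simp_all add: E)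
  note R1 = interp_transfer[OF assms(8) maps(1) list.distinct(2)]
  note R2 = interp_transfer[OF assms(9) maps(2) list.distinct(2)]
  note R3 = interp_transfer[OF assms(10) maps(3) list.distinct(2)]
  note R4 = interp_transfer[OF assms(11) maps(4) list.distinct(2)]
  have R5: "arith_rel (\<lambda>e. e 2 = Suc (e 1))" "holds (\<lambda>e. e 2 = Suc (e 1)) ?z"
  proof -
    show "arith_rel (\<lambda>e. e 2 = Suc (e 1))" by (intro arith_intros)
    have "holds (\<lambda>e. e 2 = Suc (e 1)) ?z \<longleftrightarrow> sat M ?z (Eq (Var 2) (Plus (Var 1) One))"
      by (rule holds_iff) simp
    then show "holds (\<lambda>e. e 2 = Suc (e 1)) ?z" using assms(7) by (simp add: E E[unfolded One_nat_def])
  qed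
  have R6: "arith_rel (\<lambda>e. k \<le> e 1)" "holds (\<lambda>e. k \<le> e 1) ?z" for k
    using assms(6) by (auto intro!: arith_intros holds_ge_nonstandard simp: E)

  define In where "In e \<longleftrightarrow> str (e 7) \<in> cube (e 1)" for e :: "nat \<Rightarrow> nat"
  define Mem where "Mem e \<longleftrightarrow> e 7 \<in> set_decode (e 0)" for e :: "nat \<Rightarrow> nat"
  define Out where "Out s e \<longleftrightarrow> student_run h B (fst s) (str (e 4)) (str (e 5)) (str (e 6)) (str (e 7)) (snd s) []
     = Output (str (e 8))" for s and e :: "nat \<Rightarrow> nat"
  define Leg where "Leg s e \<longleftrightarrow> student_run h B (fst s) (str (e 4)) (str (e 5)) (str (e 6)) (str (e 7)) (snd s) []
     \<noteq> Illegal" for s and e :: "nat \<Rightarrow> nat"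
  \<comment> \<open>Legality on all samples depends on the parameters only and can therefore join
    the premise of the transferred implication.\<close>
  define AllLeg where "AllLeg s e \<longleftrightarrow> (\<forall>x. In (e(7 := x)) \<longrightarrow> Leg s (e(7 := x)))" for s e
  define AllOut where "AllOut s e \<longleftrightarrow> (\<forall>x. Mem (e(7 := x)) \<longrightarrow> (\<exists>y. Out s (e(7 := x, 8 := y))))" for s e
  define Big where "Big k e \<longleftrightarrow> k \<le> card (set_decode (e 0)) \<and> (\<forall>x. Mem (e(7 := x)) \<longrightarrow> In (e(7 := x)))" for k e
  have ar_In: "arith_rel In" and ar_Mem: "arith_rel Mem"
    unfolding In_def Mem_def cube_def mem_Collect_eq by (intro arith_intros)+
  have ar_Out: "arith_rel (Out s)" if "polytime (fst s)" for s
    unfolding Out_def by (intro arith_rel_student_run h that arith_intros)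
  have interp_In: "x \<in> cubeM N M n \<longleftrightarrow> holds In ((E a)(7 := x))" for x a
  proof -
    have "arith_rel (\<lambda>e. length (str (e 1)) = e 0)" by (intro arith_intros)
    then have "arith_rel (\<lambda>e. (\<lambda>v. str (v ! 1) \<in> cube (v ! 0)) (map e [0..<length [1, 7 :: nat]]))"
      by (simp add: cube_def)
    from interp_holds[OF this, of "(E a)(7 := x)"] show ?thesis
      by (simp add: cubeM_def In_def[abs_def] E)
  qed
  have interp_Mem: "x \<in> elemsM N M a \<longleftrightarrow> holds Mem ((E a)(7 := x))" for x a
  proof -
    have "arith_rel (\<lambda>e. e 1 \<in> set_decode (e 0))" by (intro arith_intros)
    then have "arith_rel (\<lambda>e. (\<lambda>v. v ! 1 \<in> set_decode (v ! 0)) (map e [0..<length [0, 7 :: nat]]))"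
      by simp
    from interp_holds[OF this, of "(E a)(7 := x)"] show ?thesis
      by (simp add: elemsM_def Mem_def[abs_def] E)
  qed
  have interp_card: "cardM N M a c \<longleftrightarrow> holds (\<lambda>e. card (set_decode (e 0)) = e 7) ((E a)(7 := c))" for a c
  proof -
    have "arith_rel (\<lambda>e. card (set_decode (e 0)) = e 1)" by (intro arith_intros)
    then have "arith_rel (\<lambda>e. (\<lambda>v. card (set_decode (v ! 0)) = v ! 1) (map e [0..<length [0, 7 :: nat]]))"
      by simp
    from interp_holds[OF this, of "(E a)(7 := c)"] show ?thesis
      by (simp add: cardM_def E)
  qed
  have interp_Out: "interp N M
               (\<lambda>v. student_run h B S (str (v ! 0)) (str (v ! 1)) (str (v ! 2)) (str (v ! 3)) c []
                      = Output (str (v ! 4))) [J, b, w, x, y] \<longleftrightarrow> holds (Out (S, c)) ((E a)(7 := x, 8 := y))"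
    if "polytime S" for S c x y a
  proof -
    have "arith_rel (\<lambda>e. student_run h B S (str (e 0)) (str (e 1)) (str (e 2)) (str (e 3)) c []
                      = Output (str (e 4)))"
      by (intro arith_rel_student_run h that arith_intros)
    then have "arith_rel (\<lambda>e. (\<lambda>v. student_run h B S (str (v ! 0)) (str (v ! 1)) (str (v ! 2)) (str (v ! 3)) c []
                      = Output (str (v ! 4))) (map e [0..<length [4, 5, 6, 7, 8 :: nat]]))"
      by (simp add: eval_nat_numeral)
    from interp_holds[OF this, of "(E a)(7 := x, 8 := y)"] show ?thesis
      by (simp add: Out_def[abs_def] E numeral_3_eq_3 numeral_2_eq_2)
  qed

  \<comment> \<open>The pairs of Student and query bound that are legal on all samples in
    \<open>M\<close>; by definition of \<open>F_unif\<close> every \<open>\<alpha>\<close> comes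
    from such a pair.\<close>
  define L where "L = {s. polytime (fst s) \<and> (\<forall>x\<in>cubeM N M n.
     interp N M (\<lambda>v. student_run h B (fst s) (str (v ! 0)) (str (v ! 1)) (str (v ! 2)) (str (v ! 3)) (snd s) []
        \<noteq> Illegal) [J, b, w, x])}"
  have ar_Leg: "arith_rel (Leg s)" and AllLeg: "arith_rel (AllLeg s)" "holds (AllLeg s) ?z" if "s \<in> L" for s
  proof -
    \<comment> \<open>Definability of legality is read off from its truth at one sample, so
      \<open>M\<close> has to contain a sample; in \<open>N\<close> the string of ones is a
      witness.\<close>
    have "holds (\<lambda>e. \<exists>x. In (e(7 := x))) ?z"
    proof (rule holds_mono[OF R5(1) arith_rel_Ex_upd(1)[OF ar_In] _ R5(2)])
      show "\<exists>x. In (e(7 := x))" for e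
        by (rule exI[of _ "code (replicate (e 1) True)"]) (simp add: In_def cube_def)
    qed
    then obtain x where "x \<in> cubeM N M n"
      unfolding arith_rel_Ex_upd(2)[OF ar_In] using interp_In by blast
    moreover have leg: "arith_rel (Leg s)" "holds (Leg s) (?z(7 := x))" if "x \<in> cubeM N M n" for x
    proof -
      have i: "interp N M (\<lambda>v. student_run h B (fst s) (str (v ! 0)) (str (v ! 1)) (str (v ! 2)) (str (v ! 3)) (snd s) []
        \<noteq> Illegal) [J, b, w, x]" using \<open>s \<in> L\<close> that by (simp add: L_def)
      have "[J, b, w, x] = map (?z(7 := x)) [4, 5, 6, 7]" by (simp add: E)
      from interp_transfer[OF i this] show "arith_rel (Leg s)" "holds (Leg s) (?z(7 := x))"
        by (simp_all add: Leg_def[abs_def] numeral_3_eq_3 numeral_2_eq_2)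
    qed
    ultimately show ar: "arith_rel (Leg s)" by blast
    have eq: "AllLeg s = (\<lambda>e. \<forall>x. (\<lambda>e. In e \<longrightarrow> Leg s e) (e(7 := x)))" by (simp add: AllLeg_def fun_eq_iff)
    note imp = arith_rel_imp[OF ar_In ar]
    show "arith_rel (AllLeg s)" unfolding eq by (rule arith_rel_All_upd(1)[OF imp])
    show "holds (AllLeg s) ?z" unfolding eq arith_rel_All_upd(2)[OF imp] holds_imp[OF ar_In ar]
      using leg(2) interp_In by blast
  qed

  \<comment> \<open>The type to be realised: \<open>Inl s\<close> demands that \<open>s\<close>
    outputs on all members, \<open>Inr k\<close> that there are at least \<open>k\<close> members
    and that all members are samples.\<close>
  define rel where "rel t = (case t of Inl s \<Rightarrow> AllOut s | Inr k \<Rightarrow> Big k)" for t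
  let ?I = "Inl ` L \<union> range Inr"
  have AllOut_eq: "AllOut s = (\<lambda>e. \<forall>x. (\<lambda>e. Mem e \<longrightarrow> (\<exists>y. Out s (e(8 := y)))) (e(7 := x)))" for s
    by (simp add: AllOut_def fun_eq_iff)
  have ar_outs: "arith_rel (\<lambda>e. \<exists>y. Out s (e(8 := y)))" "arith_rel (\<lambda>e. Mem e \<longrightarrow> (\<exists>y. Out s (e(8 := y))))"
    if "s \<in> L" for s
    using that by (auto simp: L_def intro!: arith_rel_imp ar_Mem arith_rel_Ex_upd(1) ar_Out)
  have ar_card: "arith_rel (\<lambda>e. k \<le> card (set_decode (e 0)))" for k by (intro arith_intros)
  have Big_eq: "Big k = (\<lambda>e. k \<le> card (set_decode (e 0)) \<and> (\<forall>x. (\<lambda>e. Mem e \<longrightarrow> In e) (e(7 := x))))" for k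
    by (simp add: Big_def fun_eq_iff)
  have ar_sub: "arith_rel (\<lambda>e. Mem e \<longrightarrow> In e)" by (intro arith_rel_imp ar_Mem ar_In)
  have ar_rel: "arith_rel (rel t)" if "t \<in> ?I" for t
    using that unfolding rel_def
    by (auto simp: AllOut_eq Big_eq intro!: arith_rel_All_upd(1) arith_rel_conj ar_outs ar_card ar_sub)

  have finite_sat: "\<exists>a. \<forall>t\<in>C. holds (rel t) (E a)" if C: "C \<subseteq> ?I" "finite C" for C
  proof -
    define F where "F = {s. Inl s \<in> C}"
    \<comment> \<open>The sum of the size demands in \<open>C\<close> is an upper bound for each of
      them.\<close>
    define k where "k = (\<Sum>t\<in>C. case t of Inl s \<Rightarrow> 0 | Inr k \<Rightarrow> k)"
    have "F = Inl -` C" by (auto simp: F_def)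
    then have F: "finite F" "F \<subseteq> L" using C by (auto simp: finite_vimageI)
    have k: "k' \<le> k" if "Inr k' \<in> C" for k'
      using member_le_sum[OF that, of "\<lambda>t. case t of Inl s \<Rightarrow> 0 | Inr k \<Rightarrow> k"] C(2) by (simp add: k_def)
    obtain Ss where Ss: "set Ss = F" using finite_list[OF F(1)] by blast
    have poly: "\<forall>s\<in>set Ss. polytime (fst s)" using Ss F(2) by (auto simp: L_def)
    let ?Q = "\<lambda>n. \<forall>m l J b w. m = Suc n \<longrightarrow> int l = \<lfloor>root 3 (real n)\<rfloor> \<longrightarrow>
      set_system n m l J \<longrightarrow> length b = m \<longrightarrow> length w \<le> poly q n \<longrightarrow>
      (\<forall>(S, c)\<in>set Ss. \<forall>\<omega>\<in>cube n. student_run h B S J b w \<omega> c [] \<noteq> Illegal) \<longrightarrow>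
      k \<le> card (finishing h B Ss n J b w)"
    from many_outputs[where Ss = Ss and q = q and C = k, OF assms(5) poly]
    obtain n0 where "\<forall>n\<ge>n0. ?Q n" unfolding eventually_sequentially by (rule exE)
    note n0 = this[rule_format]
    have ar_leg: "arith_rel (\<lambda>e. \<forall>s\<in>F. AllLeg s e)" "holds (\<lambda>e. \<forall>s\<in>F. AllLeg s e) ?z"
      using arith_rel_Ball[OF F(1), of AllLeg] AllLeg F(2) by blast+
    note hyp = holds_conjI[OF conjI[OF R1] holds_conjI[OF conjI[OF R2] holds_conjI[OF conjI[OF R3]
      holds_conjI[OF conjI[OF R4] holds_conjI[OF conjI[OF R5] holds_conjI[OF conjI[OF R6[of n0]] conjI[OF ar_leg]]]]]]]
    have ar_C: "arith_rel (\<lambda>e. \<forall>t\<in>C. rel t e)" using C ar_rel by (intro arith_rel_Ball(1)) auto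
    \<comment> \<open>In \<open>N\<close>, any parameters satisfying the hypotheses admit the set of
      all finishing samples as witness, by \<open>many_outputs\<close>; this implication is
      transferred. The threshold \<open>n0\<close> is standard, hence below the nonstandard
      \<open>n\<close>.\<close>
    have "holds (\<lambda>e. \<exists>a. (\<lambda>e. \<forall>t\<in>C. rel t e) (e(0 := a))) ?z"
    proof (rule holds_mono[OF conjunct1[OF hyp] arith_rel_Ex_upd(1)[OF ar_C] _ conjunct2[OF hyp]])
      fix e :: "nat \<Rightarrow> nat"
      assume e: "int (map e [1, 3] ! 1) = \<lfloor>root 3 (real (map e [1, 3] ! 0))\<rfloor> \<and>
        set_system (map e [1, 2, 3, 4] ! 0) (map e [1, 2, 3, 4] ! 1) (map e [1, 2, 3, 4] ! 2) (str (map e [1, 2, 3, 4] ! 3)) \<and>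
        str (map e [1, 2, 4, 5] ! 3) \<in> cube (map e [1, 2, 4, 5] ! 1) -
           NW (\<lambda>u. B (preimage h u)) (map e [1, 2, 4, 5] ! 0) (map e [1, 2, 4, 5] ! 1) (str (map e [1, 2, 4, 5] ! 2)) `
             cube (map e [1, 2, 4, 5] ! 0) \<and>
        length (str (map e [1, 6] ! 1)) \<le> poly q (map e [1, 6] ! 0) \<and>
        e 2 = Suc (e 1) \<and> n0 \<le> e 1 \<and> (\<forall>s\<in>F. AllLeg s e)"
      let ?X = "finishing h B Ss (e 1) (str (e 4)) (str (e 5)) (str (e 6))"
      have leg: "student_run h B S (str (e 4)) (str (e 5)) (str (e 6)) \<omega> c [] \<noteq> Illegal"
        if "(S, c) \<in> set Ss" "\<omega> \<in> cube (e 1)" for S c \<omega>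
      proof -
        have "In (e(7 := code \<omega>)) \<longrightarrow> Leg (S, c) (e(7 := code \<omega>))"
          using e that(1) Ss unfolding AllLeg_def by blast
        then show ?thesis using that(2) by (simp add: In_def Leg_def)
      qed
      have X: "k \<le> card ?X"
        by (rule n0[of _ "e 2" "e 3"]) (use e leg in \<open>auto simp: cube_def numeral_2_eq_2 numeral_3_eq_3\<close>)
      have fin: "finite ?X" using card_cube by (auto simp: finishing_def)
      define a where "a = set_encode (code ` ?X)"
      have a: "set_decode a = code ` ?X" unfolding a_def using fin by (intro set_encode_inverse) simp
      have "card (set_decode a) = card ?X"
        unfolding a by (rule card_image) (simp add: inj_on_def code_inj)
      moreover have "rel t (e(0 := a))" if "t \<in> C" for t
      proof (cases t)
        case (Inl s)
        then have "s \<in> set Ss" using that Ss by (simp add: F_def)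
        moreover have "\<exists>y. Out s (e(0 := a, 7 := x, 8 := y))" if x: "x \<in> set_decode a" for x
        proof -
          obtain \<omega> where \<omega>: "\<omega> \<in> ?X" "x = code \<omega>" using x a by blast
          then obtain y where "student_run h B (fst s) (str (e 4)) (str (e 5)) (str (e 6)) \<omega> (snd s) [] = Output y"
            using \<open>s \<in> set Ss\<close> by (cases s) (auto simp: finishing_def)
          then show ?thesis using \<omega>(2) by (intro exI[of _ "code y"]) (simp add: Out_def)
        qed
        ultimately show ?thesis using Inl by (auto simp: rel_def AllOut_def Mem_def)
      next
        case (Inr k')
        then have "k' \<le> card ?X" using k that X by (blast intro: order.trans)
        then show ?thesis using Inr a calculation by (auto simp: rel_def Big_def Mem_def In_def finishing_def)
      qed
      ultimately show "\<exists>a. \<forall>t\<in>C. rel t (e(0 := a))" by blast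
    qed
    then show ?thesis
      unfolding arith_rel_Ex_upd(2)[OF ar_C] E0 using C ar_rel by (subst (asm) arith_rel_Ball(2)) auto
  qed

  have "\<forall>t\<in>?I. \<exists>\<phi>. \<forall>e. holds (rel t) e \<longleftrightarrow> sat M e \<phi>" using arith_formula ar_rel by blast
  then obtain form where form: "\<And>t e. t \<in> ?I \<Longrightarrow> holds (rel t) e \<longleftrightarrow> sat M e (form t)" by metis
  have "countable L"
  proof (rule countable_subset)
    show "L \<subseteq> {S. polytime S} \<times> UNIV" by (auto simp: L_def)
  qed (intro countable_SIGMA countable_polytime, simp)
  then have "countable ((\<lambda>t. (form t, ?z)) ` ?I)" by auto
  moreover have "\<exists>a. \<forall>(\<phi>, e)\<in>\<Delta>. sat M (e(0 := a)) \<phi>" if D: "\<Delta> \<subseteq> (\<lambda>t. (form t, ?z)) ` ?I" "finite \<Delta>" for \<Delta>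
  proof -
    obtain C where C: "C \<subseteq> ?I" "finite C" "\<Delta> = (\<lambda>t. (form t, ?z)) ` C"
      using finite_subset_image[OF D(2,1)] by blast
    obtain a where a: "\<forall>t\<in>C. holds (rel t) (E a)" using finite_sat[OF C(1,2)] by blast
    have "sat M (E a) (form t)" if "t \<in> C" for t
      using form[of t "E a"] a C(1) that by blast
    then show ?thesis unfolding C(3) by (intro exI[of _ a]) (auto simp: E0)
  qed
  ultimately have "\<exists>a. \<forall>(\<phi>, e)\<in>(\<lambda>t. (form t, ?z)) ` ?I. sat M (e(0 := a)) \<phi>"
    using assms(4) unfolding aleph1_saturated_def by blast
  then obtain H where "\<forall>t\<in>?I. sat M (E H) (form t)" by (auto simp: E0)
  then have H: "holds (rel t) (E H)" if "t \<in> ?I" for t using form that by blast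

  have Big: "holds (\<lambda>e. k \<le> card (set_decode (e 0))) (E H)" "holds (\<lambda>e. Mem e \<longrightarrow> In e) ((E H)(7 := x))" for k x
  proof -
    have "holds (Big k) (E H)" using H[of "Inr k"] by (simp add: rel_def)
    then show "holds (\<lambda>e. k \<le> card (set_decode (e 0))) (E H)" "holds (\<lambda>e. Mem e \<longrightarrow> In e) ((E H)(7 := x))"
      unfolding Big_eq holds_conj[OF ar_card arith_rel_All_upd(1)[OF ar_sub]] arith_rel_All_upd(2)[OF ar_sub] by auto
  qed
  have sub: "elemsM N M H \<subseteq> cubeM N M n"
    using Big(2) interp_Mem interp_In holds_imp[OF ar_Mem ar_In] by blast
  have ar_c: "arith_rel (\<lambda>e. card (set_decode (e 0)) = e 7)" by (intro arith_intros)
  have "holds (\<lambda>e. \<exists>c. (\<lambda>e. card (set_decode (e 0)) = e 7) (e(7 := c))) (E H)"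
    by (rule holds_mono[OF ar_card arith_rel_Ex_upd(1)[OF ar_c] _ Big(1)]) auto
  then obtain c where c: "holds (\<lambda>e. card (set_decode (e 0)) = e 7) ((E H)(7 := c))"
    unfolding arith_rel_Ex_upd(2)[OF ar_c] by blast
  have "c \<noteq> numeral_of M j" for j
  proof
    assume j: "c = numeral_of M j"
    have ar_j: "arith_rel (\<lambda>e. e 7 = j)" by (intro arith_intros)
    note ar_i = arith_rel_imp[OF ar_c arith_rel_Not[OF ar_j]]
    \<comment> \<open>\<open>H\<close> has at least \<open>Suc j\<close> members in
      \<open>M\<close>, hence its cardinality is not \<open>j\<close>.\<close>
    have "holds (\<lambda>e. \<forall>a. (\<lambda>e. card (set_decode (e 0)) = e 7 \<longrightarrow> \<not> e 7 = j) (e(7 := a))) (E H)"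
      by (rule holds_mono[OF ar_card arith_rel_All_upd(1)[OF ar_i] _ Big(1)[of "Suc j"]]) auto
    then have "holds (\<lambda>e. card (set_decode (e 0)) = e 7 \<longrightarrow> \<not> e 7 = j) ((E H)(7 := c))"
      unfolding arith_rel_All_upd(2)[OF ar_i] by blast
    then have "\<not> holds (\<lambda>e. e 7 = j) ((E H)(7 := c))"
      using c unfolding holds_imp[OF ar_c arith_rel_Not[OF ar_j]] holds_Not[OF ar_j] by blast
    then show False unfolding holds_eq_numeral using j by simp
  qed
  then have "nonstandard M c" by (auto simp: nonstandard_def)
  moreover have "cardM N M H c" using c interp_card by blast
  moreover have "elemsM N M H \<subseteq> dom \<alpha>" if \<alpha>: "\<alpha> \<in> F_unif N M h B n J b w" for \<alpha>
  proof
    fix x assume x: "x \<in> elemsM N M H"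
    obtain S c where S: "polytime S" "\<forall>x\<in>cubeM N M n. interp N M
            (\<lambda>v. student_run h B S (str (v ! 0)) (str (v ! 1)) (str (v ! 2)) (str (v ! 3)) c []
                   \<noteq> Illegal) [J, b, w, x]"
      and \<alpha>': "\<And>x y. x \<in> cubeM N M n \<Longrightarrow> \<alpha> x = Some y \<longleftrightarrow> interp N M
               (\<lambda>v. student_run h B S (str (v ! 0)) (str (v ! 1)) (str (v ! 2)) (str (v ! 3)) c []
                      = Output (str (v ! 4))) [J, b, w, x, y]"
      using \<alpha> unfolding F_unif_def by blast
    have L: "(S, c) \<in> L" using S by (simp add: L_def)
    then have "holds (AllOut (S, c)) (E H)" using H[of "Inl (S, c)"] by (simp add: rel_def)
    then have "holds (\<lambda>e. Mem e \<longrightarrow> (\<exists>y. Out (S, c) (e(8 := y)))) ((E H)(7 := x))"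
      unfolding AllOut_eq arith_rel_All_upd(2)[OF ar_outs(2)[OF L]] by blast
    then have "holds (\<lambda>e. \<exists>y. Out (S, c) (e(8 := y))) ((E H)(7 := x))"
      using x interp_Mem holds_imp[OF ar_Mem ar_outs(1)[OF L]] by blast
    then obtain y where "holds (Out (S, c)) ((E H)(7 := x, 8 := y))"
      using arith_rel_Ex_upd(2)[OF ar_Out[of "(S, c)"]] S(1) by auto
    then have "\<alpha> x = Some y" using \<alpha>' interp_Out[OF S(1)] x sub by blast
    then show "x \<in> dom \<alpha>" by blast
  qed
  ultimately show ?thesis using sub by blast
qed

end
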